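(* For every quantum channel $\mathcal{N}$, $Q(\mathcal{N})\le Q_\Gamma(\mathcal{N})\le Q_\Theta(\mathcal{N})$. Moreover, each of the two inequalities can be strict: there exist quantum channels with $Q(\mathcal{N})<Q_\Gamma(\mathcal{N})$, and quantum channels with $Q_\Gamma(\mathcal{N})<Q_\Theta(\mathcal{N})$.
   Context: For a channel $\mathcal{N}:\mathcal{L}(A')\to\mathcal{L}(B)$ with $A\cong A'$ and Choi matrix $J_{\mathcal{N}}=J_{AB}=\sum_{i,j}|i\rangle\langle j|_A\otimes\mathcal{N}(|i\rangle\langle j|_{A'})$, $\Gamma(\mathcal{N})$ is the optimal value of the SDP: maximize $\operatorname{tr}(J_{AB}R_{AB})$ over $R_{AB}\ge0$, $\rho_A\ge0$ with $\operatorname{tr}\rho_A=1$ and $-\rho_A\otimes\mathbb{1}_B\le R_{AB}^{T_B}\le\rho_A\otimes\mathbb{1}_B$ ($T_B$ = partial transpose on $B$), and $Q_\Gamma(\mathcal{N})=\log_2\Gamma(\mathcal{N})$. $Q_\Theta(\mathcal{N})=\log_2\|J_{\mathcal{N}}^{T_B}\|_{cb}$ is the Holevo–Werner partial transposition bound, where $\|J_{\mathcal{N}}^{T_B}\|_{cb}$ denotes the completely bounded trace norm (diamond norm) of the linear map whose Choi matrix is $J_{\mathcal{N}}^{T_B}$ (i.e. the map $T\circ\mathcal{N}$ with $T$ the transpose). $Q(\mathcal{N})$ is the quantum capacity of $\mathcal{N}$, $Q(\mathcal{N})=\lim_{n\to\infty}\frac1n I_C(\mathcal{N}^{\otimes n})$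 with $I_C$ the coherent information. *)

theory Defs
  imports Complex_Main "Jordan_Normal_Form.Char_Poly"
begin

definition mtrace :: "complex mat \<Rightarrow> complex" where
  "mtrace A = (\<Sum>i<dim_row A. A $$ (i,i))"

definition adj :: "complex mat \<Rightarrow> complex mat" where
  "adj A = mat (dim_col A) (dim_row A) (\<lambda>(i,j). cnj (A $$ (j,i)))"

definition psd :: "nat \<Rightarrow> complex mat \<Rightarrow> bool" where
  "psd n A \<longleftrightarrow> A \<in> carrier_mat n n \<and> adj A = A \<and>
     (\<forall>v \<in> carrier_vec n. 0 \<le> Re ((A *\<^sub>v v) \<bullet>c v))"

definition eigs :: "complex mat \<Rightarrow> complex multiset" where
  "eigs A = proots (char_poly A)"

definition trace_norm :: "complex mat \<Rightarrow> real" where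
  "trace_norm X = (\<Sum>ev\<in>#eigs (adj X * X). sqrt (Re ev))"

definition eta :: "real \<Rightarrow> real" where
  "eta x = (if x \<le> 0 then 0 else - x * log 2 x)"

definition entropy :: "complex mat \<Rightarrow> real" where
  "entropy \<rho> = (\<Sum>ev\<in>#eigs \<rho>. eta (Re ev))"

text \<open>Kronecker product A \<otimes> B, index (a,b) of the product corresponds to a * dim B + b.\<close>
definition kron :: "complex mat \<Rightarrow> complex mat \<Rightarrow> complex mat" where
  "kron A B = mat (dim_row A * dim_row B) (dim_col A * dim_col B)
     (\<lambda>(i,j). A $$ (i div dim_row B, j div dim_col B) * B $$ (i mod dim_row B, j mod dim_col B))"

definition unit_mat :: "nat \<Rightarrow> nat \<Rightarrow> nat \<Rightarrow> complex mat" where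
  "unit_mat d i j = mat d d (\<lambda>(p,q). if p = i \<and> q = j then 1 else 0)"

text \<open>(id_k \<otimes> \<Phi>)(X) for \<Phi> : L(C^dA) \<rightarrow> L(C^dB), X on C^k \<otimes> C^dA (reference first).\<close>
definition id_tensor :: "nat \<Rightarrow> nat \<Rightarrow> nat \<Rightarrow> (complex mat \<Rightarrow> complex mat) \<Rightarrow> complex mat \<Rightarrow> complex mat" where
  "id_tensor k dA dB \<Phi> X = mat (k * dB) (k * dB) (\<lambda>(p,q).
      \<Phi> (mat dA dA (\<lambda>(i,j). X $$ ((p div dB) * dA + i, (q div dB) * dA + j))) $$ (p mod dB, q mod dB))"

definition is_linear_map :: "nat \<Rightarrow> (complex mat \<Rightarrow> complex mat) \<Rightarrow> bool" where
  "is_linear_map dA \<Phi> \<longleftrightarrow>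
     (\<forall>X \<in> carrier_mat dA dA. \<forall>Y \<in> carrier_mat dA dA. \<Phi> (X + Y) = \<Phi> X + \<Phi> Y) \<and>
     (\<forall>X \<in> carrier_mat dA dA. \<forall>c. \<Phi> (c \<cdot>\<^sub>m X) = c \<cdot>\<^sub>m \<Phi> X)"

definition is_channel :: "nat \<Rightarrow> nat \<Rightarrow> (complex mat \<Rightarrow> complex mat) \<Rightarrow> bool" where
  "is_channel dA dB \<N> \<longleftrightarrow> 0 < dA \<and> 0 < dB \<and>
     is_linear_map dA \<N> \<and>
     (\<forall>X \<in> carrier_mat dA dA. \<N> X \<in> carrier_mat dB dB) \<and>
     (\<forall>X \<in> carrier_mat dA dA. mtrace (\<N> X) = mtrace X) \<and>
     (\<forall>k X. psd (k * dA) X \<longrightarrow> psd (k * dB) (id_tensor k dA dB \<N> X))"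

text \<open>Tensor product of maps \<Phi>1 : L(C^d1) \<rightarrow> L(C^e1), \<Phi>2 : L(C^d2) \<rightarrow> L(C^e2), defined by linear
  extension from matrix units: (\<Phi>1 \<otimes> \<Phi>2)(X) = \<Sum> X_{(i,k),(j,l)} \<Phi>1(|i><j|) \<otimes> \<Phi>2(|k><l|).\<close>
definition map_tensor :: "nat \<Rightarrow> nat \<Rightarrow> nat \<Rightarrow> nat \<Rightarrow> (complex mat \<Rightarrow> complex mat) \<Rightarrow>
     (complex mat \<Rightarrow> complex mat) \<Rightarrow> complex mat \<Rightarrow> complex mat" where
  "map_tensor d1 e1 d2 e2 \<Phi>1 \<Phi>2 X = mat (e1 * e2) (e1 * e2) (\<lambda>(p,q).
     \<Sum>i<d1. \<Sum>j<d1. \<Sum>k<d2. \<Sum>l<d2. X $$ (i * d2 + k, j * d2 + l) *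
        (\<Phi>1 (unit_mat d1 i j)) $$ (p div e2, q div e2) * (\<Phi>2 (unit_mat d2 k l)) $$ (p mod e2, q mod e2))"

fun chan_pow :: "nat \<Rightarrow> nat \<Rightarrow> (complex mat \<Rightarrow> complex mat) \<Rightarrow> nat \<Rightarrow> complex mat \<Rightarrow> complex mat" where
  "chan_pow dA dB \<N> 0 = (\<lambda>X. X)"
| "chan_pow dA dB \<N> (Suc n) = map_tensor dA dB (dA ^ n) (dB ^ n) \<N> (chan_pow dA dB \<N> n)"

definition ptrace_first :: "nat \<Rightarrow> nat \<Rightarrow> complex mat \<Rightarrow> complex mat" where
  "ptrace_first k d X = mat d d (\<lambda>(i,j). \<Sum>a<k. X $$ (a * d + i, a * d + j))"

definition proj :: "complex vec \<Rightarrow> complex mat" where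
  "proj v = mat (dim_vec v) (dim_vec v) (\<lambda>(i,j). v $ i * cnj (v $ j))"

text \<open>Coherent information I_C(\<N>) = max over input states \<rho> of S(\<N>(\<rho>)) - S(\<N>^c(\<rho>)),
  with S(\<N>^c(\<rho>)) = S((id_R \<otimes> \<N>)(|\<psi>><\<psi>|)) for a purification \<psi> of \<rho> on R \<otimes> A, R \<cong> A.\<close>
definition coh_info :: "nat \<Rightarrow> nat \<Rightarrow> (complex mat \<Rightarrow> complex mat) \<Rightarrow> real" where
  "coh_info dA dB \<N> = Sup {entropy (\<N> (ptrace_first dA dA (proj \<psi>)))
        - entropy (id_tensor dA dA dB \<N> (proj \<psi>)) | \<psi>.
        \<psi> \<in> carrier_vec (dA * dA) \<and> \<psi> \<bullet>c \<psi> = 1}"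

definition quantum_capacity :: "nat \<Rightarrow> nat \<Rightarrow> (complex mat \<Rightarrow> complex mat) \<Rightarrow> real" where
  "quantum_capacity dA dB \<N> = lim (\<lambda>n. coh_info (dA ^ n) (dB ^ n) (chan_pow dA dB \<N> n) / real n)"

definition choi :: "nat \<Rightarrow> nat \<Rightarrow> (complex mat \<Rightarrow> complex mat) \<Rightarrow> complex mat" where
  "choi dA dB \<N> = mat (dA * dB) (dA * dB) (\<lambda>(p,q).
      \<N> (unit_mat dA (p div dB) (q div dB)) $$ (p mod dB, q mod dB))"

definition ptrans_B :: "nat \<Rightarrow> nat \<Rightarrow> complex mat \<Rightarrow> complex mat" where
  "ptrans_B dA dB X = mat (dA * dB) (dA * dB) (\<lambda>(p,q).
      X $$ ((p div dB) * dB + q mod dB, (q div dB) * dB + p mod dB))"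

definition Gamma :: "nat \<Rightarrow> nat \<Rightarrow> (complex mat \<Rightarrow> complex mat) \<Rightarrow> real" where
  "Gamma dA dB \<N> = Sup {Re (mtrace (choi dA dB \<N> * R)) | R \<rho>.
      psd (dA * dB) R \<and> psd dA \<rho> \<and> mtrace \<rho> = 1 \<and>
      psd (dA * dB) (kron \<rho> (1\<^sub>m dB) - ptrans_B dA dB R) \<and>
      psd (dA * dB) (ptrans_B dA dB R + kron \<rho> (1\<^sub>m dB))}"

definition Q_Gamma :: "nat \<Rightarrow> nat \<Rightarrow> (complex mat \<Rightarrow> complex mat) \<Rightarrow> real" where
  "Q_Gamma dA dB \<N> = log 2 (Gamma dA dB \<N>)"

definition cb_norm :: "nat \<Rightarrow> nat \<Rightarrow> (complex mat \<Rightarrow> complex mat) \<Rightarrow> real" where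
  "cb_norm dA dB \<Phi> = Sup {trace_norm (id_tensor k dA dB \<Phi> X) | k X.
      X \<in> carrier_mat (k * dA) (k * dA) \<and> trace_norm X \<le> 1}"

text \<open>Holevo--Werner bound: log of the cb norm of T \<circ> \<N>, the map with Choi matrix J^{T_B}.\<close>
definition Q_Theta :: "nat \<Rightarrow> nat \<Rightarrow> (complex mat \<Rightarrow> complex mat) \<Rightarrow> real" where
  "Q_Theta dA dB \<N> = log 2 (cb_norm dA dB (\<lambda>X. transpose_mat (\<N> X)))"

end

theory Submission
  imports Defs "HOL-Computational_Algebra.Fundamental_Theorem_Algebra"
begin

text \<open>Write \<open>J\<close> for the Choi matrix and \<open>X\<^sup>\<theta>\<close> for the partial transpose on \<open>B\<close>.

  For \<open>\<mu> > \<Gamma>(N)\<close> strong duality yields \<open>V, Y \<ge> 0\<close> with \<open>(V - Y)\<^sup>\<theta> \<ge> J\<close> and \<open>Tr\<^sub>B (V + Y) \<le> \<mu> 1\<close>.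
  Tensor powers of such a pair are feasible for the tensor powers of \<open>N\<close>, with \<open>\<mu>\<^sup>n\<close> in place of \<open>\<mu>\<close>.
  Applied to a purified input, the pair turns into operators \<open>P, Q \<ge> 0\<close> of total trace at most \<open>\<mu>\<close>,
  and since \<open>\<plusminus> P\<^sup>\<theta> \<le> 1 \<otimes> (P\<^sub>B)\<^sup>T\<close> (the reduction criterion and its companion), the output \<open>\<omega>\<close> satisfies
  \<open>\<omega> \<le> 1 \<otimes> \<tau>\<close> with \<open>Tr \<tau> \<le> \<mu>\<close>. This forces \<open>S(\<omega>\<^sub>B) - S(\<omega>) \<le> log \<mu>\<close>. The regularised coherent
  information converges because it is superadditive, so it is at most \<open>log \<mu>\<close>.

  For the second inequality, \<open>R\<^sup>\<theta> = (\<rho>\<^sup>1\<^sup>/\<^sup>2 \<otimes> 1) K (\<rho>\<^sup>1\<^sup>/\<^sup>2 \<otimes> 1)\<close> with \<open>-1 \<le> K \<le> 1\<close>, and \<open>Tr (J R)\<close> is at most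
  the trace norm of \<open>id \<otimes> (T \<circ> N)\<close> applied to the pure state with amplitudes \<open>\<rho>\<^sup>1\<^sup>/\<^sup>2\<close>. The
  argument covers indefinite \<open>R\<close> as well, which is the source of the gap between the two bounds.

  Amplitude damping with parameter \<open>1/2\<close> separates all three quantities. It equals its own
  complementary channel, so its capacity is \<open>0\<close>, while \<open>1 < \<Gamma> \<le> 3/2 < 38/25 \<le>\<close> the completely
  bounded norm.\<close>

section \<open>Complex matrices over finite index sets\<close>

text \<open>\<open>Sup\<close> and \<open>lim\<close> are total: on an unbounded set or a divergent
  sequence their value is unspecified. Every bound on one of the three quantities therefore rests on
  a boundedness or convergence proof. The sum of the moduli of the Choi entries bounds the set
  behind \<open>cb_norm\<close> uniformly in the reference dimension, this in turn bounds the set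
  behind \<open>Gamma\<close>, and a dual pair bounds the coherent informations, so that Fekete's
  lemma applies. Even the vanishing capacity in the example passes through a dual pair for this
  reason.

  No optimum is assumed to be attained. A threshold above \<Gamma>, an invertible \<tau> in the
  entropy bound and an invertible \<rho> in the norm bound each cost an arbitrarily small amount,
  which a limit removes at the end. The margin between \<mu> and \<Gamma> also takes the place of a
  closedness argument when the dual pair is obtained by separation.\<close>

definition idm :: "'i \<Rightarrow> 'i \<Rightarrow> complex" where
  "idm i j = (if i = j then 1 else 0)"

definition ip :: "'i set \<Rightarrow> ('i \<Rightarrow> complex) \<Rightarrow> ('i \<Rightarrow> complex) \<Rightarrow> complex" where
  "ip I u v = (\<Sum>i\<in>I. cnj (u i) * v i)"

definition app :: "'i set \<Rightarrow> ('i \<Rightarrow> 'i \<Rightarrow> complex) \<Rightarrow> ('i \<Rightarrow> complex) \<Rightarrow> 'i \<Rightarrow> complex" where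
  "app I M v i = (\<Sum>j\<in>I. M i j * v j)"

definition qf :: "'i set \<Rightarrow> ('i \<Rightarrow> 'i \<Rightarrow> complex) \<Rightarrow> ('i \<Rightarrow> complex) \<Rightarrow> complex" where
  "qf I M v = (\<Sum>i\<in>I. \<Sum>j\<in>I. cnj (v i) * M i j * v j)"

definition herm :: "'i set \<Rightarrow> ('i \<Rightarrow> 'i \<Rightarrow> complex) \<Rightarrow> bool" where
  "herm I M \<longleftrightarrow> (\<forall>i\<in>I. \<forall>j\<in>I. cnj (M i j) = M j i)"

definition pos :: "'i set \<Rightarrow> ('i \<Rightarrow> 'i \<Rightarrow> complex) \<Rightarrow> bool" where
  "pos I M \<longleftrightarrow> herm I M \<and> (\<forall>v. 0 \<le> Re (qf I M v))"

text \<open>Orthonormality and completeness are both recorded, so that no dimension count is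
  required to pass from one to the other.\<close>

definition onb :: "'i set \<Rightarrow> ('i \<Rightarrow> 'i \<Rightarrow> complex) \<Rightarrow> bool" where
  "onb I e \<longleftrightarrow> (\<forall>k\<in>I. \<forall>l\<in>I. ip I (e k) (e l) = idm k l) \<and>
     (\<forall>i\<in>I. \<forall>j\<in>I. (\<Sum>k\<in>I. e k i * cnj (e k j)) = idm i j)"

definition spec :: "'i set \<Rightarrow> ('i \<Rightarrow> 'i \<Rightarrow> complex) \<Rightarrow> ('i \<Rightarrow> real) \<Rightarrow> ('i \<Rightarrow> 'i \<Rightarrow> complex) \<Rightarrow> bool" where
  "spec I M p e \<longleftrightarrow> onb I e \<and>
     (\<forall>i\<in>I. \<forall>j\<in>I. M i j = (\<Sum>k\<in>I. of_real (p k) * e k i * cnj (e k j)))"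

text \<open>In \<open>spec I M p e\<close> the eigenbasis is indexed by the index set \<open>I\<close> of the matrix itself, so that
  tensor products and reindexing need no enumeration of the eigenvalues.\<close>

lemma idm_sum [simp]:
  assumes "finite I" "i \<in> I"
  shows "(\<Sum>j\<in>I. idm i j * f j) = f i" "(\<Sum>j\<in>I. idm j i * f j) = f i"
    "(\<Sum>j\<in>I. f j * idm i j) = f i" "(\<Sum>j\<in>I. f j * idm j i) = f i"
  using assms by (simp_all add: idm_def if_distrib if_distribR cong: if_cong)

lemma cnj_idm [simp]: "cnj (idm i j) = idm i j"
  by (simp add: idm_def)

lemma idm_commute: "idm i j = idm j i"
  by (simp add: idm_def)

lemma idm_Pair: "idm (a, b) (c, d) = idm a c * idm b d"
  by (simp add: idm_def)

lemma cnj_ip: "cnj (ip I u v) = ip I v u"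
  by (simp add: ip_def mult.commute)

lemma ip_self: "ip I u u = of_real (\<Sum>i\<in>I. (cmod (u i))\<^sup>2)"
  by (simp add: ip_def complex_norm_square mult.commute del: of_real_power)

lemma hermD: "herm I M \<Longrightarrow> i \<in> I \<Longrightarrow> j \<in> I \<Longrightarrow> cnj (M i j) = M j i"
  by (auto simp: herm_def)

lemma sum_rotate_out: "(\<Sum>a\<in>A. \<Sum>b\<in>B. \<Sum>c\<in>C. f a b c) = (\<Sum>c\<in>C. \<Sum>a\<in>A. \<Sum>b\<in>B. f a b c)"
  by (rule trans[OF _ sum.swap], rule sum.cong[OF refl], rule sum.swap)

lemma sum_rotate_in: "(\<Sum>a\<in>A. \<Sum>b\<in>B. \<Sum>c\<in>C. f a b c) = (\<Sum>b\<in>B. \<Sum>c\<in>C. \<Sum>a\<in>A. f a b c)"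
  by (rule sum_rotate_out[symmetric])

lemma sum_swap_pairs:
  "(\<Sum>a\<in>A. \<Sum>b\<in>B. \<Sum>c\<in>C. \<Sum>d\<in>D. f a b c d) = (\<Sum>c\<in>C. \<Sum>d\<in>D. \<Sum>a\<in>A. \<Sum>b\<in>B. f a b c d)"
  by (rule trans[OF _ sum_rotate_in], rule sum.cong[OF refl], rule sum_rotate_in)

text \<open>Matrices are total functions of which only the entries over \<open>I\<close> have a
  meaning. These congruence rules stand in for equality of matrices.\<close>

lemma qf_cong:
  assumes "\<And>i j. i \<in> I \<Longrightarrow> j \<in> I \<Longrightarrow> M i j = N i j" "\<And>i. i \<in> I \<Longrightarrow> v i = w i"
  shows "qf I M v = qf I N w"
  unfolding qf_def using assms by (intro sum.cong refl) simp

lemma herm_cong: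
  assumes "\<And>i j. i \<in> I \<Longrightarrow> j \<in> I \<Longrightarrow> M i j = N i j"
  shows "herm I M \<longleftrightarrow> herm I N"
  unfolding herm_def using assms by auto

lemma pos_cong:
  assumes "\<And>i j. i \<in> I \<Longrightarrow> j \<in> I \<Longrightarrow> M i j = N i j"
  shows "pos I M \<longleftrightarrow> pos I N"
proof -
  have "qf I M v = qf I N v" for v
    by (rule qf_cong) (use assms in auto)
  then show ?thesis
    unfolding pos_def using herm_cong[of I M N] assms by auto
qed

lemma spec_cong:
  assumes "\<And>i j. i \<in> I \<Longrightarrow> j \<in> I \<Longrightarrow> M i j = N i j"
  shows "spec I M p e \<longleftrightarrow> spec I N p e"
  unfolding spec_def using assms by auto

lemma ip_cong:
  assumes "\<And>i. i \<in> I \<Longrightarrow> u i = u' i" "\<And>i. i \<in> I \<Longrightarrow> v i = v' i"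
  shows "ip I u v = ip I u' v'"
  unfolding ip_def using assms by (intro sum.cong refl) simp

subsection \<open>Existence of an eigenvector\<close>

lemma sum_bij_nat:
  assumes "bij_betw h {..<n::nat} I"
  shows "(\<Sum>i\<in>I. f i) = (\<Sum>k<n. f (h k))"
  using sum.reindex_bij_betw[OF assms, of f] by simp

text \<open>An enumeration of \<open>I\<close> turns \<open>M\<close> into a matrix with numerical
  indices, whose characteristic polynomial has a root by the fundamental theorem of algebra.\<close>

lemma eigenvector_exists:
  fixes M :: "'i \<Rightarrow> 'i \<Rightarrow> complex"
  assumes "finite I" "I \<noteq> {}"
  shows "\<exists>c v. (\<exists>i\<in>I. v i \<noteq> 0) \<and> (\<forall>i\<in>I. app I M v i = c * v i)"
proof -
  define n where "n = card I"
  obtain h where h: "bij_betw h {..<n} I"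
    using ex_bij_betw_nat_finite[OF assms(1)] by (auto simp: n_def lessThan_atLeast0)
  define A where "A = mat n n (\<lambda>(k,l). M (h k) (h l))"
  have A: "A \<in> carrier_mat n n" by (simp add: A_def)
  have n0: "n > 0" using assms by (auto simp: n_def card_gt_0_iff)
  have "\<not> constant (poly (char_poly A))"
    using degree_monic_char_poly[OF A] n0 by (auto simp: constant_degree)
  then obtain c where "poly (char_poly A) c = 0"
    using fundamental_theorem_of_algebra by blast
  then have "eigenvalue A c"
    using eigenvalue_root_char_poly[OF A] by simp
  then obtain w where w: "w \<in> carrier_vec n" "w \<noteq> 0\<^sub>v n" "A *\<^sub>v w = c \<cdot>\<^sub>v w"
    using A unfolding eigenvalue_def eigenvector_def by auto
  define g where "g = the_inv_into {..<n} h"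
  have g: "g (h k) = k" if "k < n" for k
    unfolding g_def using h that by (intro the_inv_into_f_f) (auto simp: bij_betw_def)
  have surj: "\<exists>k<n. i = h k" if "i \<in> I" for i
    using h that by (auto simp: bij_betw_def)
  have hI: "h k \<in> I" if "k < n" for k
    using h that by (auto simp: bij_betw_def)
  define v where "v i = w $ g i" for i
  from w obtain k where k: "k < n" "w $ k \<noteq> 0"
    by (metis carrier_vecD eq_vecI index_zero_vec(1) index_zero_vec(2))
  have "v (h k) \<noteq> 0" using k by (simp add: v_def g)
  moreover have "app I M v i = c * v i" if "i \<in> I" for i
  proof -
    obtain l where l: "l < n" "i = h l" using surj[OF \<open>i \<in> I\<close>] by blast
    have "app I M v i = (\<Sum>k<n. A $$ (l, k) * w $ k)"
      unfolding app_def sum_bij_nat[OF h] using l by (intro sum.cong refl) (simp add: A_def v_def g)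
    also have "\<dots> = (A *\<^sub>v w) $ l"
      using l w(1) A by (simp add: scalar_prod_def lessThan_atLeast0)
    also have "\<dots> = c * v i" using l w by (simp add: v_def g)
    finally show ?thesis .
  qed
  ultimately show ?thesis using k hI by blast
qed

subsection \<open>The spectral theorem\<close>

lemma ip_app_herm:
  assumes "herm I H"
  shows "ip I (app I H u) v = ip I u (app I H v)"
proof -
  have "ip I (app I H u) v = (\<Sum>i\<in>I. \<Sum>j\<in>I. cnj (u j) * (H j i * v i))"
    unfolding ip_def app_def cnj_sum sum_distrib_right
    by (intro sum.cong refl) (simp add: hermD[OF assms] mult_ac)
  also have "\<dots> = (\<Sum>j\<in>I. \<Sum>i\<in>I. cnj (u j) * (H j i * v i))"
    by (rule sum.swap)
  finally show ?thesis
    unfolding ip_def app_def sum_distrib_left .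
qed

lemma app_invol:
  assumes "finite I" "\<And>i k. i \<in> I \<Longrightarrow> k \<in> I \<Longrightarrow> (\<Sum>j\<in>I. H i j * H j k) = idm i k" "i \<in> I"
  shows "app I H (app I H v) i = v i"
proof -
  have "app I H (app I H v) i = (\<Sum>j\<in>I. \<Sum>k\<in>I. (H i j * H j k) * v k)"
    unfolding app_def sum_distrib_left by (simp add: mult_ac)
  also have "\<dots> = (\<Sum>k\<in>I. (\<Sum>j\<in>I. H i j * H j k) * v k)"
    unfolding sum_distrib_right by (rule sum.swap)
  also have "\<dots> = (\<Sum>k\<in>I. idm i k * v k)"
    using assms by (intro sum.cong refl) simp
  finally show ?thesis using assms by simp
qed

lemma sum_sandwich:
  "(c::complex) * (\<Sum>a\<in>I. f a) * (\<Sum>b\<in>J. g b) = (\<Sum>a\<in>I. \<Sum>b\<in>J. c * f a * g b)"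
  by (simp only: mult.assoc sum_product) (simp only: sum_distrib_left)

lemma sum_app_app:
  assumes "herm I H" "i \<in> I" "j \<in> I"
  shows "(\<Sum>k\<in>K. of_real (p k) * app I H (e k) i * cnj (app I H (e k) j)) =
     (\<Sum>a\<in>I. \<Sum>b\<in>I. H i a * (\<Sum>k\<in>K. of_real (p k) * e k a * cnj (e k b)) * H b j)"
proof -
  have "(\<Sum>k\<in>K. of_real (p k) * app I H (e k) i * cnj (app I H (e k) j)) =
     (\<Sum>k\<in>K. \<Sum>a\<in>I. \<Sum>b\<in>I. H i a * (of_real (p k) * e k a * cnj (e k b)) * H b j)"
    unfolding app_def cnj_sum sum_sandwich
    using assms(2,3) by (intro sum.cong refl) (simp add: hermD[OF assms(1)] mult_ac)
  also have "\<dots> = (\<Sum>a\<in>I. \<Sum>k\<in>K. \<Sum>b\<in>I. H i a * (of_real (p k) * e k a * cnj (e k b)) * H b j)"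
    by (rule sum.swap)
  also have "\<dots> = (\<Sum>a\<in>I. \<Sum>b\<in>I. \<Sum>k\<in>K. H i a * (of_real (p k) * e k a * cnj (e k b)) * H b j)"
    by (intro sum.cong refl, rule sum.swap)
  finally show ?thesis
    by (simp add: sum_distrib_left sum_distrib_right)
qed

text \<open>A hermitian involution is its own inverse and its own adjoint, hence unitary, and
  carries an eigenbasis to an eigenbasis with the same eigenvalues.\<close>

lemma spec_conj:
  assumes "finite I" and inv: "\<And>i k. i \<in> I \<Longrightarrow> k \<in> I \<Longrightarrow> (\<Sum>j\<in>I. H i j * H j k) = idm i k"
    and H: "herm I H" and sp: "spec I M p e"
  shows "spec I (\<lambda>i j. \<Sum>a\<in>I. \<Sum>b\<in>I. H i a * M a b * H b j) p (\<lambda>k. app I H (e k))"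
proof -
  have e: "onb I e" using sp by (simp add: spec_def)
  have 1: "ip I (app I H (e k)) (app I H (e l)) = idm k l" if "k \<in> I" "l \<in> I" for k l
  proof -
    have "ip I (app I H (e k)) (app I H (e l)) = ip I (e k) (app I H (app I H (e l)))"
      by (rule ip_app_herm[OF H])
    also have "\<dots> = ip I (e k) (e l)"
      by (intro ip_cong refl app_invol assms) 
    finally show ?thesis using e that by (simp add: onb_def)
  qed
  have 2: "(\<Sum>k\<in>I. app I H (e k) i * cnj (app I H (e k) j)) = idm i j" if "i \<in> I" "j \<in> I" for i j
  proof -
    have "(\<Sum>k\<in>I. app I H (e k) i * cnj (app I H (e k) j)) =
      (\<Sum>a\<in>I. \<Sum>b\<in>I. H i a * (\<Sum>k\<in>I. e k a * cnj (e k b)) * H b j)"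
      using sum_app_app[OF H that, where K = I and p = "\<lambda>_. 1" and e = e] by simp
    also have "\<dots> = (\<Sum>a\<in>I. \<Sum>b\<in>I. H i a * (idm a b * H b j))"
      using e by (intro sum.cong refl) (simp add: onb_def mult_ac)
    also have "\<dots> = (\<Sum>a\<in>I. H i a * (\<Sum>b\<in>I. idm a b * H b j))"
      by (simp only: sum_distrib_left)
    also have "\<dots> = (\<Sum>a\<in>I. H i a * H a j)"
      using assms by (intro sum.cong refl) simp
    finally show ?thesis using inv that by simp
  qed
  have 3: "(\<Sum>a\<in>I. \<Sum>b\<in>I. H i a * M a b * H b j) =
      (\<Sum>k\<in>I. of_real (p k) * app I H (e k) i * cnj (app I H (e k) j))" if "i \<in> I" "j \<in> I" for i j
    unfolding sum_app_app[OF H that] using sp by (intro sum.cong refl) (simp add: spec_def)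
  show ?thesis
    unfolding spec_def onb_def using 1 2 3 by blast
qed

text \<open>The reflection along \<open>w = v - idm i0\<close> exchanges the unit vector at
  \<open>i0\<close> with \<open>v\<close>. Over the complex numbers this requires the overlap
  \<open>v i0\<close> to be real, and \<open>t \<le> 0\<close> keeps the squared length
  \<open>2 - 2 * t\<close> of \<open>w\<close> away from zero.\<close>

lemma householder:
  assumes fin: "finite I" and i0: "i0 \<in> I" and v: "(\<Sum>i\<in>I. (cmod (v i))\<^sup>2) = 1"
    and t: "v i0 = of_real t" "t \<le> 0"
  obtains H where "herm I H" "\<And>i k. i \<in> I \<Longrightarrow> k \<in> I \<Longrightarrow> (\<Sum>j\<in>I. H i j * H j k) = idm i k"
    "\<And>i. i \<in> I \<Longrightarrow> H i i0 = v i"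
proof -
  define w where "w i = v i - idm i0 i" for i
  define c where "c = complex_of_real (2 - 2 * t)"
  have c0: "c \<noteq> 0" using t(2) by (auto simp: c_def simp del: of_real_diff of_real_mult)
  have ww: "(\<Sum>j\<in>I. cnj (w j) * w j) = c"
  proof -
    have "(\<Sum>j\<in>I. cnj (w j) * w j) = (\<Sum>j\<in>I. cnj (v j) * v j - cnj (v j) * idm i0 j - idm i0 j * v j + idm i0 j * idm i0 j)"
      by (intro sum.cong refl) (simp add: w_def algebra_simps)
    also have "\<dots> = ip I v v - cnj (v i0) - v i0 + 1"
      using fin i0 by (simp add: sum.distrib sum_subtractf ip_def) (simp add: idm_def)
    also have "\<dots> = c" using v t by (simp add: ip_self c_def del: of_real_sum) 
    finally show ?thesis .
  qed
  define H where "H i j = idm i j - 2 / c * w i * cnj (w j)" for i j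
  have cc: "cnj c = c" by (simp add: c_def)
  have "herm I H"
    by (simp add: herm_def H_def cc mult_ac) (simp add: idm_def)
  moreover have "(\<Sum>j\<in>I. H i j * H j k) = idm i k" if "i \<in> I" "k \<in> I" for i k
  proof -
    have "(\<Sum>j\<in>I. H i j * H j k) = (\<Sum>j\<in>I. idm i j * idm j k - (idm i j * w j) * (2 / c * cnj (w k))
       - (2 / c * w i) * (cnj (w j) * idm j k) + 4 / c\<^sup>2 * w i * cnj (w k) * (cnj (w j) * w j))"
      by (intro sum.cong refl) (simp add: H_def algebra_simps power2_eq_square)
    also have "\<dots> = (\<Sum>j\<in>I. idm i j * idm j k) - (\<Sum>j\<in>I. idm i j * w j) * (2 / c * cnj (w k))
       - (2 / c * w i) * (\<Sum>j\<in>I. cnj (w j) * idm j k) + 4 / c\<^sup>2 * w i * cnj (w k) * (\<Sum>j\<in>I. cnj (w j) * w j)"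
      by (simp only: sum.distrib sum_subtractf sum_distrib_left sum_distrib_right)
    also have "\<dots> = idm i k"
      using fin that c0 unfolding ww by (simp add: power2_eq_square field_simps)
    finally show ?thesis .
  qed
  moreover have "H i i0 = v i" if "i \<in> I" for i
  proof -
    have "2 / c * cnj (w i0) = -1"
      using c0 t(1) by (simp add: w_def idm_def c_def field_simps)
    then have "H i i0 = idm i i0 - w i * (-1)"
      unfolding H_def by (metis mult.assoc mult.commute)
    then show ?thesis by (simp add: w_def idm_def)
  qed
  ultimately show ?thesis using that by blast
qed

text \<open>Rotating the phase until the entry at \<open>i0\<close> is real and nonpositive prepares
  a vector for the Householder reflection.\<close>

lemma normalise_phase:
  assumes fin: "finite I" and nz: "\<exists>i\<in>I. v i \<noteq> (0::complex)"
  obtains z t where "z \<noteq> 0" "(\<Sum>i\<in>I. (cmod (z * v i))\<^sup>2) = 1" "z * v i0 = of_real t" "t \<le> 0"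
proof -
  define s where "s = (\<Sum>i\<in>I. (cmod (v i))\<^sup>2)"
  have s0: "s > 0" unfolding s_def using nz fin by (auto intro!: sum_pos2)
  define u where "u = (if v i0 = 0 then 1 else - cnj (v i0) / of_real (cmod (v i0)))"
  have u: "cmod u = 1" by (auto simp: u_def norm_divide)
  have uv: "u * v i0 = of_real (- cmod (v i0))"
    by (auto simp: u_def field_simps power2_eq_square complex_norm_square[symmetric] simp flip: of_real_mult)
  define z where "z = u / of_real (sqrt s)"
  have "z \<noteq> 0" using u s0 by (auto simp: z_def)
  moreover have "(\<Sum>i\<in>I. (cmod (z * v i))\<^sup>2) = 1"
    using s0 u by (simp add: z_def norm_mult norm_divide power_divide power_mult_distrib s_def[symmetric]
        flip: sum_divide_distrib)
  moreover have "z * v i0 = of_real (- cmod (v i0) / sqrt s)"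
    using uv by (simp add: z_def)
  moreover have "- cmod (v i0) / sqrt s \<le> 0" using s0 by simp
  ultimately show ?thesis using that by blast
qed

lemma conj_conj:
  assumes "finite I" and inv: "\<And>i k. i \<in> I \<Longrightarrow> k \<in> I \<Longrightarrow> (\<Sum>j\<in>I. H i j * H j k) = idm i k"
    and "i \<in> I" "j \<in> I"
  shows "(\<Sum>a\<in>I. \<Sum>b\<in>I. H i a * (\<Sum>k\<in>I. \<Sum>l\<in>I. H a k * M k l * H l b) * H b j) = M i j"
proof -
  have "(\<Sum>a\<in>I. \<Sum>b\<in>I. H i a * (\<Sum>k\<in>I. \<Sum>l\<in>I. H a k * M k l * H l b) * H b j)
      = (\<Sum>a\<in>I. \<Sum>b\<in>I. \<Sum>k\<in>I. \<Sum>l\<in>I. (H i a * H a k) * M k l * (H l b * H b j))"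
    by (simp add: sum_distrib_left sum_distrib_right mult_ac)
  also have "\<dots> = (\<Sum>a\<in>I. \<Sum>k\<in>I. \<Sum>l\<in>I. \<Sum>b\<in>I. (H i a * H a k) * M k l * (H l b * H b j))"
    by (rule sum.cong[OF refl], rule trans[OF sum.swap], rule sum.cong[OF refl], rule sum.swap)
  also have "\<dots> = (\<Sum>k\<in>I. \<Sum>a\<in>I. \<Sum>l\<in>I. (H i a * H a k) * M k l * (\<Sum>b\<in>I. H l b * H b j))"
    by (subst sum.swap) (simp add: sum_distrib_left)
  also have "\<dots> = (\<Sum>k\<in>I. \<Sum>a\<in>I. (H i a * H a k) * M k j)"
    using assms by (intro sum.cong refl) (simp add: inv)
  also have "\<dots> = (\<Sum>k\<in>I. idm i k * M k j)"
    using assms by (intro sum.cong refl) (simp add: inv sum_distrib_right[symmetric])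
  finally show ?thesis using assms by simp
qed

text \<open>Induction on the index set. Conjugation with a reflection that moves the unit vector at
  \<open>i0\<close> to an eigenvector decouples the index \<open>i0\<close> from the rest; the
  remaining block is diagonalised by the induction hypothesis with labels in \<open>I'\<close>, and
  \<open>i0\<close> labels the new eigenvector.\<close>

theorem spectral:
  fixes M :: "'i \<Rightarrow> 'i \<Rightarrow> complex"
  assumes "finite I" "herm I M"
  shows "\<exists>p e. spec I M p e"
  using assms
proof (induction I arbitrary: M rule: finite_induct)
  case empty
  then show ?case by (simp add: spec_def onb_def)
next
  case (insert i0 I' M)
  define I where "I = insert i0 I'"
  have fin: "finite I" and i0: "i0 \<in> I" using insert by (auto simp: I_def)
  have hM: "herm I M" using insert by (simp add: I_def)
  obtain c v0 where v0: "\<exists>i\<in>I. v0 i \<noteq> 0" and ev0: "\<And>i. i \<in> I \<Longrightarrow> app I M v0 i = c * v0 i"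
    using eigenvector_exists[OF fin, of M] i0 by blast
  obtain z t where z: "z \<noteq> 0" "(\<Sum>i\<in>I. (cmod (z * v0 i))\<^sup>2) = 1" "z * v0 i0 = of_real t" "t \<le> 0"
    using normalise_phase[OF fin v0, of i0] by blast
  define v where "v i = z * v0 i" for i
  have ev: "app I M v i = c * v i" if "i \<in> I" for i
  proof -
    have "app I M v i = z * app I M v0 i"
      by (simp add: app_def v_def sum_distrib_left mult_ac)
    then show ?thesis using ev0[OF that] by (simp add: v_def)
  qed
  obtain H where H: "herm I H" and inv: "\<And>i k. i \<in> I \<Longrightarrow> k \<in> I \<Longrightarrow> (\<Sum>j\<in>I. H i j * H j k) = idm i k"
    and Hi0: "\<And>i. i \<in> I \<Longrightarrow> H i i0 = v i"
    using householder[OF fin i0, of v t] z by (auto simp: v_def)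
  define M' where "M' i j = (\<Sum>a\<in>I. \<Sum>b\<in>I. H i a * M a b * H b j)" for i j
  have hM': "herm I M'"
    unfolding herm_def
  proof (intro ballI)
    fix i j assume ij: "i \<in> I" "j \<in> I"
    have "cnj (M' i j) = (\<Sum>a\<in>I. \<Sum>b\<in>I. H j b * M b a * H a i)"
      unfolding M'_def cnj_sum using ij
      by (intro sum.cong refl) (simp add: hermD[OF H] hermD[OF hM] mult_ac)
    also have "\<dots> = M' j i" unfolding M'_def by (rule sum.swap)
    finally show "cnj (M' i j) = M' j i" .
  qed
  \<comment> \<open>\<open>H\<close> takes the unit vector at \<open>i0\<close> to the eigenvector
    \<open>v\<close>, then \<open>M\<close> scales it, then \<open>H\<close> takes it back.\<close>
  have col: "M' i i0 = c * idm i i0" if "i \<in> I" for i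
  proof -
    have "M' i i0 = (\<Sum>a\<in>I. H i a * app I M v a)"
      unfolding M'_def app_def by (simp add: Hi0 sum_distrib_left mult_ac)
    also have "\<dots> = (\<Sum>a\<in>I. c * (H i a * H a i0))"
      by (intro sum.cong refl) (simp add: ev Hi0)
    also have "\<dots> = c * idm i i0"
      using inv[OF that i0] by (simp add: sum_distrib_left[symmetric])
    finally show ?thesis .
  qed
  \<comment> \<open>The eigenvalue is a diagonal entry of the hermitian matrix
    \<open>M'\<close>.\<close>
  have creal: "c = of_real (Re c)"
    using hermD[OF hM' i0 i0] col[OF i0] by (simp add: idm_def complex_eq_iff)
  have row: "M' i0 i = c * idm i i0" if "i \<in> I" for i
  proof -
    have "M' i0 i = cnj (M' i i0)" using hermD[OF hM' that i0] by simp
    also have "\<dots> = cnj c * idm i i0" by (simp add: col that)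
    also have "cnj c = c" using creal by (metis complex_cnj_complex_of_real)
    finally show ?thesis .
  qed
  have "herm I' M'" using hM' by (simp add: herm_def I_def)
  then obtain p' e' where sp': "spec I' M' p' e'" using insert.IH by blast
  define p where "p = p'(i0 := Re c)"
  define e where "e k i = (if k = i0 then idm i0 i else if i = i0 then 0 else e' k i)" for k i
  have ne: "k \<noteq> i0" if "k \<in> I'" for k using that insert by auto
  have si: "(\<Sum>k\<in>I. f k) = f i0 + (\<Sum>k\<in>I'. f k)" for f :: "'i \<Rightarrow> complex"
    unfolding I_def using insert by simp
  have fI': "finite I'" using insert by simp
  have inI: "k = i0 \<or> k \<in> I'" if "k \<in> I" for k using that by (auto simp: I_def)
  have "spec I M' p e"
    unfolding spec_def onb_def
  proof (intro conjI ballI)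
    fix k l assume kl: "k \<in> I" "l \<in> I"
    show "ip I (e k) (e l) = idm k l"
    proof (cases "k = i0 \<or> l = i0")
      case True
      then show ?thesis using inI[OF kl(1)] inI[OF kl(2)] insert(2)
        by (auto simp: ip_def si e_def idm_def ne intro!: sum.neutral)
    next
      case False
      then have "k \<in> I'" "l \<in> I'" using kl by (auto simp: I_def)
      then show ?thesis using sp' False
        by (auto simp: ip_def si e_def ne spec_def onb_def cong: sum.cong)
    qed
  next
    fix i j assume ij: "i \<in> I" "j \<in> I"
    show "(\<Sum>k\<in>I. e k i * cnj (e k j)) = idm i j"
    proof (cases "i = i0 \<or> j = i0")
      case True
      then show ?thesis using inI[OF ij(1)] inI[OF ij(2)] by (auto simp: si e_def idm_def ne)
    next
      case False
      then have "i \<in> I'" "j \<in> I'" using ij by (auto simp: I_def)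
      then show ?thesis using sp' False insert(2)
        by (auto simp: si e_def ne spec_def onb_def idm_def cong: sum.cong)
    qed
  next
    fix i j assume ij: "i \<in> I" "j \<in> I"
    show "M' i j = (\<Sum>k\<in>I. of_real (p k) * e k i * cnj (e k j))"
    proof (cases "i = i0 \<or> j = i0")
      case True
      then show ?thesis
      proof
        assume "i = i0"
        then show ?thesis using row[OF ij(2)] creal by (auto simp: si e_def idm_def ne p_def)
      next
        assume "j = i0"
        then show ?thesis using col[OF ij(1)] creal by (auto simp: si e_def idm_def ne p_def)
      qed
    next
      case False
      then have "i \<in> I'" "j \<in> I'" using ij by (auto simp: I_def)
      then show ?thesis using sp' False insert(2)
        by (auto simp: si e_def ne spec_def onb_def idm_def p_def cong: sum.cong)
    qed
  qed
  from spec_conj[OF fin inv H this]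
  have "spec I (\<lambda>i j. \<Sum>a\<in>I. \<Sum>b\<in>I. H i a * M' a b * H b j) p (\<lambda>k. app I H (e k))" .
  moreover have "(\<Sum>a\<in>I. \<Sum>b\<in>I. H i a * M' a b * H b j) = M i j" if "i \<in> I" "j \<in> I" for i j
    unfolding M'_def by (rule conj_conj[OF fin inv that])
  ultimately have "spec I M p (\<lambda>k. app I H (e k))"
    using spec_cong[of I "\<lambda>i j. \<Sum>a\<in>I. \<Sum>b\<in>I. H i a * M' a b * H b j" M] by blast
  then show ?case by (auto simp: I_def)
qed

subsection \<open>Spectral decompositions and positivity\<close>

lemma spec_onb: "spec I M p e \<Longrightarrow> onb I e"
  by (simp add: spec_def)

lemma specD: "spec I M p e \<Longrightarrow> i \<in> I \<Longrightarrow> j \<in> I \<Longrightarrow> M i j = (\<Sum>k\<in>I. of_real (p k) * e k i * cnj (e k j))"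
  by (simp add: spec_def)

lemma spec_herm: "spec I M p e \<Longrightarrow> herm I M"
  by (auto simp: herm_def specD mult_ac intro!: sum.cong)

lemma onb_spec: "onb I e \<Longrightarrow> spec I idm (\<lambda>_. 1) e"
  by (simp add: spec_def onb_def)

lemma sum_spec:
  assumes "spec I M p e"
  shows "(\<Sum>i\<in>I. \<Sum>j\<in>I. M i j * B i j) = (\<Sum>k\<in>I. of_real (p k) * (\<Sum>i\<in>I. \<Sum>j\<in>I. e k i * cnj (e k j) * B i j))"
proof -
  have "(\<Sum>i\<in>I. \<Sum>j\<in>I. M i j * B i j) = (\<Sum>i\<in>I. \<Sum>j\<in>I. \<Sum>k\<in>I. of_real (p k) * (e k i * cnj (e k j) * B i j))"
    by (intro sum.cong refl) (simp add: specD[OF assms] sum_distrib_right sum_distrib_left mult_ac)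
  also have "\<dots> = (\<Sum>k\<in>I. \<Sum>i\<in>I. \<Sum>j\<in>I. of_real (p k) * (e k i * cnj (e k j) * B i j))"
    by (rule sum_rotate_out)
  finally show ?thesis by (simp only: sum_distrib_left)
qed

lemma qf_rank1: "qf I (\<lambda>i j. u i * cnj (u j)) v = of_real ((cmod (ip I u v))\<^sup>2)"
proof -
  have "qf I (\<lambda>i j. u i * cnj (u j)) v = (\<Sum>i\<in>I. \<Sum>j\<in>I. (cnj (v i) * u i) * (cnj (u j) * v j))"
    unfolding qf_def by (simp add: mult_ac)
  also have "\<dots> = ip I v u * ip I u v"
    unfolding ip_def sum_product ..
  also have "\<dots> = of_real ((cmod (ip I u v))\<^sup>2)"
    unfolding complex_norm_square cnj_ip by (rule mult.commute)
  finally show ?thesis .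
qed

lemma qf_spec:
  assumes "spec I M p e"
  shows "qf I M v = of_real (\<Sum>k\<in>I. p k * (cmod (ip I (e k) v))\<^sup>2)"
proof -
  have "qf I M v = (\<Sum>i\<in>I. \<Sum>j\<in>I. M i j * (cnj (v i) * v j))"
    unfolding qf_def by (simp add: mult_ac)
  also have "\<dots> = (\<Sum>k\<in>I. of_real (p k) * qf I (\<lambda>i j. e k i * cnj (e k j)) v)"
    unfolding sum_spec[OF assms] qf_def by (simp add: mult_ac)
  finally show ?thesis by (simp add: qf_rank1)
qed

lemma qf_idm:
  assumes "finite I"
  shows "qf I idm v = of_real (\<Sum>i\<in>I. (cmod (v i))\<^sup>2)"
proof -
  have "qf I idm v = (\<Sum>i\<in>I. cnj (v i) * (\<Sum>j\<in>I. idm i j * v j))"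
    unfolding qf_def by (simp add: sum_distrib_left mult_ac)
  also have "\<dots> = ip I v v"
    unfolding ip_def using assms by (intro sum.cong refl) simp
  finally show ?thesis unfolding ip_self .
qed

lemma parseval:
  assumes "finite I" "onb I e"
  shows "(\<Sum>k\<in>I. (cmod (ip I (e k) v))\<^sup>2) = (\<Sum>i\<in>I. (cmod (v i))\<^sup>2)"
  using qf_spec[OF onb_spec[OF assms(2)], of v] qf_idm[OF assms(1), of v]
  by (simp only: mult_1 of_real_eq_iff)

lemma onb_norm:
  assumes "onb I e" "k \<in> I"
  shows "(\<Sum>i\<in>I. (cmod (e k i))\<^sup>2) = 1"
proof -
  have "ip I (e k) (e k) = 1" using assms by (simp add: onb_def idm_def)
  then show ?thesis unfolding ip_self by (simp only: of_real_eq_1_iff)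
qed

lemma trace_spec:
  assumes "spec I M p e"
  shows "(\<Sum>i\<in>I. M i i) = of_real (\<Sum>k\<in>I. p k)"
proof -
  have "(\<Sum>i\<in>I. M i i) = (\<Sum>i\<in>I. \<Sum>k\<in>I. of_real (p k) * (cnj (e k i) * e k i))"
    by (intro sum.cong refl) (simp add: specD[OF assms] mult_ac)
  also have "\<dots> = (\<Sum>k\<in>I. of_real (p k) * ip I (e k) (e k))"
    unfolding ip_def sum_distrib_left by (rule sum.swap)
  also have "\<dots> = (\<Sum>k\<in>I. of_real (p k))"
    using spec_onb[OF assms] by (intro sum.cong refl) (simp add: onb_def idm_def)
  finally show ?thesis by simp
qed

lemma qf_eigen:
  assumes "finite I" "spec I M p e" "k \<in> I"
  shows "qf I M (e k) = of_real (p k)"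
proof -
  have "(\<Sum>l\<in>I. p l * (cmod (ip I (e l) (e k)))\<^sup>2) = (\<Sum>l\<in>I. if l = k then p l else 0)"
    using spec_onb[OF assms(2)] assms(3) by (intro sum.cong refl) (simp add: onb_def idm_def)
  also have "\<dots> = p k" using assms by simp
  finally show ?thesis using qf_spec[OF assms(2), of "e k"] by simp
qed

lemma spec_nonneg: "finite I \<Longrightarrow> pos I M \<Longrightarrow> spec I M p e \<Longrightarrow> k \<in> I \<Longrightarrow> 0 \<le> p k"
  using qf_eigen[of I M p e k] unfolding pos_def by (metis Re_complex_of_real)

lemma spec_pos:
  assumes "spec I M p e" "\<And>k. k \<in> I \<Longrightarrow> 0 \<le> p k"
  shows "pos I M"
  unfolding pos_def using spec_herm[OF assms(1)] qf_spec[OF assms(1)] assms(2)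
  by (auto intro!: sum_nonneg)

lemma trace_prod_spec:
  assumes "spec I M p e"
  shows "(\<Sum>i\<in>I. \<Sum>j\<in>I. M i j * B j i) = (\<Sum>k\<in>I. of_real (p k) * qf I B (e k))"
proof -
  have "(\<Sum>i\<in>I. \<Sum>j\<in>I. e k i * cnj (e k j) * B j i) = qf I B (e k)" for k
    unfolding qf_def by (subst sum.swap) (simp add: mult_ac)
  then show ?thesis unfolding sum_spec[OF assms, of "\<lambda>i j. B j i"] by simp
qed

lemma pos_herm: "pos I M \<Longrightarrow> herm I M"
  by (simp add: pos_def)

lemma pos_qf: "pos I M \<Longrightarrow> 0 \<le> Re (qf I M v)"
  by (simp add: pos_def)

lemma trace_prod_nonneg:
  assumes "finite I" "pos I M" "pos I B"
  shows "0 \<le> Re (\<Sum>i\<in>I. \<Sum>j\<in>I. M i j * B j i)"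
proof -
  obtain p e where sp: "spec I M p e" using spectral assms pos_herm by blast
  show ?thesis unfolding trace_prod_spec[OF sp]
    using spec_nonneg[OF assms(1,2) sp] pos_qf[OF assms(3)] by (auto intro!: sum_nonneg)
qed

section \<open>The convex cone of positive matrices\<close>

lemma qf_add: "qf I (\<lambda>i j. M i j + N i j) v = qf I M v + qf I N v"
  unfolding qf_def by (simp add: algebra_simps sum.distrib)

lemma qf_diff: "qf I (\<lambda>i j. M i j - N i j) v = qf I M v - qf I N v"
  unfolding qf_def by (simp add: algebra_simps sum_subtractf)

lemma qf_scale: "qf I (\<lambda>i j. c * M i j) v = c * qf I M v"
  unfolding qf_def by (simp add: sum_distrib_left mult_ac)

lemma qf_sum: "qf I (\<lambda>i j. \<Sum>k\<in>K. M k i j) v = (\<Sum>k\<in>K. qf I (M k) v)"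
proof (induction K rule: infinite_finite_induct)
  case (insert x F)
  then show ?case by (simp add: qf_add)
qed (simp_all add: qf_def)

lemma herm_add: "herm I M \<Longrightarrow> herm I N \<Longrightarrow> herm I (\<lambda>i j. M i j + N i j)"
  by (simp add: herm_def)

lemma herm_diff: "herm I M \<Longrightarrow> herm I N \<Longrightarrow> herm I (\<lambda>i j. M i j - N i j)"
  by (simp add: herm_def)

lemma herm_scale: "herm I M \<Longrightarrow> herm I (\<lambda>i j. of_real c * M i j)"
  by (simp add: herm_def)

lemma herm_idm: "herm I idm"
  by (simp add: herm_def idm_commute)

lemma pos_add: "pos I M \<Longrightarrow> pos I N \<Longrightarrow> pos I (\<lambda>i j. M i j + N i j)"
  by (simp add: pos_def herm_add qf_add)

lemma pos_scale: "pos I M \<Longrightarrow> 0 \<le> c \<Longrightarrow> pos I (\<lambda>i j. of_real c * M i j)"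
  by (simp add: pos_def herm_scale qf_scale)

lemma pos_sum:
  assumes "\<And>k. k \<in> K \<Longrightarrow> pos I (M k)"
  shows "pos I (\<lambda>i j. \<Sum>k\<in>K. M k i j)"
proof -
  have "herm I (\<lambda>i j. \<Sum>k\<in>K. M k i j)"
    using assms by (auto simp: herm_def pos_def)
  then show ?thesis
    using assms by (auto simp: pos_def qf_sum intro!: sum_nonneg)
qed

lemma pos_rank1: "pos I (\<lambda>i j. u i * cnj (u j))"
  by (simp add: pos_def qf_rank1 herm_def mult.commute)

lemma pos_idm: "finite I \<Longrightarrow> pos I idm"
  by (simp add: pos_def herm_idm qf_idm sum_nonneg)

section \<open>Congruence, reindexing and tensor products of positive matrices\<close>

lemma qf_pullback:
  "qf X (\<lambda>x y. \<Sum>i\<in>I. \<Sum>j\<in>I. L x i * M i j * cnj (L y j)) v = qf I M (\<lambda>i. \<Sum>x\<in>X. cnj (L x i) * v x)"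
proof -
  have "qf X (\<lambda>x y. \<Sum>i\<in>I. \<Sum>j\<in>I. L x i * M i j * cnj (L y j)) v =
    (\<Sum>x\<in>X. \<Sum>y\<in>X. \<Sum>i\<in>I. \<Sum>j\<in>I. M i j * (L x i * cnj (v x)) * (cnj (L y j) * v y))"
    unfolding qf_def by (simp add: sum_distrib_left sum_distrib_right mult_ac)
  also have "\<dots> = (\<Sum>i\<in>I. \<Sum>j\<in>I. \<Sum>x\<in>X. \<Sum>y\<in>X. M i j * (L x i * cnj (v x)) * (cnj (L y j) * v y))"
    by (rule sum_swap_pairs)
  also have "\<dots> = (\<Sum>i\<in>I. \<Sum>j\<in>I. M i j * (\<Sum>x\<in>X. L x i * cnj (v x)) * (\<Sum>y\<in>X. cnj (L y j) * v y))"
    unfolding sum_sandwich ..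
  finally show ?thesis unfolding qf_def by (simp add: mult_ac)
qed

lemma herm_pullback:
  assumes "herm I M"
  shows "herm X (\<lambda>x y. \<Sum>i\<in>I. \<Sum>j\<in>I. L x i * M i j * cnj (L y j))"
  unfolding herm_def
proof (intro ballI)
  fix x y
  have "cnj (\<Sum>i\<in>I. \<Sum>j\<in>I. L x i * M i j * cnj (L y j)) = (\<Sum>i\<in>I. \<Sum>j\<in>I. L y j * M j i * cnj (L x i))"
    unfolding cnj_sum by (intro sum.cong refl) (simp add: hermD[OF assms] mult_ac)
  also have "\<dots> = (\<Sum>i\<in>I. \<Sum>j\<in>I. L y i * M i j * cnj (L x j))"
    by (rule sum.swap)
  finally show "cnj (\<Sum>i\<in>I. \<Sum>j\<in>I. L x i * M i j * cnj (L y j)) = (\<Sum>i\<in>I. \<Sum>j\<in>I. L y i * M i j * cnj (L x j))" .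
qed

text \<open>The quadratic form of \<open>L M L^*\<close> at \<open>v\<close> is that of
  \<open>M\<close> at \<open>L^* v\<close>. Submatrices, outputs of channels and Kraus maps are all
  congruences of this shape.\<close>

lemma pos_pullback:
  "pos I M \<Longrightarrow> pos X (\<lambda>x y. \<Sum>i\<in>I. \<Sum>j\<in>I. L x i * M i j * cnj (L y j))"
  using herm_pullback[of I M X L] by (auto simp: pos_def qf_pullback)

text \<open>The congruence by the 0-1 matrix \<open>idm (f x) i\<close>. One rule covers principal
  submatrices, the decoding of numbers into pairs, and maps \<open>f\<close> that identify
  indices.\<close>

lemma pos_reindex:
  assumes "finite I" "f ` X \<subseteq> I" "pos I M"
  shows "pos X (\<lambda>x y. M (f x) (f y))"
proof -
  have "(\<Sum>i\<in>I. \<Sum>j\<in>I. idm (f x) i * M i j * cnj (idm (f y) j)) = M (f x) (f y)"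
    if "x \<in> X" "y \<in> X" for x y
  proof -
    have "(\<Sum>i\<in>I. \<Sum>j\<in>I. idm (f x) i * M i j * cnj (idm (f y) j)) =
       (\<Sum>i\<in>I. idm (f x) i * (\<Sum>j\<in>I. M i j * idm (f y) j))"
      by (simp add: sum_distrib_left mult_ac)
    also have "\<dots> = M (f x) (f y)"
    proof -
      have "f x \<in> I" "f y \<in> I" using assms(2) that by auto
      with assms(1) show ?thesis by simp
    qed
    finally show ?thesis .
  qed
  note eq = this
  show ?thesis
    by (rule iffD1[OF pos_cong pos_pullback[OF assms(3), of X "\<lambda>x. idm (f x)"]]) (rule eq)
qed

lemma pos_transpose:
  assumes "pos I M"
  shows "pos I (\<lambda>i j. M j i)"
proof -
  have "qf I (\<lambda>i j. M j i) v = qf I M (\<lambda>i. cnj (v i))" for v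
    unfolding qf_def by (subst sum.swap) (simp add: mult_ac)
  then show ?thesis using assms by (auto simp: pos_def herm_def)
qed

lemma onb_tensor:
  assumes "finite I" "finite J" "onb I e" "onb J f"
  shows "onb (I \<times> J) (\<lambda>k i. e (fst k) (fst i) * f (snd k) (snd i))"
  unfolding onb_def
proof (intro conjI ballI)
  fix k l assume "k \<in> I \<times> J" "l \<in> I \<times> J"
  then obtain a b c d where [simp]: "k = (a,b)" "l = (c,d)" and "a \<in> I" "c \<in> I" "b \<in> J" "d \<in> J" by auto
  have "ip (I \<times> J) (\<lambda>i. e (fst k) (fst i) * f (snd k) (snd i)) (\<lambda>i. e (fst l) (fst i) * f (snd l) (snd i))
     = (\<Sum>i\<in>I. \<Sum>j\<in>J. (cnj (e a i) * e c i) * (cnj (f b j) * f d j))"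
    unfolding ip_def sum.cartesian_product by (intro sum.cong refl) (auto simp: mult_ac)
  also have "\<dots> = ip I (e a) (e c) * ip J (f b) (f d)"
    unfolding ip_def sum_product ..
  finally show "ip (I \<times> J) (\<lambda>i. e (fst k) (fst i) * f (snd k) (snd i)) (\<lambda>i. e (fst l) (fst i) * f (snd l) (snd i)) = idm k l"
    using assms \<open>a \<in> I\<close> \<open>c \<in> I\<close> \<open>b \<in> J\<close> \<open>d \<in> J\<close> by (simp add: onb_def idm_Pair)
next
  fix i j assume "i \<in> I \<times> J" "j \<in> I \<times> J"
  then obtain a b c d where [simp]: "i = (a,b)" "j = (c,d)" and "a \<in> I" "c \<in> I" "b \<in> J" "d \<in> J" by auto
  have "(\<Sum>k\<in>I \<times> J. e (fst k) (fst i) * f (snd k) (snd i) * cnj (e (fst k) (fst j) * f (snd k) (snd j)))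
     = (\<Sum>k\<in>I. \<Sum>l\<in>J. (e k a * cnj (e k c)) * (f l b * cnj (f l d)))"
    unfolding sum.cartesian_product by (intro sum.cong refl) (auto simp: mult_ac)
  also have "\<dots> = (\<Sum>k\<in>I. e k a * cnj (e k c)) * (\<Sum>l\<in>J. f l b * cnj (f l d))"
    unfolding sum_product ..
  finally show "(\<Sum>k\<in>I \<times> J. e (fst k) (fst i) * f (snd k) (snd i) * cnj (e (fst k) (fst j) * f (snd k) (snd j))) = idm i j"
    using assms \<open>a \<in> I\<close> \<open>c \<in> I\<close> \<open>b \<in> J\<close> \<open>d \<in> J\<close> by (simp add: onb_def idm_Pair)
qed

lemma spec_tensor:
  assumes "finite I" "finite J" "spec I M p e" "spec J N q f"
  shows "spec (I \<times> J) (\<lambda>x y. M (fst x) (fst y) * N (snd x) (snd y)) (\<lambda>k. p (fst k) * q (snd k))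
     (\<lambda>k i. e (fst k) (fst i) * f (snd k) (snd i))"
  unfolding spec_def
proof (intro conjI ballI)
  show "onb (I \<times> J) (\<lambda>k i. e (fst k) (fst i) * f (snd k) (snd i))"
    by (rule onb_tensor[OF assms(1,2) spec_onb[OF assms(3)] spec_onb[OF assms(4)]])
  fix i j assume "i \<in> I \<times> J" "j \<in> I \<times> J"
  then obtain a b c d where [simp]: "i = (a,b)" "j = (c,d)" and *: "a \<in> I" "c \<in> I" "b \<in> J" "d \<in> J" by auto
  have "(\<Sum>k\<in>I \<times> J. of_real (p (fst k) * q (snd k)) * (e (fst k) (fst i) * f (snd k) (snd i)) * cnj (e (fst k) (fst j) * f (snd k) (snd j)))
     = (\<Sum>k\<in>I. \<Sum>l\<in>J. (of_real (p k) * e k a * cnj (e k c)) * (of_real (q l) * f l b * cnj (f l d)))"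
    unfolding sum.cartesian_product by (intro sum.cong refl) (auto simp: mult_ac)
  also have "\<dots> = M a c * N b d"
    unfolding specD[OF assms(3) *(1,2)] specD[OF assms(4) *(3,4)] sum_product ..
  finally show "M (fst i) (fst j) * N (snd i) (snd j) = (\<Sum>k\<in>I \<times> J. of_real (p (fst k) * q (snd k)) * (e (fst k) (fst i) * f (snd k) (snd i)) * cnj (e (fst k) (fst j) * f (snd k) (snd j)))"
    by simp
qed

lemma pos_tensor:
  assumes "finite I" "finite J" "pos I M" "pos J N"
  shows "pos (I \<times> J) (\<lambda>x y. M (fst x) (fst y) * N (snd x) (snd y))"
proof -
  obtain p e where sp: "spec I M p e" using spectral assms pos_herm by blast
  obtain q f where sq: "spec J N q f" using spectral assms pos_herm by blast
  show ?thesis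
    using spec_nonneg[OF assms(1,3) sp] spec_nonneg[OF assms(2,4) sq]
    by (intro spec_pos[OF spec_tensor[OF assms(1,2) sp sq]]) auto
qed

lemma spec_reindex:
  assumes "bij_betw h X I" "spec I M p e"
  shows "spec X (\<lambda>x y. M (h x) (h y)) (\<lambda>k. p (h k)) (\<lambda>k i. e (h k) (h i))"
proof -
  have hI: "h x \<in> I" if "x \<in> X" for x using assms(1) that by (auto simp: bij_betw_def)
  have inj: "h x = h y \<longleftrightarrow> x = y" if "x \<in> X" "y \<in> X" for x y
    using assms(1) that by (auto simp: bij_betw_def inj_on_def)
  have s: "(\<Sum>x\<in>X. f (h x)) = (\<Sum>i\<in>I. f i)" for f :: "_ \<Rightarrow> complex"
    by (rule sum.reindex_bij_betw[OF assms(1)])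
  show ?thesis
    unfolding spec_def onb_def
  proof (intro conjI ballI)
    fix k l assume kl: "k \<in> X" "l \<in> X"
    show "ip X (\<lambda>i. e (h k) (h i)) (\<lambda>i. e (h l) (h i)) = idm k l"
      using spec_onb[OF assms(2)] hI kl inj[OF kl] s[of "\<lambda>i. cnj (e (h k) i) * e (h l) i"]
      by (simp add: onb_def ip_def idm_def)
  next
    fix i j assume kl: "i \<in> X" "j \<in> X"
    show "(\<Sum>k\<in>X. e (h k) (h i) * cnj (e (h k) (h j))) = idm i j"
      using spec_onb[OF assms(2)] hI kl inj[OF kl] s[of "\<lambda>k. e k (h i) * cnj (e k (h j))"]
      by (simp add: onb_def idm_def)
  next
    fix i j assume kl: "i \<in> X" "j \<in> X"
    show "M (h i) (h j) = (\<Sum>k\<in>X. of_real (p (h k)) * e (h k) (h i) * cnj (e (h k) (h j)))"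
      using specD[OF assms(2) hI[OF kl(1)] hI[OF kl(2)]] s[of "\<lambda>k. of_real (p k) * e k (h i) * cnj (e k (h j))"]
      by simp
  qed
qed

lemma spec_shift:
  assumes "spec I M p e"
  shows "spec I (\<lambda>i j. M i j + of_real c * idm i j) (\<lambda>k. p k + c) e"
proof -
  have "(\<Sum>k\<in>I. of_real (p k + c) * e k i * cnj (e k j)) =
    (\<Sum>k\<in>I. of_real (p k) * e k i * cnj (e k j)) + of_real c * (\<Sum>k\<in>I. e k i * cnj (e k j))" for i j
    by (simp add: algebra_simps sum.distrib sum_distrib_left)
  then show ?thesis using assms by (simp add: spec_def onb_def)
qed

lemma spec_reflect:
  assumes "spec I M p e"
  shows "spec I (\<lambda>i j. of_real c * idm i j - M i j) (\<lambda>k. c - p k) e"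
proof -
  have "(\<Sum>k\<in>I. of_real (c - p k) * e k i * cnj (e k j)) =
    of_real c * (\<Sum>k\<in>I. e k i * cnj (e k j)) - (\<Sum>k\<in>I. of_real (p k) * e k i * cnj (e k j))" for i j
    by (simp add: algebra_simps sum_subtractf sum_distrib_left)
  then show ?thesis using assms by (simp add: spec_def onb_def)
qed

text \<open>The squared overlaps of two orthonormal bases form a doubly stochastic matrix, by
  Parseval in either basis. They are the weights in the entropy inequalities.\<close>

lemma onb_overlap:
  assumes "finite I" "onb I e" "onb I f" "k \<in> I"
  shows "(\<Sum>l\<in>I. (cmod (ip I (f l) (e k)))\<^sup>2) = 1" "(\<Sum>l\<in>I. (cmod (ip I (f k) (e l)))\<^sup>2) = 1"
proof -
  show "(\<Sum>l\<in>I. (cmod (ip I (f l) (e k)))\<^sup>2) = 1"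
    using parseval[OF assms(1,3)] onb_norm[OF assms(2,4)] by simp
  have "cmod (ip I (f k) (e l)) = cmod (ip I (e l) (f k))" for l
    by (metis cnj_ip complex_mod_cnj)
  then show "(\<Sum>l\<in>I. (cmod (ip I (f k) (e l)))\<^sup>2) = 1"
    using parseval[OF assms(1,2)] onb_norm[OF assms(3,4)] by simp
qed

section \<open>Eigenvalues, entropy and trace norm of matrices\<close>

lemma spectralE:
  assumes "finite I" "herm I M"
  obtains p e where "spec I M p e"
  using spectral[OF assms] that by auto

abbreviation ent :: "complex mat \<Rightarrow> nat \<Rightarrow> nat \<Rightarrow> complex" where
  "ent A \<equiv> \<lambda>i j. A $$ (i, j)"

lemma mult_mat_index:
  assumes "A \<in> carrier_mat n m" "B \<in> carrier_mat m l" "i < n" "j < l"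
  shows "(A * B) $$ (i, j) = (\<Sum>k<m. A $$ (i, k) * B $$ (k, j))"
  using assms by (simp add: scalar_prod_def lessThan_atLeast0)

lemma psd_iff_pos: "psd n A \<longleftrightarrow> A \<in> carrier_mat n n \<and> pos {..<n} (ent A)"
proof (cases "A \<in> carrier_mat n n")
  case True
  have "adj A = A \<longleftrightarrow> herm {..<n} (ent A)"
    using True by (auto simp: adj_def herm_def mat_eq_iff)
  moreover have "(A *\<^sub>v v) \<bullet>c v = qf {..<n} (ent A) (\<lambda>i. v $ i)" if "v \<in> carrier_vec n" for v
    using True that
    by (simp add: scalar_prod_def qf_def lessThan_atLeast0 sum_distrib_right sum_distrib_left mult_ac)
  moreover have "qf {..<n} (ent A) w = qf {..<n} (ent A) (\<lambda>i. vec n w $ i)" for w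
    by (rule qf_cong) auto
  ultimately have "psd n A \<longleftrightarrow> A \<in> carrier_mat n n \<and> herm {..<n} (ent A) \<and> (\<forall>v \<in> carrier_vec n. 0 \<le> Re (qf {..<n} (ent A) (\<lambda>i. v $ i)))"
    by (auto simp: psd_def)
  moreover have "(\<forall>v \<in> carrier_vec n. 0 \<le> Re (qf {..<n} (ent A) (\<lambda>i. v $ i))) \<longleftrightarrow> (\<forall>w. 0 \<le> Re (qf {..<n} (ent A) w))"
  proof (intro iffI allI ballI)
    fix w assume "\<forall>v \<in> carrier_vec n. 0 \<le> Re (qf {..<n} (ent A) (\<lambda>i. v $ i))"
    then have "0 \<le> Re (qf {..<n} (ent A) (\<lambda>i. vec n w $ i))" by auto
    also have "qf {..<n} (ent A) (\<lambda>i. vec n w $ i) = qf {..<n} (ent A) w"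
      by (rule qf_cong) auto
    finally show "0 \<le> Re (qf {..<n} (ent A) w)" .
  qed auto
  ultimately show ?thesis unfolding pos_def by blast
qed (auto simp: psd_def)

text \<open>The eigenbasis makes \<open>A\<close> similar to a diagonal matrix, so the
  characteristic polynomial splits with the eigenvalues as roots, counted with multiplicity. Entropy
  and trace norm, defined through these roots, can then be read off from any spectral
  decomposition.\<close>

lemma eigs_spec:
  assumes A: "A \<in> carrier_mat n n" and sp: "spec {..<n} (ent A) p e"
  shows "eigs A = image_mset (\<lambda>k. complex_of_real (p k)) (mset [0..<n])"
proof -
  define U where "U = mat n n (\<lambda>(i,k). e k i)"
  define V where "V = mat n n (\<lambda>(k,j). cnj (e k j))"
  define D where "D = mat n n (\<lambda>(i,j). if i = j then complex_of_real (p i) else 0)"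
  have carr [simp]: "U \<in> carrier_mat n n" "V \<in> carrier_mat n n" "D \<in> carrier_mat n n"
    by (auto simp: U_def V_def D_def)
  have onb: "onb {..<n} e" using sp by (rule spec_onb)
  have "U * V = 1\<^sub>m n"
  proof (rule eq_matI)
    fix i j assume "i < dim_row (1\<^sub>m n :: complex mat)" "j < dim_col (1\<^sub>m n :: complex mat)"
    then show "(U * V) $$ (i, j) = 1\<^sub>m n $$ (i, j)"
      using onb by (subst mult_mat_index[of _ n n _ n]) (auto simp: U_def V_def onb_def idm_def)
  qed (auto simp: U_def V_def)
  moreover have "V * U = 1\<^sub>m n"
  proof (rule eq_matI)
    fix i j assume "i < dim_row (1\<^sub>m n :: complex mat)" "j < dim_col (1\<^sub>m n :: complex mat)"
    then show "(V * U) $$ (i, j) = 1\<^sub>m n $$ (i, j)"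
      using onb by (subst mult_mat_index[of _ n n _ n]) (auto simp: U_def V_def onb_def idm_def ip_def)
  qed (auto simp: U_def V_def)
  moreover have "A = U * D * V"
  proof (rule eq_matI)
    fix i j assume "i < dim_row (U * D * V)" "j < dim_col (U * D * V)"
    then have ij: "i < n" "j < n" by (auto simp: U_def V_def)
    have UD: "(U * D) $$ (i, k) = e k i * of_real (p k)" if "k < n" for k
      using ij that by (subst mult_mat_index[of _ n n _ n])
        (auto simp: U_def D_def if_distrib if_distribR cong: if_cong)
    have "(U * D * V) $$ (i, j) = (\<Sum>k<n. (U * D) $$ (i, k) * V $$ (k, j))"
      using ij by (intro mult_mat_index[of _ n n _ n] mult_carrier_mat[of _ n n]) auto
    also have "\<dots> = (\<Sum>k<n. of_real (p k) * e k i * cnj (e k j))"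
      using ij by (intro sum.cong refl) (simp add: UD V_def mult_ac)
    also have "\<dots> = A $$ (i, j)"
      using specD[OF sp] ij by simp
    finally show "A $$ (i, j) = (U * D * V) $$ (i, j)" ..
  qed (use A in \<open>auto simp: U_def V_def\<close>)
  ultimately have "similar_mat A D"
    using A by (intro similar_matI[of _ _ U V n]) auto
  then have "char_poly A = char_poly D" by (rule char_poly_similar)
  also have "\<dots> = (\<Prod>a\<leftarrow>diag_mat D. [:- a, 1:])"
    by (rule char_poly_upper_triangular[OF carr(3)]) (auto simp: D_def)
  also have "diag_mat D = map (\<lambda>k. complex_of_real (p k)) [0..<n]"
    by (auto simp: diag_mat_def D_def)
  finally have cp: "char_poly A = (\<Prod>q\<leftarrow>map (\<lambda>k. [:- complex_of_real (p k), 1:]) [0..<n]. q)"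
    by (simp add: o_def)
  have "(\<Sum>x\<leftarrow>xs. {#complex_of_real (p x)#}) = image_mset (\<lambda>k. complex_of_real (p k)) (mset xs)" for xs
    by (induction xs) auto
  then show ?thesis
    unfolding eigs_def cp by (subst proots_prod_list) (auto simp: o_def)
qed

lemma sum_mset_upt: "(\<Sum>x\<in>#image_mset f (mset [0..<n]). g x) = (\<Sum>k<n. g (f k))"
  by (simp add: sum_unfold_sum_mset lessThan_atLeast0 multiset.map_comp o_def)

lemma entropy_spec:
  assumes "A \<in> carrier_mat n n" "spec {..<n} (ent A) p e"
  shows "entropy A = (\<Sum>k<n. eta (p k))"
  unfolding entropy_def eigs_spec[OF assms] sum_mset_upt by simp

lemma app_eigen:
  assumes "finite I" "spec I M p e" "k \<in> I" "i \<in> I"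
  shows "app I M (e k) i = of_real (p k) * e k i"
proof -
  have "app I M (e k) i = (\<Sum>j\<in>I. \<Sum>l\<in>I. of_real (p l) * e l i * (cnj (e l j) * e k j))"
    unfolding app_def using assms(4)
    by (intro sum.cong refl) (simp add: specD[OF assms(2)] sum_distrib_right sum_distrib_left mult_ac)
  also have "\<dots> = (\<Sum>l\<in>I. of_real (p l) * e l i * ip I (e l) (e k))"
    unfolding ip_def sum_distrib_left by (rule sum.swap)
  also have "\<dots> = (\<Sum>l\<in>I. of_real (p l) * e l i * idm l k)"
    using spec_onb[OF assms(2)] assms(3) by (intro sum.cong refl) (simp add: onb_def)
  finally show ?thesis using assms by simp
qed

lemma adj_mult_index:
  assumes "X \<in> carrier_mat n n" "i < n" "j < n"
  shows "(adj X * X) $$ (i, j) = (\<Sum>k<n. cnj (X $$ (k, i)) * X $$ (k, j))"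
  using assms by (subst mult_mat_index[of _ n n _ n]) (auto simp: adj_def)

text \<open>The basis diagonalises \<open>X^* X\<close>; its images under \<open>X\<close> are then
  orthogonal and their lengths are the singular values. This is the singular value decomposition
  without left singular vectors, which would be undefined where \<open>s k = 0\<close>.\<close>

lemma trace_norm_singular:
  assumes X: "X \<in> carrier_mat n n"
  obtains e s where "onb {..<n} e" "trace_norm X = (\<Sum>k<n. s k)" "\<And>k. 0 \<le> s k"
    "\<And>k l. k < n \<Longrightarrow> l < n \<Longrightarrow>
       ip {..<n} (app {..<n} (ent X) (e k)) (app {..<n} (ent X) (e l)) = of_real ((s k)\<^sup>2) * idm k l"
proof -
  define G where "G = adj X * X"
  have G: "G \<in> carrier_mat n n" using X by (auto simp: G_def adj_def)
  have Gi: "G $$ (i, j) = (\<Sum>k<n. cnj (X $$ (k, i)) * X $$ (k, j))" if "i < n" "j < n" for i j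
    unfolding G_def by (rule adj_mult_index[OF X that])
  have gram: "ip {..<n} (app {..<n} (ent X) u) (app {..<n} (ent X) v) = ip {..<n} u (app {..<n} (ent G) v)" for u v
  proof -
    have "ip {..<n} (app {..<n} (ent X) u) (app {..<n} (ent X) v)
      = (\<Sum>k<n. \<Sum>i<n. \<Sum>j<n. cnj (u i) * (cnj (X $$ (k, i)) * X $$ (k, j)) * v j)"
      unfolding ip_def app_def cnj_sum sum_product by (simp add: mult_ac)
    also have "\<dots> = (\<Sum>i<n. \<Sum>j<n. \<Sum>k<n. cnj (u i) * (cnj (X $$ (k, i)) * X $$ (k, j)) * v j)"
      by (rule sum_rotate_in)
    also have "\<dots> = (\<Sum>i<n. \<Sum>j<n. cnj (u i) * (G $$ (i, j) * v j))"
      by (intro sum.cong refl) (simp add: Gi sum_distrib_left sum_distrib_right mult_ac)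
    finally show ?thesis unfolding ip_def app_def sum_distrib_left .
  qed
  have "herm {..<n} (ent G)" by (simp add: herm_def Gi mult.commute)
  then obtain q e where sp: "spec {..<n} (ent G) q e" by (rule spectralE[OF finite_lessThan])
  have e: "onb {..<n} e" using sp by (rule spec_onb)
  have ge: "ip {..<n} (app {..<n} (ent X) (e k)) (app {..<n} (ent X) (e l)) = of_real (q k) * idm k l"
    if "k < n" "l < n" for k l
  proof -
    have "ip {..<n} (e k) (app {..<n} (ent G) (e l)) = (\<Sum>i<n. of_real (q l) * (cnj (e k i) * e l i))"
      unfolding ip_def using that by (intro sum.cong refl) (simp add: app_eigen[OF _ sp])
    also have "\<dots> = of_real (q l) * ip {..<n} (e k) (e l)"
      unfolding ip_def sum_distrib_left ..
    also have "\<dots> = of_real (q k) * idm k l"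
      using e that by (simp add: onb_def idm_def)
    finally show ?thesis by (simp add: gram)
  qed
  have q0: "0 \<le> q k" if "k < n" for k
  proof -
    have "complex_of_real (q k) = of_real (\<Sum>i<n. (cmod (app {..<n} (ent X) (e k) i))\<^sup>2)"
      using ge[OF that that] unfolding ip_self by (simp add: idm_def)
    then have "q k = (\<Sum>i<n. (cmod (app {..<n} (ent X) (e k) i))\<^sup>2)"
      by (simp only: of_real_eq_iff)
    then show ?thesis by (simp add: sum_nonneg)
  qed
  \<comment> \<open>The maximum with 0 makes \<open>s\<close> nonnegative at every index, also
    beyond \<open>n\<close>, where nothing is known about \<open>q\<close>.\<close>
  define s where "s k = sqrt (max 0 (q k))" for k
  have "trace_norm X = (\<Sum>k<n. sqrt (q k))"
    unfolding trace_norm_def G_def[symmetric] eigs_spec[OF G sp] sum_mset_upt by simp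
  also have "\<dots> = (\<Sum>k<n. s k)" using q0 by (intro sum.cong refl) (simp add: s_def)
  finally have "trace_norm X = (\<Sum>k<n. s k)" .
  moreover have "0 \<le> s k" for k by (simp add: s_def)
  moreover have "ip {..<n} (app {..<n} (ent X) (e k)) (app {..<n} (ent X) (e l)) = of_real ((s k)\<^sup>2) * idm k l"
    if "k < n" "l < n" for k l
    using ge[OF that] q0[OF that(1)] by (simp add: s_def)
  ultimately show ?thesis using that e by blast
qed

lemma trace_norm_herm:
  assumes X: "X \<in> carrier_mat n n" and sp: "spec {..<n} (ent X) p e"
  shows "trace_norm X = (\<Sum>k<n. \<bar>p k\<bar>)"
proof -
  have "(adj X * X) $$ (i, j) = (\<Sum>k<n. of_real ((p k)\<^sup>2) * e k i * cnj (e k j))" if ij: "i < n" "j < n" for i j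
  proof -
    have "(adj X * X) $$ (i, j) = (\<Sum>l<n. X $$ (i, l) * X $$ (l, j))"
      unfolding adj_mult_index[OF X ij] using ij
      by (intro sum.cong refl) (simp add: hermD[OF spec_herm[OF sp], of _ i])
    also have "\<dots> = (\<Sum>l<n. \<Sum>k<n. X $$ (i, l) * (of_real (p k) * e k l * cnj (e k j)))"
      using ij by (intro sum.cong refl) (simp add: specD[OF sp] sum_distrib_left)
    also have "\<dots> = (\<Sum>k<n. app {..<n} (ent X) (e k) i * (of_real (p k) * cnj (e k j)))"
      unfolding app_def sum_distrib_right by (subst sum.swap) (simp add: mult_ac)
    also have "\<dots> = (\<Sum>k<n. of_real ((p k)\<^sup>2) * e k i * cnj (e k j))"
      using ij by (intro sum.cong refl) (simp add: app_eigen[OF _ sp] power2_eq_square)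
    finally show ?thesis .
  qed
  then have "spec {..<n} (ent (adj X * X)) (\<lambda>k. (p k)\<^sup>2) e"
    using spec_onb[OF sp] by (simp add: spec_def)
  moreover have "adj X * X \<in> carrier_mat n n" using X by (auto simp: adj_def)
  ultimately show ?thesis
    unfolding trace_norm_def by (simp only: eigs_spec sum_mset_upt) simp
qed

lemma trace_norm_pos:
  assumes X: "X \<in> carrier_mat n n" and "pos {..<n} (ent X)"
  shows "trace_norm X = Re (\<Sum>i<n. X $$ (i, i))"
proof -
  obtain p e where sp: "spec {..<n} (ent X) p e" by (rule spectralE[OF finite_lessThan pos_herm[OF assms(2)]])
  have "trace_norm X = (\<Sum>k<n. p k)"
    unfolding trace_norm_herm[OF X sp] using spec_nonneg[OF _ assms(2) sp] by simp
  then show ?thesis using trace_spec[OF sp] by simp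
qed

text \<open>The easy half of the duality between trace norm and operator norm: in an eigenbasis of
  \<open>X\<close> the diagonal entries of \<open>K\<close> lie between -1 and 1.\<close>

lemma trace_prod_le_trace_norm:
  assumes X: "X \<in> carrier_mat n n" and h: "herm {..<n} (ent X)" and K: "herm {..<n} K"
    and K1: "pos {..<n} (\<lambda>i j. idm i j - K i j)" and K2: "pos {..<n} (\<lambda>i j. idm i j + K i j)"
  shows "Re (\<Sum>i<n. \<Sum>j<n. X $$ (i, j) * K j i) \<le> trace_norm X"
proof -
  obtain p e where sp: "spec {..<n} (ent X) p e" by (rule spectralE[OF finite_lessThan h])
  have "\<bar>Re (qf {..<n} K (e k))\<bar> \<le> 1" if "k < n" for k
  proof -
    have "qf {..<n} idm (e k) = 1"
      using onb_norm[OF spec_onb[OF sp], of k] that by (simp add: qf_idm del: of_real_sum)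
    then show ?thesis
      using pos_qf[OF K1, of "e k"] pos_qf[OF K2, of "e k"] by (simp add: qf_add qf_diff)
  qed
  then have "p k * Re (qf {..<n} K (e k)) \<le> \<bar>p k\<bar>" if "k < n" for k
    using that by (metis abs_ge_self abs_ge_zero abs_mult mult_left_le order_trans)
  then show ?thesis
    unfolding trace_prod_spec[OF sp] trace_norm_herm[OF X sp] by (auto intro!: sum_mono)
qed

subsection \<open>Pair encoding of indices\<close>

lemma bij_betw_decode: "bij_betw (\<lambda>p. (p div D, p mod D)) {..<k * D} ({..<k} \<times> {..<D::nat})"
  by (rule bij_betw_byWitness[where f' = "\<lambda>(r, b). r * D + b"])
     (auto simp: less_mult_imp_div_less intro!: mod_less_divisor Nat.gr0I,
      metis Suc_leI add.commute add_mult_distrib less_le_trans mult_Suc mult_le_mono1 nat_add_left_cancel_less plus_1_eq_Suc)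

lemma encode_less: "r < k \<Longrightarrow> b < D \<Longrightarrow> r * D + b < k * (D::nat)"
  by (metis Suc_leI add.commute less_le_trans mult_Suc mult_le_mono1 nat_add_left_cancel_less)

lemma decode_less: "p < k * D \<Longrightarrow> p div D < k \<and> p mod D < (D::nat)"
  by (cases "D = 0") (auto simp: less_mult_imp_div_less)

lemma sum_decode: "(\<Sum>p<k * D. f (p div D) (p mod D)) = (\<Sum>r<k. \<Sum>b<D::nat. f r b)"
  unfolding sum.cartesian_product
  using sum.reindex_bij_betw[OF bij_betw_decode, of "\<lambda>(r, b). f r b" D k] by simp

lemma sum_encode: "(\<Sum>p<k * D. f p) = (\<Sum>r<k. \<Sum>b<D::nat. f (r * D + b))"
  using sum_decode[of "\<lambda>r b. f (r * D + b)" D k] by simp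

section \<open>The one-shot converse\<close>

text \<open>Gibbs' inequality for a single term, from \<open>ln u \<le> u - 1\<close> at
  \<open>u = y / x\<close>. Summed over two distributions of equal total mass, the terms
  \<open>(y - x) / ln 2\<close> cancel.\<close>

lemma eta_le:
  assumes "0 \<le> x" "0 < y"
  shows "eta x \<le> - x * log 2 y + (y - x) / ln 2"
proof (cases "x = 0")
  case False
  with assms have x: "x > 0" by simp
  have "x * ln (y / x) \<le> x * (y / x - 1)"
    using x assms by (intro mult_left_mono ln_le_minus_one) auto
  moreover have "x * (y / x - 1) = y - x" using x by (simp add: field_simps)
  ultimately have "x * ln y - x * ln x \<le> y - x"
    using x assms by (simp add: ln_div algebra_simps)
  then have "(x * ln y - x * ln x) / ln 2 \<le> (y - x) / ln 2"
    by (rule divide_right_mono) simp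
  moreover have "(x * ln y - x * ln x) / ln 2 = x * log 2 y - x * log 2 x"
    by (simp add: log_def diff_divide_distrib)
  moreover have "eta x = - x * log 2 x" using x by (simp add: eta_def)
  ultimately show ?thesis by linarith
qed (use assms in \<open>simp add: eta_def\<close>)

text \<open>If \<open>\<omega> \<le> \<sigma>\<close>, then testing with \<open>\<sigma>\<^sup>-\<^sup>1 e\<^sub>k\<close> gives \<open>p\<^sub>k \<langle>e\<^sub>k, \<sigma>\<^sup>-\<^sup>1 e\<^sub>k\<rangle> \<le> 1\<close> for
  every eigenvector \<open>e\<^sub>k\<close> of \<open>\<omega>\<close>, which replaces operator monotonicity of the logarithm.\<close>

lemma cross_entropy_le_entropy:
  assumes fin: "finite I" and sp: "spec I \<omega> p e" and pos: "pos I \<omega>"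
    and st: "spec I \<sigma> t h" and t: "\<And>l. l \<in> I \<Longrightarrow> 0 < t l" and le: "pos I (\<lambda>i j. \<sigma> i j - \<omega> i j)"
  shows "(\<Sum>k\<in>I. p k * (\<Sum>l\<in>I. (cmod (ip I (h l) (e k)))\<^sup>2 * (- log 2 (t l)))) \<le> (\<Sum>k\<in>I. eta (p k))"
proof (rule sum_mono)
  fix k assume k: "k \<in> I"
  define w where "w l = (cmod (ip I (h l) (e k)))\<^sup>2" for l
  have w1: "(\<Sum>l\<in>I. w l) = 1"
    unfolding w_def by (rule onb_overlap(1)[OF fin spec_onb[OF sp] spec_onb[OF st] k])
  define a where "a = (\<Sum>l\<in>I. w l / t l)"
  \<comment> \<open>The vector \<open>\<sigma>^-1 e k\<close>, expanded in the eigenbasis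
    \<open>h\<close> of \<sigma>; its overlap with \<open>e k\<close> and its quadratic form under
    \<sigma> are both \<open>a\<close>.\<close>
  define x where "x i = (\<Sum>l\<in>I. of_real (1 / t l) * ip I (h l) (e k) * h l i)" for i
  have ip_x: "ip I u x = (\<Sum>l\<in>I. of_real (1 / t l) * ip I (h l) (e k) * ip I u (h l))" for u
    unfolding x_def ip_def[of I u] sum_distrib_left by (subst sum.swap) (simp add: mult_ac)
  have hx: "ip I (h l) x = of_real (1 / t l) * ip I (h l) (e k)" if "l \<in> I" for l
  proof -
    have "ip I (h l) x = (\<Sum>m\<in>I. (of_real (1 / t m) * ip I (h m) (e k)) * idm l m)"
      unfolding ip_x using spec_onb[OF st] that by (intro sum.cong refl) (simp add: onb_def)
    then show ?thesis by (simp only: idm_sum[OF fin that])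
  qed
  have "qf I \<sigma> x = of_real (\<Sum>l\<in>I. t l * (cmod (ip I (h l) x))\<^sup>2)" by (rule qf_spec[OF st])
  also have "(\<Sum>l\<in>I. t l * (cmod (ip I (h l) x))\<^sup>2) = a"
    unfolding a_def using t by (intro sum.cong refl)
      (simp add: hx norm_mult norm_divide w_def power_mult_distrib power2_eq_square field_simps)
  finally have q\<sigma>: "qf I \<sigma> x = of_real a" .
  have ekx: "ip I (e k) x = of_real a"
  proof -
    have "ip I (e k) x = (\<Sum>l\<in>I. of_real (w l / t l))"
      unfolding ip_x
    proof (intro sum.cong refl)
      fix l
      have "ip I (h l) (e k) * ip I (e k) (h l) = of_real (w l)"
        unfolding w_def complex_norm_square cnj_ip ..
      then show "of_real (1 / t l) * ip I (h l) (e k) * ip I (e k) (h l) = of_real (w l / t l)"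
        by (simp add: mult.assoc)
    qed
    then show ?thesis by (simp add: a_def)
  qed
  have pk: "0 \<le> p k" by (rule spec_nonneg[OF fin pos sp k])
  \<comment> \<open>Only the \<open>k\<close>-th term of the form of \<omega> at \<open>x\<close> is
    kept, and \<omega> is then replaced by \<sigma>.\<close>
  have "p k * a\<^sup>2 = p k * (cmod (ip I (e k) x))\<^sup>2" by (simp add: ekx)
  also have "\<dots> \<le> (\<Sum>m\<in>I. p m * (cmod (ip I (e m) x))\<^sup>2)"
    using spec_nonneg[OF fin pos sp] fin k by (intro member_le_sum) auto
  also have "\<dots> = Re (qf I \<omega> x)" unfolding qf_spec[OF sp] by simp
  also have "\<dots> \<le> Re (qf I \<sigma> x)" using pos_qf[OF le, of x] by (simp add: qf_diff)
  finally have pa: "p k * a\<^sup>2 \<le> a" by (simp add: q\<sigma>)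
  have a0: "a > 0"
  proof -
    obtain l where l: "l \<in> I" "w l \<noteq> 0" using w1 by (metis sum.neutral zero_neq_one)
    show ?thesis unfolding a_def
      by (rule sum_pos2[OF fin l(1)]) (use l t in \<open>auto simp: w_def less_imp_le\<close>)
  qed
  have "p k * a * a \<le> 1 * a" using pa by (simp add: power2_eq_square mult_ac)
  then have pa1: "p k * a \<le> 1" using a0 mult_le_cancel_right_pos by blast
  show "p k * (\<Sum>l\<in>I. (cmod (ip I (h l) (e k)))\<^sup>2 * (- log 2 (t l))) \<le> eta (p k)"
  proof (cases "p k = 0")
    case False
    with pk have pk: "p k > 0" by simp
    \<comment> \<open>Jensen's inequality for the logarithm with weights \<open>w\<close>, again
      from \<open>ln u \<le> u - 1\<close>, now at \<open>u = p k / t l\<close>. The right side adds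
      up to \<open>p k * a - 1 \<le> 0\<close>.\<close>
    have "(\<Sum>l\<in>I. w l * (ln (p k) - ln (t l))) \<le> (\<Sum>l\<in>I. w l * (p k / t l - 1))"
    proof (intro sum_mono mult_left_mono)
      fix l assume "l \<in> I"
      then show "ln (p k) - ln (t l) \<le> p k / t l - 1"
        using ln_le_minus_one[of "p k / t l"] pk t[of l] by (simp add: ln_div)
    qed (simp add: w_def)
    also have "\<dots> = p k * a - (\<Sum>l\<in>I. w l)"
      unfolding a_def by (simp add: algebra_simps sum_subtractf sum_distrib_left)
    also have "\<dots> \<le> 0" using pa1 w1 by simp
    also have "(\<Sum>l\<in>I. w l * (ln (p k) - ln (t l))) = ln (p k) * (\<Sum>l\<in>I. w l) + (\<Sum>l\<in>I. w l * - ln (t l))"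
      by (simp add: right_diff_distrib sum_subtractf sum_distrib_right sum_negf mult.commute)
    finally have *: "(\<Sum>l\<in>I. w l * - ln (t l)) \<le> - ln (p k)" using w1 by simp
    have "(\<Sum>l\<in>I. w l * (- log 2 (t l))) = (\<Sum>l\<in>I. w l * - ln (t l)) / ln 2"
      by (simp add: log_def sum_divide_distrib)
    also have "\<dots> \<le> - ln (p k) / ln 2" using * by (rule divide_right_mono) simp
    finally have "p k * (\<Sum>l\<in>I. w l * (- log 2 (t l))) \<le> p k * (- ln (p k) / ln 2)"
      using pk by (intro mult_left_mono) auto
    then show ?thesis using pk by (simp add: eta_def log_def w_def)
  qed (simp add: eta_def)
qed

text \<open>Klein's inequality against \<open>\<tau> / Tr \<tau>\<close>; the term
  \<open>log 2 (\<Sum>c\<in>B. t c)\<close> pays for the missing normalisation of \<tau>. The scalar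
  inequality \<open>eta_le\<close> is applied to every pair of eigenvalues and averaged with the
  squared overlaps.\<close>

lemma entropy_le_cross_entropy:
  assumes fin: "finite B" and sq: "spec B \<rho> q f" and q: "\<And>b. b \<in> B \<Longrightarrow> 0 \<le> q b" "(\<Sum>b\<in>B. q b) = 1"
    and st: "spec B \<tau> t g" and t: "\<And>c. c \<in> B \<Longrightarrow> 0 < t c"
  shows "(\<Sum>b\<in>B. eta (q b)) \<le> (\<Sum>c\<in>B. Re (qf B \<rho> (g c)) * (- log 2 (t c))) + log 2 (\<Sum>c\<in>B. t c)"
proof -
  define T where "T = (\<Sum>c\<in>B. t c)"
  have "B \<noteq> {}" using q(2) by auto
  then have T: "T > 0" unfolding T_def using fin t by (intro sum_pos) auto
  have tn: "t c \<noteq> 0" if "c \<in> B" for c using t[OF that] by simp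
  define u where "u b c = (cmod (ip B (f b) (g c)))\<^sup>2" for b c
  have u1: "(\<Sum>c\<in>B. u b c) = 1" if "b \<in> B" for b
    unfolding u_def by (rule onb_overlap(2)[OF fin spec_onb[OF st] spec_onb[OF sq] that])
  have u2: "(\<Sum>b\<in>B. u b c) = 1" if "c \<in> B" for c
    unfolding u_def by (rule onb_overlap(1)[OF fin spec_onb[OF st] spec_onb[OF sq] that])
  have "(\<Sum>b\<in>B. eta (q b)) = (\<Sum>b\<in>B. \<Sum>c\<in>B. u b c * eta (q b))"
    by (intro sum.cong refl) (simp add: sum_distrib_right[symmetric] u1)
  also have "\<dots> \<le> (\<Sum>b\<in>B. \<Sum>c\<in>B. u b c * (- q b * log 2 (t c / T) + (t c / T - q b) / ln 2))"
    using q t T by (intro sum_mono mult_left_mono eta_le) (auto simp: u_def)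
  also have "\<dots> = (\<Sum>b\<in>B. \<Sum>c\<in>B. (q b * u b c) * (- log 2 (t c)) + u b c * (q b * log 2 T) + u b c * (t c / T) / ln 2 - u b c * q b / ln 2)"
    using t T by (intro sum.cong refl) (simp add: tn log_divide algebra_simps diff_divide_distrib add_divide_distrib)
  also have "\<dots> = (\<Sum>b\<in>B. \<Sum>c\<in>B. (q b * u b c) * (- log 2 (t c))) + (\<Sum>b\<in>B. (\<Sum>c\<in>B. u b c) * (q b * log 2 T))
      + (\<Sum>b\<in>B. \<Sum>c\<in>B. u b c * (t c / T)) / ln 2 - (\<Sum>b\<in>B. (\<Sum>c\<in>B. u b c) * q b) / ln 2"
    by (simp only: sum.distrib sum_subtractf sum_distrib_right sum_divide_distrib)
  also have "(\<Sum>b\<in>B. (\<Sum>c\<in>B. u b c) * (q b * log 2 T)) = log 2 T"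
    using q(2) by (simp add: u1 flip: sum_distrib_right)
  also have "(\<Sum>b\<in>B. (\<Sum>c\<in>B. u b c) * q b) = 1"
    using q(2) by (simp add: u1)
  also have "(\<Sum>b\<in>B. \<Sum>c\<in>B. u b c * (t c / T)) = (\<Sum>c\<in>B. (\<Sum>b\<in>B. u b c) * (t c / T))"
    unfolding sum_distrib_right by (rule sum.swap)
  also have "\<dots> = 1" using T by (simp add: u2 T_def flip: sum_divide_distrib)
  also have "(\<Sum>b\<in>B. \<Sum>c\<in>B. (q b * u b c) * (- log 2 (t c))) = (\<Sum>c\<in>B. (\<Sum>b\<in>B. q b * u b c) * (- log 2 (t c)))"
    unfolding sum_distrib_right by (rule sum.swap)
  also have "(\<Sum>c\<in>B. (\<Sum>b\<in>B. q b * u b c) * (- log 2 (t c))) = (\<Sum>c\<in>B. Re (qf B \<rho> (g c)) * (- log 2 (t c)))"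
    unfolding qf_spec[OF sq] u_def by simp
  finally show ?thesis by (simp add: T_def)
qed

section \<open>Conditional entropy from an operator bound on the joint state\<close>

lemma sum_pair: "(\<Sum>x\<in>A \<times> B. f x) = (\<Sum>a\<in>A. \<Sum>b\<in>B. f (a, b))"
  by (rule sum.cartesian_product')

lemma qf_partial:
  assumes "finite R" "finite B"
  shows "qf B (\<lambda>b b'. \<Sum>r\<in>R. \<omega> (r, b) (r, b')) v = (\<Sum>r\<in>R. qf (R \<times> B) \<omega> (\<lambda>x. idm r (fst x) * v (snd x)))"
proof -
  have "qf (R \<times> B) \<omega> (\<lambda>x. idm r (fst x) * v (snd x)) = qf B (\<lambda>b b'. \<omega> (r, b) (r, b')) v"
    if "r \<in> R" for r
  proof -
    have "qf (R \<times> B) \<omega> (\<lambda>x. idm r (fst x) * v (snd x)) =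
      (\<Sum>b\<in>B. \<Sum>r1\<in>R. idm r r1 * (\<Sum>r2\<in>R. idm r r2 * (\<Sum>b'\<in>B. cnj (v b) * \<omega> (r1, b) (r2, b') * v b')))"
      unfolding qf_def sum_pair by (subst sum.swap) (simp add: sum_distrib_left mult_ac)
    also have "\<dots> = (\<Sum>b\<in>B. \<Sum>b'\<in>B. cnj (v b) * \<omega> (r, b) (r, b') * v b')"
      by (simp only: idm_sum[OF assms(1) that])
    finally show ?thesis unfolding qf_def .
  qed
  then show ?thesis by (simp add: qf_sum)
qed

lemma onb_idm: "finite I \<Longrightarrow> onb I idm"
  by (auto simp: onb_def ip_def) (auto simp: idm_def)

text \<open>Klein's inequality bounds the entropy of the marginal by
  \<open>- Tr (\<omega>_B log \<tau>) + log Tr \<tau>\<close>. The first term equals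
  \<open>- Tr (\<omega> log (1 \<otimes> \<tau>))\<close>, which is at most the entropy of \<omega>
  because \<omega> lies below \<open>1 \<otimes> \<tau>\<close>.\<close>

lemma conditional_entropy_le:
  assumes fin: "finite R" "finite B" and pos: "pos (R \<times> B) \<omega>"
    and le: "pos (R \<times> B) (\<lambda>x y. idm (fst x) (fst y) * \<tau> (snd x) (snd y) - \<omega> x y)"
    and st: "spec B \<tau> t g" and t: "\<And>c. c \<in> B \<Longrightarrow> 0 < t c"
    and tr: "(\<Sum>r\<in>R. \<Sum>b\<in>B. \<omega> (r, b) (r, b)) = 1"
    and sp: "spec (R \<times> B) \<omega> p e" and sq: "spec B (\<lambda>b b'. \<Sum>r\<in>R. \<omega> (r, b) (r, b')) q f"
  shows "(\<Sum>b\<in>B. eta (q b)) - (\<Sum>x\<in>R \<times> B. eta (p x)) \<le> log 2 (\<Sum>c\<in>B. t c)"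
proof -
  define \<rho> where "\<rho> b b' = (\<Sum>r\<in>R. \<omega> (r, b) (r, b'))" for b b'
  define h where "h k i = (idm (fst k) (fst i) * g (snd k) (snd i))" for k i :: "'a \<times> 'b"
  have sh: "spec (R \<times> B) (\<lambda>x y. idm (fst x) (fst y) * \<tau> (snd x) (snd y)) (\<lambda>k. t (snd k)) h"
    using spec_tensor[OF fin onb_spec[OF onb_idm[OF fin(1)]] st] by (simp add: h_def[abs_def])
  have sq': "spec B \<rho> q f" using sq by (simp add: \<rho>_def[abs_def])
  have qrho: "qf B \<rho> v = (\<Sum>r\<in>R. qf (R \<times> B) \<omega> (\<lambda>x. idm r (fst x) * v (snd x)))" for v
    unfolding \<rho>_def[abs_def] by (rule qf_partial[OF fin])
  have "pos B \<rho>"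
  proof -
    have "pos B (\<lambda>b b'. \<omega> (r, b) (r, b'))" if "r \<in> R" for r
      using pos_reindex[of "R \<times> B" "\<lambda>b. (r, b)" B \<omega>] fin pos that by auto
    then show ?thesis unfolding \<rho>_def[abs_def] by (rule pos_sum)
  qed
  then have q: "0 \<le> q b" if "b \<in> B" for b using spec_nonneg[OF fin(2) _ sq' that] by simp
  have "(\<Sum>b\<in>B. \<rho> b b) = 1" unfolding \<rho>_def using tr by (subst sum.swap) simp
  then have q1: "(\<Sum>b\<in>B. q b) = 1" using trace_spec[OF sq'] by (simp only: of_real_eq_1_iff)
  have "(\<Sum>b\<in>B. eta (q b)) \<le> (\<Sum>c\<in>B. Re (qf B \<rho> (g c)) * (- log 2 (t c))) + log 2 (\<Sum>c\<in>B. t c)"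
    by (rule entropy_le_cross_entropy[OF fin(2) sq' q q1 st t])
  also have "(\<Sum>c\<in>B. Re (qf B \<rho> (g c)) * (- log 2 (t c))) =
     (\<Sum>c\<in>B. \<Sum>r\<in>R. (\<Sum>k\<in>R \<times> B. p k * (cmod (ip (R \<times> B) (e k) (h (r, c))))\<^sup>2) * (- log 2 (t c)))"
  proof (intro sum.cong refl)
    fix c
    have "Re (qf B \<rho> (g c)) = (\<Sum>r\<in>R. \<Sum>k\<in>R \<times> B. p k * (cmod (ip (R \<times> B) (e k) (h (r, c))))\<^sup>2)"
      unfolding qrho qf_spec[OF sp] by (simp add: h_def[abs_def])
    then show "Re (qf B \<rho> (g c)) * (- log 2 (t c)) =
      (\<Sum>r\<in>R. (\<Sum>k\<in>R \<times> B. p k * (cmod (ip (R \<times> B) (e k) (h (r, c))))\<^sup>2) * (- log 2 (t c)))"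
      by (simp add: sum_distrib_right sum_negf)
  qed
  also have "\<dots> = (\<Sum>l\<in>R \<times> B. \<Sum>k\<in>R \<times> B. p k * ((cmod (ip (R \<times> B) (e k) (h l)))\<^sup>2 * (- log 2 (t (snd l)))))"
    unfolding sum_pair[where f = "\<lambda>l. \<Sum>k\<in>R \<times> B. p k * ((cmod (ip (R \<times> B) (e k) (h l)))\<^sup>2 * (- log 2 (t (snd l))))"] sum_distrib_right
    by (subst sum.swap) (simp add: mult.assoc)
  also have "\<dots> = (\<Sum>k\<in>R \<times> B. p k * (\<Sum>l\<in>R \<times> B. (cmod (ip (R \<times> B) (h l) (e k)))\<^sup>2 * (- log 2 (t (snd l)))))"
  proof -
    have "cmod (ip (R \<times> B) (h l) (e k)) = cmod (ip (R \<times> B) (e k) (h l))" for k l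
      by (metis cnj_ip complex_mod_cnj)
    then show ?thesis unfolding sum_distrib_left by (subst sum.swap) simp
  qed
  also have "\<dots> \<le> (\<Sum>k\<in>R \<times> B. eta (p k))"
    using t by (intro cross_entropy_le_entropy[OF _ sp pos sh _ le]) (auto simp: fin)
  finally show ?thesis by simp
qed

text \<open>Up to a factor 2 the operator is the sum over \<open>(r, s)\<close> of the projections onto the vectors
  \<open>|r\<rangle> \<otimes> u\<^sub>s \<plusminus> |s\<rangle> \<otimes> u\<^sub>r\<close> (with conjugated entries).\<close>

lemma pos_reduction_rank1:
  fixes u :: "'r \<times> 'b \<Rightarrow> complex"
  assumes "finite R" "finite B" and \<epsilon>: "\<epsilon> = 1 \<or> \<epsilon> = -1"
  shows "pos (R \<times> B) (\<lambda>x y. idm (fst x) (fst y) * (\<Sum>s\<in>R. u (s, snd y) * cnj (u (s, snd x)))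
     + of_real \<epsilon> * (u (fst x, snd y) * cnj (u (fst y, snd x))))"
proof -
  define w where "w rs x = idm (fst rs) (fst x) * cnj (u (snd rs, snd x)) + of_real \<epsilon> * idm (snd rs) (fst x) * cnj (u (fst rs, snd x))"
    for rs :: "'r \<times> 'r" and x :: "'r \<times> 'b"
  have ee: "complex_of_real \<epsilon> * of_real \<epsilon> = 1" using \<epsilon> by auto
  have "pos (R \<times> B) (\<lambda>x y. of_real (1/2) * (\<Sum>rs\<in>R \<times> R. w rs x * cnj (w rs y)))"
    by (intro pos_scale pos_sum pos_rank1) simp
  moreover have "of_real (1/2) * (\<Sum>rs\<in>R \<times> R. w rs x * cnj (w rs y)) =
      idm (fst x) (fst y) * (\<Sum>s\<in>R. u (s, snd y) * cnj (u (s, snd x))) + of_real \<epsilon> * (u (fst x, snd y) * cnj (u (fst y, snd x)))"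
    if "x \<in> R \<times> B" "y \<in> R \<times> B" for x y
  proof -
    obtain x1 x2 y1 y2 where xy [simp]: "x = (x1, x2)" "y = (y1, y2)" by fastforce
    have in1: "x1 \<in> R" "y1 \<in> R" using that by auto
    have "(\<Sum>rs\<in>R \<times> R. w rs x * cnj (w rs y)) = (\<Sum>r\<in>R. \<Sum>s\<in>R.
        (idm r x1 * idm r y1) * (cnj (u (s, x2)) * u (s, y2))
      + (of_real \<epsilon> * of_real \<epsilon>) * ((cnj (u (r, x2)) * u (r, y2)) * (idm s x1 * idm s y1))
      + of_real \<epsilon> * ((idm r x1 * u (r, y2)) * (idm s y1 * cnj (u (s, x2))))
      + of_real \<epsilon> * ((idm r y1 * cnj (u (r, x2))) * (idm s x1 * u (s, y2))))"
      unfolding sum_pair w_def by (intro sum.cong refl) (simp add: algebra_simps)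
    also have "\<dots> = (\<Sum>r\<in>R. idm r x1 * idm r y1) * (\<Sum>s\<in>R. cnj (u (s, x2)) * u (s, y2))
      + (\<Sum>r\<in>R. cnj (u (r, x2)) * u (r, y2)) * (\<Sum>s\<in>R. idm s x1 * idm s y1)
      + of_real \<epsilon> * ((\<Sum>r\<in>R. idm r x1 * u (r, y2)) * (\<Sum>s\<in>R. idm s y1 * cnj (u (s, x2))))
      + of_real \<epsilon> * ((\<Sum>r\<in>R. idm r y1 * cnj (u (r, x2))) * (\<Sum>s\<in>R. idm s x1 * u (s, y2)))"
      by (simp only: ee mult_1 sum.distrib sum_product) (simp only: sum_distrib_left)
    also have "\<dots> = 2 * (idm x1 y1 * (\<Sum>s\<in>R. u (s, y2) * cnj (u (s, x2)))) + 2 * (of_real \<epsilon> * (u (x1, y2) * cnj (u (y1, x2))))"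
      using assms in1 by (simp add: mult.commute)
    finally show ?thesis by simp
  qed
  ultimately show ?thesis
    by (rule iffD1[OF pos_cong, rotated])
qed

text \<open>Everything is linear in \<open>P\<close>, so a spectral decomposition with nonnegative
  weights reduces the claim to rank one. The second argument order
  \<open>(s, snd y) (s, snd x)\<close> is the transpose of the marginal, matching the partial
  transpose.\<close>

lemma pos_reduction:
  fixes P :: "'r \<times> 'b \<Rightarrow> 'r \<times> 'b \<Rightarrow> complex"
  assumes fin: "finite R" "finite B" and \<epsilon>: "\<epsilon> = 1 \<or> \<epsilon> = -1" and P: "pos (R \<times> B) P"
  shows "pos (R \<times> B) (\<lambda>x y. idm (fst x) (fst y) * (\<Sum>s\<in>R. P (s, snd y) (s, snd x))
     + of_real \<epsilon> * P (fst x, snd y) (fst y, snd x))"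
proof -
  have finRB: "finite (R \<times> B)" using fin by simp
  obtain p e where sp: "spec (R \<times> B) P p e" by (rule spectralE[OF finRB pos_herm[OF P]])
  have "pos (R \<times> B) (\<lambda>x y. \<Sum>k\<in>R \<times> B. of_real (p k) * (idm (fst x) (fst y) * (\<Sum>s\<in>R. e k (s, snd y) * cnj (e k (s, snd x)))
     + of_real \<epsilon> * (e k (fst x, snd y) * cnj (e k (fst y, snd x)))))"
    by (intro pos_sum pos_scale pos_reduction_rank1 fin \<epsilon> spec_nonneg[OF finRB P sp])
  moreover have "(\<Sum>k\<in>R \<times> B. of_real (p k) * (idm (fst x) (fst y) * (\<Sum>s\<in>R. e k (s, snd y) * cnj (e k (s, snd x)))
     + of_real \<epsilon> * (e k (fst x, snd y) * cnj (e k (fst y, snd x))))) =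
     idm (fst x) (fst y) * (\<Sum>s\<in>R. P (s, snd y) (s, snd x)) + of_real \<epsilon> * P (fst x, snd y) (fst y, snd x)"
    if "x \<in> R \<times> B" "y \<in> R \<times> B" for x y
  proof -
    obtain x1 x2 y1 y2 where xy: "x = (x1, x2)" "y = (y1, y2)" "x1 \<in> R" "y1 \<in> R" "x2 \<in> B" "y2 \<in> B" using \<open>x \<in> R \<times> B\<close> \<open>y \<in> R \<times> B\<close> by fastforce
    have 1: "(\<Sum>s\<in>R. P (s, y2) (s, x2)) = (\<Sum>k\<in>R \<times> B. of_real (p k) * (\<Sum>s\<in>R. e k (s, y2) * cnj (e k (s, x2))))"
      unfolding sum_distrib_left using xy by (subst sum.swap) (simp add: specD[OF sp] mult.assoc)
    have 2: "P (x1, y2) (y1, x2) = (\<Sum>k\<in>R \<times> B. of_real (p k) * (e k (x1, y2) * cnj (e k (y1, x2))))"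
      using xy by (simp add: specD[OF sp] mult.assoc)
    show ?thesis unfolding xy(1,2) fst_conv snd_conv 1 2 sum_distrib_left
      by (simp add: sum.distrib sum_distrib_left algebra_simps)
  qed
  ultimately show ?thesis
    by (rule iffD1[OF pos_cong, rotated])
qed

text \<open>The state \<open>(id \<otimes> N)(|\<psi>\<rangle>\<langle>\<psi>|)\<close> in terms of the Choi matrix \<open>J\<close> of \<open>N\<close>.\<close>

definition out :: "'a set \<Rightarrow> ('r \<Rightarrow> 'a \<Rightarrow> complex) \<Rightarrow> ('a \<times> 'b \<Rightarrow> 'a \<times> 'b \<Rightarrow> complex) \<Rightarrow> 'r \<times> 'b \<Rightarrow> 'r \<times> 'b \<Rightarrow> complex" where
  "out A \<psi> J x y = (\<Sum>a\<in>A. \<Sum>a'\<in>A. \<psi> (fst x) a * J (a, snd x) (a', snd y) * cnj (\<psi> (fst y) a'))"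

definition ptB :: "('a \<times> 'b \<Rightarrow> 'a \<times> 'b \<Rightarrow> complex) \<Rightarrow> 'a \<times> 'b \<Rightarrow> 'a \<times> 'b \<Rightarrow> complex" where
  "ptB X x y = X (fst x, snd y) (fst y, snd x)"

text \<open>The Lagrange dual of the program for \<Gamma>: \<open>V\<close> and \<open>Y\<close> are
  the multipliers of the upper and the lower bound on the partial transpose of \<open>R\<close>. The
  dual objective, the largest eigenvalue of \<open>Tr_B (V + Y)\<close>, appears as a threshold
  \<mu>.\<close>

definition dual_feasible :: "'a set \<Rightarrow> 'b set \<Rightarrow> real \<Rightarrow> ('a \<times> 'b \<Rightarrow> 'a \<times> 'b \<Rightarrow> complex) \<Rightarrow> bool" where
  "dual_feasible A B \<mu> J \<longleftrightarrow> (\<exists>V Y. pos (A \<times> B) V \<and> pos (A \<times> B) Y \<and>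
     pos (A \<times> B) (\<lambda>x y. ptB V x y - ptB Y x y - J x y) \<and>
     pos A (\<lambda>a a'. of_real \<mu> * idm a a' - (\<Sum>b\<in>B. V (a, b) (a', b) + Y (a, b) (a', b))))"

section \<open>Channel outputs on purified inputs, expressed by Choi matrices\<close>

lemma out_pullback:
  assumes "finite B" "x \<in> R \<times> B" "y \<in> R \<times> B"
  shows "out A \<psi> J x y = (\<Sum>i\<in>A \<times> B. \<Sum>j\<in>A \<times> B.
    (\<psi> (fst x) (fst i) * idm (snd x) (snd i)) * J i j * cnj (\<psi> (fst y) (fst j) * idm (snd y) (snd j)))"
proof -
  have xy: "snd x \<in> B" "snd y \<in> B" using assms by auto
  have "(\<Sum>i\<in>A \<times> B. \<Sum>j\<in>A \<times> B. (\<psi> (fst x) (fst i) * idm (snd x) (snd i)) * J i j * cnj (\<psi> (fst y) (fst j) * idm (snd y) (snd j))) =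
    (\<Sum>a\<in>A. \<Sum>b\<in>B. idm (snd x) b * (\<Sum>a'\<in>A. \<Sum>b'\<in>B. idm (snd y) b' * (\<psi> (fst x) a * J (a, b) (a', b') * cnj (\<psi> (fst y) a'))))"
    unfolding sum_pair by (simp add: sum_distrib_left mult_ac)
  also have "\<dots> = out A \<psi> J x y"
    unfolding out_def using assms(1) xy by simp
  finally show ?thesis ..
qed

lemma pos_out:
  assumes "finite B" "pos (A \<times> B) J"
  shows "pos (R \<times> B) (out A \<psi> J)"
  by (rule iffD1[OF pos_cong pos_pullback[OF assms(2)]]) (rule out_pullback[OF assms(1), symmetric])

lemma sum_out_diag:
  "(\<Sum>b\<in>B. out A \<psi> J (r, b) (r, b)) = qf A (\<lambda>a a'. \<Sum>b\<in>B. J (a, b) (a', b)) (\<lambda>a. cnj (\<psi> r a))"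
proof -
  have "(\<Sum>b\<in>B. out A \<psi> J (r, b) (r, b)) = (\<Sum>a\<in>A. \<Sum>b\<in>B. \<Sum>a'\<in>A. \<psi> r a * J (a, b) (a', b) * cnj (\<psi> r a'))"
    unfolding out_def by (subst sum.swap) simp
  also have "\<dots> = (\<Sum>a\<in>A. \<Sum>a'\<in>A. \<Sum>b\<in>B. \<psi> r a * J (a, b) (a', b) * cnj (\<psi> r a'))"
    by (rule sum.cong[OF refl], rule sum.swap)
  finally show ?thesis unfolding qf_def by (simp add: sum_distrib_left sum_distrib_right)
qed

lemma trace_out:
  assumes "finite A" and tp: "\<And>a a'. a \<in> A \<Longrightarrow> a' \<in> A \<Longrightarrow> (\<Sum>b\<in>B. J (a, b) (a', b)) = idm a a'"
    and \<psi>: "(\<Sum>r\<in>R. \<Sum>a\<in>A. (cmod (\<psi> r a))\<^sup>2) = 1"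
  shows "(\<Sum>r\<in>R. \<Sum>b\<in>B. out A \<psi> J (r, b) (r, b)) = 1"
proof -
  have "(\<Sum>b\<in>B. out A \<psi> J (r, b) (r, b)) = of_real (\<Sum>a\<in>A. (cmod (\<psi> r a))\<^sup>2)" for r
  proof -
    have "(\<Sum>b\<in>B. out A \<psi> J (r, b) (r, b)) = qf A idm (\<lambda>a. cnj (\<psi> r a))"
      unfolding sum_out_diag using tp by (intro qf_cong) auto
    then show ?thesis using assms by (simp add: qf_idm)
  qed
  then have "(\<Sum>r\<in>R. \<Sum>b\<in>B. out A \<psi> J (r, b) (r, b)) = of_real (\<Sum>r\<in>R. \<Sum>a\<in>A. (cmod (\<psi> r a))\<^sup>2)"
    by simp
  then show ?thesis unfolding \<psi> by simp
qed

lemma coherent_information_le: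
  fixes J :: "'a \<times> 'b \<Rightarrow> 'a \<times> 'b \<Rightarrow> complex" and \<psi> :: "'r \<Rightarrow> 'a \<Rightarrow> complex"
  assumes fin: "finite R" "finite A" "finite B" and df: "dual_feasible A B \<mu> J" and J: "pos (A \<times> B) J"
    and tp: "\<And>a a'. a \<in> A \<Longrightarrow> a' \<in> A \<Longrightarrow> (\<Sum>b\<in>B. J (a, b) (a', b)) = idm a a'"
    and \<psi>: "(\<Sum>r\<in>R. \<Sum>a\<in>A. (cmod (\<psi> r a))\<^sup>2) = 1" and \<nu>: "\<mu> < \<nu>"
    and sp: "spec (R \<times> B) (out A \<psi> J) p e"
    and sq: "spec B (\<lambda>b b'. \<Sum>r\<in>R. out A \<psi> J (r, b) (r, b')) q f"
  shows "(\<Sum>b\<in>B. eta (q b)) - (\<Sum>x\<in>R \<times> B. eta (p x)) \<le> log 2 \<nu>"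
proof -
  obtain V Y where V: "pos (A \<times> B) V" and Y: "pos (A \<times> B) Y"
    and VY: "pos (A \<times> B) (\<lambda>x y. ptB V x y - ptB Y x y - J x y)"
    and mu: "pos A (\<lambda>a a'. of_real \<mu> * idm a a' - (\<Sum>b\<in>B. V (a, b) (a', b) + Y (a, b) (a', b)))"
    using df unfolding dual_feasible_def by auto
  define P where "P = out A \<psi> V"
  define N where "N = out A \<psi> Y"
  have P: "pos (R \<times> B) P" and N: "pos (R \<times> B) N"
    unfolding P_def N_def by (intro pos_out fin V Y)+
  \<comment> \<open>The transposed marginal of \<open>P + N\<close>. Its trace is the expectation of
    \<open>Tr_B (V + Y)\<close> in the input state, hence at most \<mu>.\<close>
  define \<tau>0 where "\<tau>0 b b' = (\<Sum>s\<in>R. P (s, b') (s, b)) + (\<Sum>s\<in>R. N (s, b') (s, b))" for b b'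
  have part: "pos B (\<lambda>b b'. \<Sum>s\<in>R. Q (s, b') (s, b))" if "pos (R \<times> B) Q" for Q
  proof (rule pos_sum)
    fix s assume "s \<in> R"
    then have "pos B (\<lambda>b b'. Q (s, b) (s, b'))"
      using pos_reindex[of "R \<times> B" "\<lambda>b. (s, b)" B Q] fin that by auto
    then show "pos B (\<lambda>b b'. Q (s, b') (s, b))" by (rule pos_transpose)
  qed
  have \<tau>0: "pos B \<tau>0" unfolding \<tau>0_def by (intro pos_add part P N)
  obtain t0 g where st0: "spec B \<tau>0 t0 g" by (rule spectralE[OF fin(3) pos_herm[OF \<tau>0]])
  \<comment> \<open>A multiple of the identity makes \<tau> invertible, as its logarithm demands,
    and may raise the trace by at most \<open>\<nu> - \<mu>\<close>. The 1 in the denominator covers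
    an empty \<open>B\<close>.\<close>
  define \<epsilon> where "\<epsilon> = (\<nu> - \<mu>) / (card B + 1)"
  have \<epsilon>: "\<epsilon> > 0" "\<mu> + card B * \<epsilon> \<le> \<nu>" using \<nu> by (auto simp: \<epsilon>_def field_simps)
  define \<tau> where "\<tau> b b' = \<tau>0 b b' + of_real \<epsilon> * idm b b'" for b b'
  have st: "spec B \<tau> (\<lambda>k. t0 k + \<epsilon>) g" unfolding \<tau>_def by (rule spec_shift[OF st0])
  have t: "0 < t0 c + \<epsilon>" if "c \<in> B" for c
    using spec_nonneg[OF fin(3) \<tau>0 st0 that] \<epsilon> by simp
  have "(\<Sum>c\<in>B. t0 c) \<le> \<mu>"
  proof -
    have "complex_of_real (\<Sum>c\<in>B. t0 c) = (\<Sum>b\<in>B. \<tau>0 b b)" by (rule trace_spec[OF st0, symmetric])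
    also have "\<dots> = (\<Sum>s\<in>R. \<Sum>b\<in>B. P (s, b) (s, b)) + (\<Sum>s\<in>R. \<Sum>b\<in>B. N (s, b) (s, b))"
      unfolding \<tau>0_def sum.distrib by (subst (1 2) sum.swap) simp
    also have "\<dots> = (\<Sum>s\<in>R. qf A (\<lambda>a a'. \<Sum>b\<in>B. V (a, b) (a', b) + Y (a, b) (a', b)) (\<lambda>a. cnj (\<psi> s a)))"
      unfolding P_def N_def sum_out_diag by (simp add: sum.distrib qf_add)
    finally have "(\<Sum>c\<in>B. t0 c) = (\<Sum>s\<in>R. Re (qf A (\<lambda>a a'. \<Sum>b\<in>B. V (a, b) (a', b) + Y (a, b) (a', b)) (\<lambda>a. cnj (\<psi> s a))))"
      by (metis Re_complex_of_real Re_sum)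
    also have "\<dots> \<le> (\<Sum>s\<in>R. \<mu> * (\<Sum>a\<in>A. (cmod (\<psi> s a))\<^sup>2))"
    proof (rule sum_mono)
      fix s
      show "Re (qf A (\<lambda>a a'. \<Sum>b\<in>B. V (a, b) (a', b) + Y (a, b) (a', b)) (\<lambda>a. cnj (\<psi> s a))) \<le> \<mu> * (\<Sum>a\<in>A. (cmod (\<psi> s a))\<^sup>2)"
        using pos_qf[OF mu, of "\<lambda>a. cnj (\<psi> s a)"] fin
        by (simp add: qf_diff qf_scale qf_idm del: of_real_sum)
    qed
    also have "\<dots> = \<mu>" using \<psi> by (simp add: sum_distrib_left[symmetric])
    finally show ?thesis .
  qed
  then have Tle: "(\<Sum>c\<in>B. t0 c + \<epsilon>) \<le> \<nu>" using \<epsilon>(2) by (simp add: sum.distrib)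
  have \<omega>: "pos (R \<times> B) (out A \<psi> J)" by (intro pos_out fin J)
  have trace: "(\<Sum>r\<in>R. \<Sum>b\<in>B. out A \<psi> J (r, b) (r, b)) = 1"
    by (rule trace_out[OF fin(2) tp \<psi>])
  have "B \<noteq> {}" using trace by auto
  have 1: "pos (R \<times> B) (\<lambda>x y. idm (fst x) (fst y) * (\<Sum>s\<in>R. P (s, snd y) (s, snd x)) + of_real (-1) * P (fst x, snd y) (fst y, snd x))"
    by (rule pos_reduction[OF fin(1,3) _ P]) simp
  have 2: "pos (R \<times> B) (\<lambda>x y. idm (fst x) (fst y) * (\<Sum>s\<in>R. N (s, snd y) (s, snd x)) + of_real 1 * N (fst x, snd y) (fst y, snd x))"
    by (rule pos_reduction[OF fin(1,3) _ N]) simp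
  have 3: "pos (R \<times> B) (out A \<psi> (\<lambda>x y. ptB V x y - ptB Y x y - J x y))"
    by (intro pos_out fin VY)
  have 4: "pos (R \<times> B) (\<lambda>x y. of_real \<epsilon> * idm x y)"
    using \<epsilon> fin by (intro pos_scale pos_idm) auto
  \<comment> \<open>The difference is a sum of four positive pieces: the reduction inequality for
    \<open>P\<close>, its companion for \<open>N\<close>, the dual constraint pulled through \<psi>,
    and the shift by \<epsilon>. The partial transposes of \<open>P\<close> and \<open>N\<close>
    cancel.\<close>
  have "pos (R \<times> B) (\<lambda>x y. idm (fst x) (fst y) * \<tau> (snd x) (snd y) - out A \<psi> J x y)"
  proof (rule iffD1[OF pos_cong pos_add[OF pos_add[OF pos_add[OF 1 2] 3] 4]])
    fix x y
    have "out A \<psi> (\<lambda>x y. ptB V x y - ptB Y x y - J x y) x y =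
       P (fst x, snd y) (fst y, snd x) - N (fst x, snd y) (fst y, snd x) - out A \<psi> J x y"
      unfolding P_def N_def out_def ptB_def by (simp add: algebra_simps sum_subtractf sum.distrib)
    moreover have "idm x y = idm (fst x) (fst y) * idm (snd x) (snd y)"
      by (simp add: idm_def prod_eq_iff)
    ultimately show "idm (fst x) (fst y) * (\<Sum>s\<in>R. P (s, snd y) (s, snd x)) + of_real (-1) * P (fst x, snd y) (fst y, snd x) +
      (idm (fst x) (fst y) * (\<Sum>s\<in>R. N (s, snd y) (s, snd x)) + of_real 1 * N (fst x, snd y) (fst y, snd x)) +
      out A \<psi> (\<lambda>x y. ptB V x y - ptB Y x y - J x y) x y + of_real \<epsilon> * idm x y = idm (fst x) (fst y) * \<tau> (snd x) (snd y) - out A \<psi> J x y"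
      unfolding \<tau>_def \<tau>0_def by (simp add: algebra_simps)
  qed
  from conditional_entropy_le[OF fin(1,3) \<omega> this st t trace sp sq]
  have "(\<Sum>b\<in>B. eta (q b)) - (\<Sum>x\<in>R \<times> B. eta (p x)) \<le> log 2 (\<Sum>c\<in>B. t0 c + \<epsilon>)" .
  also have "\<dots> \<le> log 2 \<nu>"
    using Tle t fin(3) \<open>B \<noteq> {}\<close> sum_pos[of B "\<lambda>c. t0 c + \<epsilon>"] by (subst log_le_cancel_iff) auto
  finally show ?thesis .
qed

section \<open>A theorem of the alternative for the positive cone\<close>

text \<open>For hermitian arguments this is the real Hilbert-Schmidt inner product
  \<open>Tr (M N)\<close>.\<close>

definition rp :: "'i set \<Rightarrow> ('i \<Rightarrow> 'i \<Rightarrow> complex) \<Rightarrow> ('i \<Rightarrow> 'i \<Rightarrow> complex) \<Rightarrow> real" where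
  "rp I M N = Re (\<Sum>i\<in>I. \<Sum>j\<in>I. M i j * N j i)"

lemma rp_cong:
  assumes "\<And>i j. i \<in> I \<Longrightarrow> j \<in> I \<Longrightarrow> M i j = M' i j" "\<And>i j. i \<in> I \<Longrightarrow> j \<in> I \<Longrightarrow> N i j = N' i j"
  shows "rp I M N = rp I M' N'"
  unfolding rp_def using assms by simp

lemma rp_commute: "rp I M N = rp I N M"
  unfolding rp_def by (subst sum.swap) (simp add: mult.commute)

lemma rp_add_right: "rp I M (\<lambda>i j. N i j + P i j) = rp I M N + rp I M P"
  unfolding rp_def by (simp add: algebra_simps sum.distrib)

lemma rp_diff_right: "rp I M (\<lambda>i j. N i j - P i j) = rp I M N - rp I M P"
  unfolding rp_def by (simp add: algebra_simps sum_subtractf)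

lemma rp_scale_right: "rp I M (\<lambda>i j. of_real c * N i j) = c * rp I M N"
proof -
  have "(\<Sum>i\<in>I. \<Sum>j\<in>I. M i j * (of_real c * N j i)) = of_real c * (\<Sum>i\<in>I. \<Sum>j\<in>I. M i j * N j i)"
    by (simp add: sum_distrib_left mult_ac)
  then show ?thesis unfolding rp_def by simp
qed

lemma rp_add_left: "rp I (\<lambda>i j. N i j + P i j) M = rp I N M + rp I P M"
  unfolding rp_def by (simp add: algebra_simps sum.distrib)

lemma rp_diff_left: "rp I (\<lambda>i j. N i j - P i j) M = rp I N M - rp I P M"
  unfolding rp_def by (simp add: algebra_simps sum_subtractf)

lemma rp_scale_left: "rp I (\<lambda>i j. of_real c * N i j) M = c * rp I N M"
  unfolding rp_commute[of I _ M] by (rule rp_scale_right)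

lemma rp_nonneg: "finite I \<Longrightarrow> pos I M \<Longrightarrow> pos I N \<Longrightarrow> 0 \<le> rp I M N"
  unfolding rp_def by (rule trace_prod_nonneg)

lemma rp_rank1: "rp I M (\<lambda>i j. v i * cnj (v j)) = Re (qf I M v)"
  unfolding rp_def qf_def by (simp add: mult_ac)

lemma rp_self:
  assumes "herm I M"
  shows "rp I M M = (\<Sum>i\<in>I. \<Sum>j\<in>I. (cmod (M i j))\<^sup>2)"
proof -
  have "(\<Sum>i\<in>I. \<Sum>j\<in>I. M i j * M j i) = of_real (\<Sum>i\<in>I. \<Sum>j\<in>I. (cmod (M i j))\<^sup>2)"
    unfolding of_real_sum complex_norm_square
    by (intro sum.cong refl) (simp add: hermD[OF assms])
  then show ?thesis unfolding rp_def by simp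
qed

lemma rp_self_nonneg: "herm I M \<Longrightarrow> 0 \<le> rp I M M"
  by (simp add: rp_self sum_nonneg)

lemma rp_self_spec:
  assumes "finite I" "spec I M p e"
  shows "rp I M M = (\<Sum>k\<in>I. (p k)\<^sup>2)"
  unfolding rp_def trace_prod_spec[OF assms(2)]
  using qf_eigen[OF assms] by (simp add: power2_eq_square)

lemma jordan_decomposition:
  assumes fin: "finite I" and z: "herm I z"
  obtains P V where "pos I P" "pos I V" "rp I V P = 0"
    "\<And>i j. i \<in> I \<Longrightarrow> j \<in> I \<Longrightarrow> z i j = P i j - V i j"
proof -
  obtain p e where sp: "spec I z p e" by (rule spectralE[OF fin z])
  define P where "P i j = (\<Sum>k\<in>I. of_real (max 0 (p k)) * e k i * cnj (e k j))" for i j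
  define V where "V i j = (\<Sum>k\<in>I. of_real (max 0 (- p k)) * e k i * cnj (e k j))" for i j
  have sP: "spec I P (\<lambda>k. max 0 (p k)) e" and sV: "spec I V (\<lambda>k. max 0 (- p k)) e"
    using spec_onb[OF sp] by (auto simp: spec_def P_def V_def)
  have "pos I P" "pos I V" by (rule spec_pos[OF sP], simp) (rule spec_pos[OF sV], simp)
  moreover have "rp I V P = 0"
  proof -
    have "(\<Sum>k\<in>I. complex_of_real (max 0 (- p k)) * qf I P (e k)) = 0"
      by (intro sum.neutral ballI) (auto simp: qf_eigen[OF fin sP] max_def)
    then show ?thesis unfolding rp_def trace_prod_spec[OF sV] by simp
  qed
  moreover have "z i j = P i j - V i j" if "i \<in> I" "j \<in> I" for i j
    unfolding specD[OF sp that] P_def V_def sum_subtractf[symmetric]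
    by (intro sum.cong refl) (simp add: max_def)
  ultimately show ?thesis using that by blast
qed

text \<open>\<open>V\<close> is an almost shortest negative part of an element of \<open>Z\<close>; as in the projection theorem,
  moving towards \<open>z'\<close> cannot shorten it much, and no compactness is needed.\<close>

theorem alternative:
  fixes Z :: "('i \<Rightarrow> 'i \<Rightarrow> complex) set"
  assumes fin: "finite I" and ne: "Z \<noteq> {}" and Zh: "\<And>z. z \<in> Z \<Longrightarrow> herm I z"
    and conv: "\<And>z z' t. z \<in> Z \<Longrightarrow> z' \<in> Z \<Longrightarrow> 0 \<le> t \<Longrightarrow> t \<le> 1 \<Longrightarrow> (\<lambda>i j. z i j + of_real t * (z' i j - z i j)) \<in> Z"
    and bdd: "\<And>z z'. z \<in> Z \<Longrightarrow> z' \<in> Z \<Longrightarrow> rp I (\<lambda>i j. z' i j - z i j) (\<lambda>i j. z' i j - z i j) \<le> D"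
    and \<delta>: "0 < \<delta>" "\<And>z. z \<in> Z \<Longrightarrow> \<not> pos I (\<lambda>i j. z i j + of_real \<delta> * idm i j)"
  obtains V where "pos I V" "\<And>z. z \<in> Z \<Longrightarrow> rp I V z < 0"
proof -
  define S where "S = {rp I V V | V P z. z \<in> Z \<and> pos I P \<and> pos I V \<and> rp I V P = 0 \<and>
    (\<forall>i\<in>I. \<forall>j\<in>I. z i j = P i j - V i j)}"
  have inS: "\<exists>V P. rp I V V \<in> S \<and> pos I P \<and> pos I V \<and> rp I V P = 0 \<and> (\<forall>i\<in>I. \<forall>j\<in>I. z i j = P i j - V i j)" if z: "z \<in> Z" for z
  proof -
    obtain P V where "pos I P" "pos I V" "rp I V P = 0"
      "\<And>i j. i \<in> I \<Longrightarrow> j \<in> I \<Longrightarrow> z i j = P i j - V i j"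
      using jordan_decomposition[OF fin Zh[OF z]] by blast
    then show ?thesis unfolding S_def using z by blast
  qed
  \<comment> \<open>A negative part shorter than \<delta> has all eigenvalues at most \<delta>, so
    that adding \<delta> times the identity would make \<open>z\<close> positive.\<close>
  have lb: "\<delta>\<^sup>2 \<le> s" if "s \<in> S" for s
  proof (rule ccontr)
    assume "\<not> \<delta>\<^sup>2 \<le> s"
    obtain V P z where s: "s = rp I V V" and z: "z \<in> Z" and P: "pos I P" and V: "pos I V"
      and zPV: "\<forall>i\<in>I. \<forall>j\<in>I. z i j = P i j - V i j" using \<open>s \<in> S\<close> unfolding S_def by blast
    obtain p e where sp: "spec I V p e" by (rule spectralE[OF fin pos_herm[OF V]])
    have "p k \<le> \<delta>" if "k \<in> I" for k
    proof -
      have "(p k)\<^sup>2 \<le> (\<Sum>k\<in>I. (p k)\<^sup>2)" using fin that by (intro member_le_sum) auto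
      then have "(p k)\<^sup>2 \<le> \<delta>\<^sup>2" using \<open>\<not> \<delta>\<^sup>2 \<le> s\<close> s rp_self_spec[OF fin sp] by simp
      then show ?thesis using \<delta>(1) by (meson less_imp_le power2_le_imp_le)
    qed
    then have "pos I (\<lambda>i j. of_real \<delta> * idm i j - V i j)"
      by (intro spec_pos[OF spec_reflect[OF sp]]) simp
    from pos_add[OF this P] have "pos I (\<lambda>i j. z i j + of_real \<delta> * idm i j)"
      by (rule iffD1[OF pos_cong, rotated]) (simp add: zPV)
    then show False using \<delta>(2)[OF z] by simp
  qed
  have Sne: "S \<noteq> {}" using ne inS by blast
  define d where "d = Inf S"
  have bb: "bdd_below S" using lb by (auto simp: bdd_below_def)
  have d: "\<delta>\<^sup>2 \<le> d" unfolding d_def using lb Sne by (intro cInf_greatest) auto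
  then have d0: "d > 0" using \<delta>(1) by (smt (verit) zero_less_power)
  define D' where "D' = max 0 D"
  \<comment> \<open>Small enough that the quadratic term \<open>t * t * D'\<close> of the
    perturbation stays below \<open>t * d\<close>, the same amount by which \<open>V\<close> is
    allowed to miss the infimum.\<close>
  define t where "t = d / (d + D' + 1)"
  have t: "0 < t" "t \<le> 1" using d0 by (auto simp: t_def D'_def field_simps)
  have tD: "t * D' < d"
  proof -
    have "d * D' < d * (d + D' + 1)" using d0 by (intro mult_strict_left_mono) (auto simp: D'_def)
    then show ?thesis using d0 by (simp add: t_def D'_def divide_less_eq)
  qed
  have "Inf S < d + t * d" using t d0 by (simp add: d_def)
  then obtain s where "s \<in> S" "s < d + t * d" using cInf_lessD[OF Sne] by blast
  then obtain V P z where z: "z \<in> Z" and P: "pos I P" and V: "pos I V" and VP: "rp I V P = 0"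
      and zPV: "\<forall>i\<in>I. \<forall>j\<in>I. z i j = P i j - V i j" and VV: "rp I V V < d + t * d"
    unfolding S_def by blast
  have VVd: "d \<le> rp I V V"
    unfolding d_def using z P V VP zPV by (intro cInf_lower[OF _ bb]) (auto simp: S_def)
  have "rp I V z' < 0" if z': "z' \<in> Z" for z'
  proof -
    define h where "h i j = z' i j - z i j" for i j
    define N where "N i j = of_real t * h i j - V i j" for i j
    have hh: "herm I h" unfolding h_def by (rule herm_diff[OF Zh[OF z'] Zh[OF z]])
    have hN: "herm I N" unfolding N_def by (intro herm_diff herm_scale hh pos_herm V)
    define zt where "zt i j = z i j + of_real t * (z' i j - z i j)" for i j
    have "zt \<in> Z" unfolding zt_def[abs_def] using conv[OF z z'] t by simp
    then obtain V' P' where V'S: "rp I V' V' \<in> S" and P': "pos I P'" and V': "pos I V'"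
      and V'P': "rp I V' P' = 0" and ztPV: "\<forall>i\<in>I. \<forall>j\<in>I. zt i j = P' i j - V' i j" using inS by blast
    \<comment> \<open>The perturbed element is \<open>P + N\<close>. Pairing its negative part
      \<open>V'\<close> with it gives \<open>rp I V' N \<le> - rp I V' V'\<close>, and then
      nonnegativity of the squared length of \<open>V' + N\<close> shows that \<open>V'\<close> is
      at most as long as \<open>N\<close>.\<close>
    have "rp I V' P + rp I V' N = rp I V' zt"
      unfolding rp_add_right[symmetric] by (rule rp_cong) (simp_all add: zt_def N_def h_def zPV)
    also have "\<dots> = rp I V' P' - rp I V' V'"
      unfolding rp_diff_right[symmetric] by (rule rp_cong) (simp_all add: ztPV)
    finally have "rp I V' N \<le> - rp I V' V'"
      using rp_nonneg[OF fin V' P] V'P' by simp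
    moreover have "0 \<le> rp I (\<lambda>i j. V' i j + N i j) (\<lambda>i j. V' i j + N i j)"
      by (intro rp_self_nonneg herm_add pos_herm V' hN)
    then have "0 \<le> rp I V' V' + 2 * rp I V' N + rp I N N"
      unfolding rp_add_right rp_add_left using rp_commute[of I N V'] by simp
    ultimately have "rp I V' V' \<le> rp I N N" by simp
    moreover have "d \<le> rp I V' V'" unfolding d_def by (rule cInf_lower[OF V'S bb])
    moreover have "rp I N N = t * (t * rp I h h) - 2 * t * rp I V h + rp I V V"
      unfolding N_def rp_diff_right rp_diff_left rp_scale_right rp_scale_left using rp_commute[of I h V]
      by (simp add: algebra_simps)
    moreover have "t * (t * rp I h h) \<le> t * (t * D')"
    proof (intro mult_left_mono)
      show "rp I h h \<le> D'" using bdd[OF z z'] by (simp add: h_def[abs_def] D'_def)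
    qed (use t in auto)
    moreover have "t * (t * D') < t * d" using tD t by (intro mult_strict_left_mono) auto
    \<comment> \<open>The chain \<open>d \<le> |V'|^2 \<le> |N|^2 < d + t d - 2 t \<langle>V,
      h\<rangle> + t d\<close> bounds the pairing with the direction \<open>h\<close> by
      \<open>d\<close>. The pairing with \<open>z\<close> itself is
      \<open>- |V|^2 \<le> - d\<close>, so the pairing with \<open>z'\<close> is negative.\<close>
    ultimately have "t * (2 * rp I V h) < t * (2 * d)" using VV by (simp add: algebra_simps)
    then have "rp I V h < d" using t by simp
    moreover have "rp I V z' = rp I V h + rp I V z"
      unfolding rp_add_right[symmetric] by (rule rp_cong) (simp_all add: h_def)
    moreover have "rp I V z = rp I V P - rp I V V"
      unfolding rp_diff_right[symmetric] by (rule rp_cong) (simp_all add: zPV)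
    ultimately show ?thesis using VP VVd by simp
  qed
  with V that show ?thesis by blast
qed

section \<open>Strong duality\<close>

definition primal_feasible :: "'a set \<Rightarrow> 'b set \<Rightarrow> ('a \<times> 'b \<Rightarrow> 'a \<times> 'b \<Rightarrow> complex) \<Rightarrow> ('a \<Rightarrow> 'a \<Rightarrow> complex) \<Rightarrow> bool" where
  "primal_feasible A B R \<rho> \<longleftrightarrow> pos (A \<times> B) R \<and> pos A \<rho> \<and> (\<Sum>a\<in>A. \<rho> a a) = 1 \<and>
     pos (A \<times> B) (\<lambda>x y. \<rho> (fst x) (fst y) * idm (snd x) (snd y) - ptB R x y) \<and>
     pos (A \<times> B) (\<lambda>x y. \<rho> (fst x) (fst y) * idm (snd x) (snd y) + ptB R x y)"

text \<open>Two operators and a scalar on the diagonal of one matrix: the two operator constraints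
  and the bound on the value become membership in a single positive cone, to which the theorem of
  the alternative applies.\<close>

definition blk :: "('x \<Rightarrow> 'x \<Rightarrow> complex) \<Rightarrow> ('x \<Rightarrow> 'x \<Rightarrow> complex) \<Rightarrow> complex \<Rightarrow> 'x + 'x + unit \<Rightarrow> 'x + 'x + unit \<Rightarrow> complex" where
  "blk M N s u v = (case u of Inl x \<Rightarrow> (case v of Inl y \<Rightarrow> M x y | _ \<Rightarrow> 0)
     | Inr (Inl x) \<Rightarrow> (case v of Inr (Inl y) \<Rightarrow> N x y | _ \<Rightarrow> 0)
     | Inr (Inr _) \<Rightarrow> (case v of Inr (Inr _) \<Rightarrow> s | _ \<Rightarrow> 0))"

lemma blk_simps [simp]:
  "blk M N s (Inl x) (Inl y) = M x y" "blk M N s (Inl x) (Inr w) = 0"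
  "blk M N s (Inr (Inl x)) (Inl y) = 0" "blk M N s (Inr (Inl x)) (Inr (Inl y)) = N x y"
  "blk M N s (Inr (Inl x)) (Inr (Inr w')) = 0"
  "blk M N s (Inr (Inr u)) (Inl y) = 0" "blk M N s (Inr (Inr u)) (Inr (Inl y)) = 0"
  "blk M N s (Inr (Inr u)) (Inr (Inr w')) = s"
  by (simp_all add: blk_def)

lemma blk_Inr_Inl [simp]: "blk M N s (Inr w) (Inl y) = 0"
  by (cases w) simp_all

definition blkset :: "'x set \<Rightarrow> ('x + 'x + unit) set" where
  "blkset X = X <+> X <+> {()}"

lemma finite_blkset: "finite X \<Longrightarrow> finite (blkset X)"
  by (simp add: blkset_def)

lemma sum_blkset:
  fixes f :: "_ \<Rightarrow> complex"
  assumes "finite X"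
  shows "(\<Sum>u\<in>blkset X. f u) = (\<Sum>x\<in>X. f (Inl x)) + (\<Sum>x\<in>X. f (Inr (Inl x))) + f (Inr (Inr ()))"
  unfolding blkset_def using assms by (simp add: sum.Plus add.assoc)

lemma rp_blk:
  assumes "finite X"
  shows "rp (blkset X) V (blk M N s) = rp X (\<lambda>x y. V (Inl x) (Inl y)) M
     + rp X (\<lambda>x y. V (Inr (Inl x)) (Inr (Inl y))) N + Re (V (Inr (Inr ())) (Inr (Inr ())) * s)"
  unfolding rp_def sum_blkset[OF assms] by simp

lemma herm_blk: "herm X M \<Longrightarrow> herm X N \<Longrightarrow> cnj s = s \<Longrightarrow> herm (blkset X) (blk M N s)"
  by (auto simp: herm_def blkset_def)

text \<open>Eigenvectors have entries of modulus at most 1, so the eigenvalues, which add up to the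
  trace, dominate every entry. This is how trace constraints make the set of slack matrices
  bounded.\<close>

lemma pos_entry_le:
  assumes fin: "finite I" and M: "pos I M" and i: "i \<in> I" and j: "j \<in> I"
  shows "cmod (M i j) \<le> Re (\<Sum>i\<in>I. M i i)"
proof -
  obtain p e where sp: "spec I M p e" by (rule spectralE[OF fin pos_herm[OF M]])
  have e1: "cmod (e k i) \<le> 1" if "k \<in> I" "i \<in> I" for k i
  proof -
    have "(cmod (e k i))\<^sup>2 \<le> (\<Sum>i\<in>I. (cmod (e k i))\<^sup>2)" using fin that by (intro member_le_sum) auto
    then have "(cmod (e k i))\<^sup>2 \<le> 1\<^sup>2" using onb_norm[OF spec_onb[OF sp] that(1)] by simp
    then show ?thesis by (rule power2_le_imp_le) simp
  qed
  have "cmod (M i j) \<le> (\<Sum>k\<in>I. p k * (cmod (e k i) * cmod (e k j)))"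
    unfolding specD[OF sp i j] using spec_nonneg[OF fin M sp]
    by (intro sum_norm_le) (simp add: norm_mult mult.assoc)
  also have "\<dots> \<le> (\<Sum>k\<in>I. p k * 1)"
    using spec_nonneg[OF fin M sp] e1 i j
    by (intro sum_mono mult_left_mono mult_le_one) auto
  also have "\<dots> = Re (\<Sum>i\<in>I. M i i)" unfolding trace_spec[OF sp] by simp
  finally show ?thesis .
qed

lemma herm_ptB: "herm (A \<times> B) R \<Longrightarrow> herm (A \<times> B) (ptB R)"
  by (auto simp: herm_def ptB_def)

lemma rp_ptB: "rp (A \<times> B) (ptB M) N = rp (A \<times> B) M (ptB N)"
proof -
  have "(\<Sum>i\<in>A \<times> B. \<Sum>j\<in>A \<times> B. ptB M i j * N j i) =
    (\<Sum>a\<in>A. \<Sum>b\<in>B. \<Sum>a'\<in>A. \<Sum>b'\<in>B. M (a, b') (a', b) * N (a', b') (a, b))"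
    unfolding sum_pair ptB_def by simp
  also have "\<dots> = (\<Sum>a\<in>A. \<Sum>a'\<in>A. \<Sum>b\<in>B. \<Sum>b'\<in>B. M (a, b') (a', b) * N (a', b') (a, b))"
    by (rule sum.cong[OF refl], rule sum.swap)
  also have "\<dots> = (\<Sum>a\<in>A. \<Sum>a'\<in>A. \<Sum>b'\<in>B. \<Sum>b\<in>B. M (a, b') (a', b) * N (a', b') (a, b))"
    by (rule sum.cong[OF refl], rule sum.cong[OF refl], rule sum.swap)
  also have "\<dots> = (\<Sum>a\<in>A. \<Sum>b'\<in>B. \<Sum>a'\<in>A. \<Sum>b\<in>B. M (a, b') (a', b) * N (a', b') (a, b))"
    by (rule sum.cong[OF refl], rule sum.swap)
  also have "\<dots> = (\<Sum>i\<in>A \<times> B. \<Sum>j\<in>A \<times> B. M i j * ptB N j i)"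
    unfolding sum_pair ptB_def by simp
  finally show ?thesis unfolding rp_def by simp
qed

lemma rp_tensor_idm:
  assumes "finite B"
  shows "rp (A \<times> B) V (\<lambda>x y. \<rho> (fst x) (fst y) * idm (snd x) (snd y)) = rp A (\<lambda>a a'. \<Sum>b\<in>B. V (a, b) (a', b)) \<rho>"
proof -
  have "(\<Sum>i\<in>A \<times> B. \<Sum>j\<in>A \<times> B. V i j * (\<rho> (fst j) (fst i) * idm (snd j) (snd i))) =
    (\<Sum>a\<in>A. \<Sum>b\<in>B. \<Sum>a'\<in>A. \<Sum>b'\<in>B. (V (a, b) (a', b') * \<rho> a' a) * idm b' b)"
    unfolding sum_pair by (simp add: mult_ac)
  also have "\<dots> = (\<Sum>a\<in>A. \<Sum>b\<in>B. \<Sum>a'\<in>A. V (a, b) (a', b) * \<rho> a' a)"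
    using assms by (intro sum.cong refl) simp
  also have "\<dots> = (\<Sum>a\<in>A. \<Sum>a'\<in>A. \<Sum>b\<in>B. V (a, b) (a', b) * \<rho> a' a)"
    by (rule sum.cong[OF refl], rule sum.swap)
  finally show ?thesis unfolding rp_def by (simp add: sum_distrib_right)
qed

lemma pos_zero: "pos I (\<lambda>_ _. 0)"
  by (simp add: pos_def herm_def qf_def)

lemma pos_tensor_idm:
  assumes "finite A" "finite B" "pos A \<rho>"
  shows "pos (A \<times> B) (\<lambda>x y. \<rho> (fst x) (fst y) * idm (snd x) (snd y))"
  by (rule pos_tensor[OF assms pos_idm[OF assms(2)]])

lemma idm_Inl: "idm (Inl x) (Inl y) = idm x y" and idm_Inr: "idm (Inr v) (Inr w) = idm v w"
  by (simp_all add: idm_def)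

context
  fixes A :: "'a set" and B :: "'b set" and J :: "'a \<times> 'b \<Rightarrow> 'a \<times> 'b \<Rightarrow> complex" and \<mu> :: real
begin

text \<open>This matrix is positive exactly when the two operator inequalities hold and the value
  reaches \<mu>. For \<mu> above the optimum no admissible pair achieves that, and duality turns the
  failure into multipliers.\<close>

definition slack :: "('a \<times> 'b \<Rightarrow> 'a \<times> 'b \<Rightarrow> complex) \<Rightarrow> ('a \<Rightarrow> 'a \<Rightarrow> complex) \<Rightarrow>
    ('a \<times> 'b) + ('a \<times> 'b) + unit \<Rightarrow> ('a \<times> 'b) + ('a \<times> 'b) + unit \<Rightarrow> complex" where
  "slack R \<rho> = blk (\<lambda>x y. \<rho> (fst x) (fst y) * idm (snd x) (snd y) - ptB R x y)
     (\<lambda>x y. \<rho> (fst x) (fst y) * idm (snd x) (snd y) + ptB R x y) (of_real (rp (A \<times> B) J R - \<mu>))"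

text \<open>The bound on the trace of \<open>R\<close> is implied by feasibility; it makes the set bounded and
  is what allows an exact dual solution to be recovered from an inexact one.\<close>

definition slacks :: "(('a \<times> 'b) + ('a \<times> 'b) + unit \<Rightarrow> ('a \<times> 'b) + ('a \<times> 'b) + unit \<Rightarrow> complex) set" where
  "slacks = {slack R \<rho> | R \<rho>. pos (A \<times> B) R \<and> Re (\<Sum>x\<in>A \<times> B. R x x) \<le> card B \<and> pos A \<rho> \<and> (\<Sum>a\<in>A. \<rho> a a) = 1}"

lemma slack_convex:
  "(\<lambda>i j. slack R \<rho> i j + of_real t * (slack R' \<rho>' i j - slack R \<rho> i j)) =
    slack (\<lambda>x y. of_real (1 - t) * R x y + of_real t * R' x y) (\<lambda>x y. of_real (1 - t) * \<rho> x y + of_real t * \<rho>' x y)"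
proof -
  have r: "rp (A \<times> B) J (\<lambda>x y. of_real (1 - t) * R x y + of_real t * R' x y) = (1 - t) * rp (A \<times> B) J R + t * rp (A \<times> B) J R'"
    by (simp only: rp_add_right rp_scale_right)
  show ?thesis
    unfolding slack_def r by (simp add: fun_eq_iff split_sum_all ptB_def algebra_simps)
qed

lemma slacksI:
  "pos (A \<times> B) R \<Longrightarrow> Re (\<Sum>x\<in>A \<times> B. R x x) \<le> card B \<Longrightarrow> pos A \<rho> \<Longrightarrow> (\<Sum>a\<in>A. \<rho> a a) = 1 \<Longrightarrow> slack R \<rho> \<in> slacks"
  unfolding slacks_def by blast

lemma slacks_convex:
  assumes "z \<in> slacks" "z' \<in> slacks" "0 \<le> t" "t \<le> 1"
  shows "(\<lambda>i j. z i j + of_real t * (z' i j - z i j)) \<in> slacks"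
proof -
  obtain R \<rho> where z: "z = slack R \<rho>" "pos (A \<times> B) R" "Re (\<Sum>x\<in>A \<times> B. R x x) \<le> card B" "pos A \<rho>" "(\<Sum>a\<in>A. \<rho> a a) = 1"
    using assms(1) unfolding slacks_def by blast
  obtain R' \<rho>' where z': "z' = slack R' \<rho>'" "pos (A \<times> B) R'" "Re (\<Sum>x\<in>A \<times> B. R' x x) \<le> card B" "pos A \<rho>'" "(\<Sum>a\<in>A. \<rho>' a a) = 1"
    using assms(2) unfolding slacks_def by blast
  let ?R = "\<lambda>x y. of_real (1 - t) * R x y + of_real t * R' x y"
  let ?\<rho> = "\<lambda>x y. of_real (1 - t) * \<rho> x y + of_real t * \<rho>' x y"
  have "pos (A \<times> B) ?R" using assms z z' by (intro pos_add pos_scale) auto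
  moreover have "pos A ?\<rho>" using assms z z' by (intro pos_add pos_scale) auto
  moreover have "Re (\<Sum>x\<in>A \<times> B. ?R x x) = (1 - t) * Re (\<Sum>x\<in>A \<times> B. R x x) + t * Re (\<Sum>x\<in>A \<times> B. R' x x)"
    by (simp add: sum.distrib sum_distrib_left)
  moreover have "\<dots> \<le> card B"
    using z z' assms by (intro convex_bound_le) auto
  moreover have "(\<Sum>a\<in>A. ?\<rho> a a) = 1"
    using z z' by (simp add: sum.distrib flip: sum_distrib_left)
  ultimately have "slack ?R ?\<rho> \<in> slacks" by (intro slacksI) linarith+
  then show ?thesis unfolding z(1) z'(1) slack_convex .
qed

lemma slacks_herm:
  assumes "finite A" "finite B" "z \<in> slacks"
  shows "herm (blkset (A \<times> B)) z"
proof -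
  obtain R \<rho> where z: "z = slack R \<rho>" "pos (A \<times> B) R" "pos A \<rho>"
    using assms(3) unfolding slacks_def by blast
  show ?thesis unfolding z(1) slack_def
    by (intro herm_blk herm_diff herm_add herm_ptB pos_herm z pos_tensor_idm assms) simp
qed

lemma slacks_entry_bound:
  assumes fin: "finite A" "finite B" and z: "z \<in> slacks" and uv: "u \<in> blkset (A \<times> B)" "v \<in> blkset (A \<times> B)"
  shows "cmod (z u v) \<le> 1 + card B + (\<Sum>i\<in>A \<times> B. \<Sum>j\<in>A \<times> B. cmod (J i j)) * card B + \<bar>\<mu>\<bar>"
proof -
  define s where "s = (\<Sum>i\<in>A \<times> B. \<Sum>j\<in>A \<times> B. cmod (J i j)) * card B"
  have s0: "0 \<le> s" unfolding s_def by (intro mult_nonneg_nonneg sum_nonneg) auto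
  obtain R \<rho> where z: "z = slack R \<rho>" and R: "pos (A \<times> B) R" "Re (\<Sum>x\<in>A \<times> B. R x x) \<le> card B"
     and \<rho>: "pos A \<rho>" "(\<Sum>a\<in>A. \<rho> a a) = 1"
    using z unfolding slacks_def by blast
  have Rb: "cmod (R x y) \<le> card B" if "x \<in> A \<times> B" "y \<in> A \<times> B" for x y
    using pos_entry_le[OF _ R(1) that] R(2) fin by simp
  have \<rho>b: "cmod (\<rho> a a' * idm b b') \<le> 1" if "a \<in> A" "a' \<in> A" for a a' and b b' :: 'b
    using pos_entry_le[OF fin(1) \<rho>(1) that] \<rho>(2) by (auto simp: idm_def)
  have pb: "cmod (ptB R x y) \<le> card B" if "x \<in> A \<times> B" "y \<in> A \<times> B" for x y
    unfolding ptB_def by (rule Rb) (use that in auto)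
  have bm: "cmod (\<rho> (fst x) (fst y) * idm (snd x) (snd y) - ptB R x y) \<le> 1 + card B"
    and bp: "cmod (\<rho> (fst x) (fst y) * idm (snd x) (snd y) + ptB R x y) \<le> 1 + card B"
    if "x \<in> A \<times> B" "y \<in> A \<times> B" for x y
  proof -
    have "fst x \<in> A" "fst y \<in> A" using that by auto
    then show "cmod (\<rho> (fst x) (fst y) * idm (snd x) (snd y) - ptB R x y) \<le> 1 + card B"
      "cmod (\<rho> (fst x) (fst y) * idm (snd x) (snd y) + ptB R x y) \<le> 1 + card B"
      using order_trans[OF norm_triangle_ineq4 add_mono[OF \<rho>b pb]] order_trans[OF norm_triangle_ineq add_mono[OF \<rho>b pb]] that
      by simp_all
  qed
  have rb: "\<bar>rp (A \<times> B) J R\<bar> \<le> s"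
  proof -
    have "\<bar>rp (A \<times> B) J R\<bar> \<le> cmod (\<Sum>i\<in>A \<times> B. \<Sum>j\<in>A \<times> B. J i j * R j i)"
      unfolding rp_def by (rule abs_Re_le_cmod)
    also have "\<dots> \<le> (\<Sum>i\<in>A \<times> B. \<Sum>j\<in>A \<times> B. cmod (J i j) * card B)"
    proof (intro sum_norm_le)
      fix i j assume "i \<in> A \<times> B" "j \<in> A \<times> B"
      then show "cmod (J i j * R j i) \<le> cmod (J i j) * card B"
        unfolding norm_mult by (intro mult_left_mono Rb) auto
    qed
    also have "\<dots> = s" unfolding s_def by (simp add: sum_distrib_right)
    finally show ?thesis .
  qed
  have "cmod (z u v) \<le> 1 + card B + s + \<bar>\<mu>\<bar>"
    unfolding z slack_def
  proof (cases u; cases v)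
    fix x y assume "u = Inl x" "v = Inl y"
    moreover from this have "x \<in> A \<times> B" "y \<in> A \<times> B" using uv by (auto simp: blkset_def)
    ultimately show "cmod (blk (\<lambda>x y. \<rho> (fst x) (fst y) * idm (snd x) (snd y) - ptB R x y) (\<lambda>x y. \<rho> (fst x) (fst y) * idm (snd x) (snd y) + ptB R x y) (of_real (rp (A \<times> B) J R - \<mu>)) u v) \<le> 1 + card B + s + \<bar>\<mu>\<bar>"
      using bm[of x y] s0 by simp
  next
    fix x y assume uv': "u = Inr x" "v = Inr y"
    show "cmod (blk (\<lambda>x y. \<rho> (fst x) (fst y) * idm (snd x) (snd y) - ptB R x y) (\<lambda>x y. \<rho> (fst x) (fst y) * idm (snd x) (snd y) + ptB R x y) (of_real (rp (A \<times> B) J R - \<mu>)) u v) \<le> 1 + card B + s + \<bar>\<mu>\<bar>"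
    proof (cases x; cases y)
      fix x' y' assume "x = Inl x'" "y = Inl y'"
      moreover from this have "x' \<in> A \<times> B" "y' \<in> A \<times> B" using uv uv' by (auto simp: blkset_def)
      ultimately show ?thesis using uv' bp[of x' y'] s0 by simp
    next
      fix x' y' assume "x = Inr x'" "y = Inr y'"
      then show ?thesis using uv' rb by (simp del: of_real_diff) 
    qed (use uv' s0 in auto)
  qed (use s0 in auto)
  then show ?thesis by (simp add: s_def)
qed

text \<open>An almost feasible pair can be repaired: adding \<delta> times the identity to \<rho>
  restores the inequalities, and dividing by \<open>1 + \<delta> * card A\<close> restores the
  trace. The repaired pair would have a value of at least \<open>(\<mu> - \<delta>) / c\<close>, and
  the choice of \<delta> puts this above \<open>G\<close>.\<close>

lemma slacks_not_pos:
  assumes fin: "finite A" "finite B"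
    and ub: "\<And>R \<rho>. primal_feasible A B R \<rho> \<Longrightarrow> rp (A \<times> B) J R \<le> G"
    and \<delta>: "0 < \<delta>" "\<delta> * (1 + G * card A) < \<mu> - G" and z: "z \<in> slacks"
  shows "\<not> pos (blkset (A \<times> B)) (\<lambda>i j. z i j + of_real \<delta> * idm i j)"
proof
  assume p: "pos (blkset (A \<times> B)) (\<lambda>i j. z i j + of_real \<delta> * idm i j)"
  obtain R \<rho> where z: "z = slack R \<rho>" and R: "pos (A \<times> B) R" and \<rho>: "pos A \<rho>" "(\<Sum>a\<in>A. \<rho> a a) = 1"
    using z unfolding slacks_def by blast
  have finX: "finite (blkset (A \<times> B))" using fin by (intro finite_blkset) auto
  define c where "c = 1 + \<delta> * card A"
  have c: "c > 0" using \<delta> by (simp add: c_def add_pos_nonneg)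
  define R' where "R' x y = of_real (1 / c) * R x y" for x y
  define \<rho>' where "\<rho>' x y = of_real (1 / c) * (\<rho> x y + of_real \<delta> * idm x y)" for x y
  have idm2: "idm (fst x) (fst y) * idm (snd x) (snd y) = idm x y" for x y :: "'a \<times> 'b"
    by (simp add: idm_def prod_eq_iff)
  define m where "m i j = z i j + of_real \<delta> * idm i j" for i j
  have pm: "pos (blkset (A \<times> B)) m" using p by (simp add: m_def[abs_def])
  have "pos (A \<times> B) (\<lambda>x y. m (Inl x) (Inl y))"
    by (rule pos_reindex[OF finX _ pm]) (auto simp: blkset_def)
  then have "pos (A \<times> B) (\<lambda>x y. of_real (1 / c) * m (Inl x) (Inl y))"
    using c by (intro pos_scale) auto
  then have p1: "pos (A \<times> B) (\<lambda>x y. \<rho>' (fst x) (fst y) * idm (snd x) (snd y) - ptB R' x y)"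
    by (rule iffD1[OF pos_cong, rotated])
       (simp add: m_def z slack_def \<rho>'_def R'_def ptB_def idm_Inl idm2[symmetric] algebra_simps diff_divide_distrib add_divide_distrib)
  have "pos (A \<times> B) (\<lambda>x y. m (Inr (Inl x)) (Inr (Inl y)))"
    by (rule pos_reindex[OF finX _ pm, of "\<lambda>x. Inr (Inl x)"]) (auto simp: blkset_def)
  then have "pos (A \<times> B) (\<lambda>x y. of_real (1 / c) * m (Inr (Inl x)) (Inr (Inl y)))"
    using c by (intro pos_scale) auto
  then have p2: "pos (A \<times> B) (\<lambda>x y. \<rho>' (fst x) (fst y) * idm (snd x) (snd y) + ptB R' x y)"
    by (rule iffD1[OF pos_cong, rotated])
       (simp add: m_def z slack_def \<rho>'_def R'_def ptB_def idm_Inl idm_Inr idm2[symmetric] algebra_simps diff_divide_distrib add_divide_distrib)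
  have "pos {()} (\<lambda>x y. m (Inr (Inr x)) (Inr (Inr y)))"
    by (rule pos_reindex[OF finX _ pm, of "\<lambda>x. Inr (Inr x)"]) (auto simp: blkset_def)
  from pos_qf[OF this, of "\<lambda>_. 1"] have p3: "\<mu> - \<delta> \<le> rp (A \<times> B) J R"
    by (simp add: m_def qf_def z slack_def idm_def)
  have "(\<Sum>a\<in>A. \<rho>' a a) = of_real (1 / c) * ((\<Sum>a\<in>A. \<rho> a a) + of_real \<delta> * (\<Sum>a\<in>A. idm a a))"
    unfolding \<rho>'_def by (simp only: sum_distrib_left[symmetric] sum.distrib)
  also have "\<dots> = of_real (1 / c) * of_real c"
    using \<rho>(2) by (simp add: c_def idm_def)
  also have "\<dots> = 1" using c by (simp flip: of_real_mult)
  finally have tr: "(\<Sum>a\<in>A. \<rho>' a a) = 1" .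
  have "pos (A \<times> B) R'" unfolding R'_def[abs_def] using c R by (intro pos_scale) auto
  moreover have "pos A \<rho>'" unfolding \<rho>'_def[abs_def] using c \<rho> \<delta> fin by (intro pos_scale pos_add pos_idm) auto
  ultimately have "primal_feasible A B R' \<rho>'"
    unfolding primal_feasible_def using tr p1 p2 by blast
  then have "rp (A \<times> B) J R' \<le> G" by (rule ub)
  then have "rp (A \<times> B) J R \<le> G * c"
    unfolding R'_def[abs_def] rp_scale_right using c by (simp add: field_simps)
  with p3 \<delta>(2) show False by (simp add: c_def algebra_simps)
qed

lemma slacks_bounded:
  assumes fin: "finite A" "finite B"
  obtains D where "\<And>z z'. z \<in> slacks \<Longrightarrow> z' \<in> slacks \<Longrightarrow>
    rp (blkset (A \<times> B)) (\<lambda>i j. z' i j - z i j) (\<lambda>i j. z' i j - z i j) \<le> D"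
proof -
  define C where "C = 1 + card B + (\<Sum>i\<in>A \<times> B. \<Sum>j\<in>A \<times> B. cmod (J i j)) * card B + \<bar>\<mu>\<bar>"
  have "rp (blkset (A \<times> B)) (\<lambda>i j. z' i j - z i j) (\<lambda>i j. z' i j - z i j) \<le>
    (\<Sum>i\<in>blkset (A \<times> B). \<Sum>j\<in>blkset (A \<times> B). (C + C)\<^sup>2)" if z: "z \<in> slacks" "z' \<in> slacks" for z z'
  proof -
    have "rp (blkset (A \<times> B)) (\<lambda>i j. z' i j - z i j) (\<lambda>i j. z' i j - z i j) =
      (\<Sum>i\<in>blkset (A \<times> B). \<Sum>j\<in>blkset (A \<times> B). (cmod (z' i j - z i j))\<^sup>2)"
      by (intro rp_self herm_diff slacks_herm fin z)
    also have "\<dots> \<le> (\<Sum>i\<in>blkset (A \<times> B). \<Sum>j\<in>blkset (A \<times> B). (C + C)\<^sup>2)"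
      unfolding C_def
      by (intro sum_mono power_mono order_trans[OF norm_triangle_ineq4 add_mono] slacks_entry_bound fin z) auto
    finally show ?thesis .
  qed
  then show thesis by (rule that)
qed

lemma qf_lt_imp_pos:
  assumes fin: "finite A" and H: "herm A H"
    and lt: "\<And>v. (\<Sum>a\<in>A. (cmod (v a))\<^sup>2) = 1 \<Longrightarrow> Re (qf A H v) < m"
  shows "pos A (\<lambda>a a'. of_real m * idm a a' - H a a')"
  unfolding pos_def
proof (intro conjI allI)
  show "herm A (\<lambda>a a'. of_real m * idm a a' - H a a')"
    by (intro herm_diff herm_scale herm_idm H)
  fix v
  define n where "n = (\<Sum>a\<in>A. (cmod (v a))\<^sup>2)"
  have n0: "0 \<le> n" unfolding n_def by (simp add: sum_nonneg)
  have "Re (qf A H v) \<le> m * n"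
  proof (cases "n = 0")
    case True
    then have "v a = 0" if "a \<in> A" for a
      using fin that by (simp add: n_def sum_nonneg_eq_0_iff)
    then have "qf A H v = 0" by (simp add: qf_def)
    with True show ?thesis by simp
  next
    case False
    with n0 have n: "n > 0" by simp
    define w where "w a = of_real (1 / sqrt n) * v a" for a
    have "(\<Sum>a\<in>A. (cmod (w a))\<^sup>2) = 1"
      using n by (simp add: w_def norm_mult norm_divide power_mult_distrib power_divide n_def[symmetric] flip: sum_divide_distrib)
    from lt[OF this] have "Re (qf A H w) < m" .
    moreover have "qf A H w = of_real (1 / n) * qf A H v"
    proof -
      have "complex_of_real (1 / sqrt n) * of_real (1 / sqrt n) = of_real (1 / n)"
        using n by (simp flip: of_real_mult)
      then have "cnj (w a) * H a a' * w a' = of_real (1 / n) * (cnj (v a) * H a a' * v a')" for a a'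
        unfolding w_def by (metis (no_types, lifting) complex_cnj_complex_of_real complex_cnj_mult mult.assoc mult.left_commute)
      then show ?thesis unfolding qf_def by (simp only: sum_distrib_left)
    qed
    ultimately show ?thesis using n by (simp add: field_simps)
  qed
  then show "0 \<le> Re (qf A (\<lambda>a a'. of_real m * idm a a' - H a a') v)"
    using fin by (simp add: qf_diff qf_scale qf_idm n_def del: of_real_sum)
qed

text \<open>The separating matrix supplies the multipliers through its two diagonal blocks and its
  corner entry \<open>l\<close>. As it separates only from pairs with bounded \<open>Tr R\<close>,
  the dual inequality may fail by some \<open>g\<close>; shifting \<open>V\<close> by
  \<open>g\<close> times the identity repairs it, at a cost that the same separation inequality
  already covers.\<close>

theorem strong_duality:
  assumes fin: "finite A" "finite B" and A: "A \<noteq> {}" and hJ: "herm (A \<times> B) J"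
    and ub: "\<And>R \<rho>. primal_feasible A B R \<rho> \<Longrightarrow> rp (A \<times> B) J R \<le> G" and G: "0 \<le> G" "G < \<mu>"
  shows "dual_feasible A B \<mu> J"
proof -
  let ?X = "A \<times> B"
  have finX: "finite ?X" using fin by simp
  \<comment> \<open>Half of the available gap, so that the inequality required of \<delta> is
    strict.\<close>
  define \<delta> where "\<delta> = (\<mu> - G) / 2 / (1 + G * card A)"
  have den: "1 + G * card A > 0" using G by (simp add: add_pos_nonneg)
  have den0: "1 + G * card A \<noteq> 0" using den by linarith
  have "\<delta> * (1 + G * card A) = (\<mu> - G) / 2" unfolding \<delta>_def by (rule nonzero_eq_divide_eq[THEN iffD1, OF den0 refl])
  also have "(\<mu> - G) / 2 < \<mu> - G" using G by simp
  finally have "\<delta> * (1 + G * card A) < \<mu> - G" .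
  moreover have "0 < \<delta>" unfolding \<delta>_def using G den by simp
  ultimately have \<delta>: "0 < \<delta>" "\<delta> * (1 + G * card A) < \<mu> - G" by blast+
  obtain D where D: "\<And>z z'. z \<in> slacks \<Longrightarrow> z' \<in> slacks \<Longrightarrow>
    rp (blkset ?X) (\<lambda>i j. z' i j - z i j) (\<lambda>i j. z' i j - z i j) \<le> D"
    using slacks_bounded[OF fin] by blast
  obtain a0 where a0: "a0 \<in> A" using A by blast
  have rank1: "pos A (\<lambda>a a'. v a * cnj (v a'))" "(\<Sum>a\<in>A. v a * cnj (v a)) = 1"
    if "(\<Sum>a\<in>A. (cmod (v a))\<^sup>2) = 1" for v :: "'a \<Rightarrow> complex"
  proof -
    have "(\<Sum>a\<in>A. v a * cnj (v a)) = of_real (\<Sum>a\<in>A. (cmod (v a))\<^sup>2)"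
      by (simp only: of_real_sum complex_norm_square)
    then show "(\<Sum>a\<in>A. v a * cnj (v a)) = 1" using that by simp
  qed (rule pos_rank1)
  have norm_idm: "(\<Sum>a\<in>A. (cmod (idm a0 a))\<^sup>2) = 1"
    using fin a0 by (simp add: idm_def if_distrib if_distribR cong: if_cong)
  have "slack (\<lambda>_ _. 0) (\<lambda>a a'. idm a0 a * cnj (idm a0 a')) \<in> slacks"
    using rank1[OF norm_idm] by (intro slacksI pos_zero) auto
  then have ne: "slacks \<noteq> {}" by blast
  obtain W where W: "pos (blkset ?X) W" and Wneg: "\<And>z. z \<in> slacks \<Longrightarrow> rp (blkset ?X) W z < 0"
  proof (rule alternative[OF finite_blkset[OF finX] ne])
    show "herm (blkset ?X) z" if "z \<in> slacks" for z by (rule slacks_herm[OF fin that])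
    show "(\<lambda>i j. z i j + of_real t * (z' i j - z i j)) \<in> slacks"
      if "z \<in> slacks" "z' \<in> slacks" "0 \<le> t" "t \<le> 1" for z z' t by (rule slacks_convex[OF that])
    show "rp (blkset ?X) (\<lambda>i j. z' i j - z i j) (\<lambda>i j. z' i j - z i j) \<le> D"
      if "z \<in> slacks" "z' \<in> slacks" for z z' by (rule D[OF that])
    show "\<not> pos (blkset ?X) (\<lambda>i j. z i j + of_real \<delta> * idm i j)" if "z \<in> slacks" for z
      by (rule slacks_not_pos[OF fin ub \<delta> that])
  qed (use \<delta>(1) in auto)
  have finb: "finite (blkset ?X)" using finX by (rule finite_blkset)
  define V1 where "V1 x y = W (Inl x) (Inl y)" for x y
  define V2 where "V2 x y = W (Inr (Inl x)) (Inr (Inl y))" for x y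
  define l where "l = Re (W (Inr (Inr ())) (Inr (Inr ())))"
  have V1: "pos ?X V1" unfolding V1_def[abs_def] by (rule pos_reindex[OF finb _ W]) (auto simp: blkset_def)
  have V2: "pos ?X V2" unfolding V2_def[abs_def] by (rule pos_reindex[OF finb _ W]) (auto simp: blkset_def)
  have "pos {()} (\<lambda>x y. W (Inr (Inr x)) (Inr (Inr y)))" by (rule pos_reindex[OF finb _ W]) (auto simp: blkset_def)
  from pos_qf[OF this, of "\<lambda>_. 1"] have l0: "0 \<le> l" by (simp add: qf_def l_def)
  \<comment> \<open>The amount by which the unnormalised dual constraint is violated; a dual
    solution would have \<open>Gm \<le> 0\<close>.\<close>
  define Gm where "Gm x y = ptB V2 x y - ptB V1 x y + of_real l * J x y" for x y
  define H where "H a a' = (\<Sum>b\<in>B. V1 (a, b) (a', b)) + (\<Sum>b\<in>B. V2 (a, b) (a', b))" for a a'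
  have hG: "herm ?X Gm" unfolding Gm_def[abs_def] by (intro herm_add herm_diff herm_ptB herm_scale pos_herm V1 V2 hJ)
  have main: "rp ?X Gm R + rp A H \<rho> < l * \<mu>"
    if "pos ?X R" "Re (\<Sum>x\<in>?X. R x x) \<le> card B" "pos A \<rho>" "(\<Sum>a\<in>A. \<rho> a a) = 1" for R \<rho>
  proof -
    have "rp (blkset ?X) W (slack R \<rho>) < 0" by (rule Wneg[OF slacksI[OF that]])
    also have "rp (blkset ?X) W (slack R \<rho>) = rp A H \<rho> + (rp ?X V2 (ptB R) - rp ?X V1 (ptB R)) + l * (rp ?X J R - \<mu>)"
      unfolding slack_def rp_blk[OF finX] V1_def[symmetric] V2_def[symmetric] l_def H_def
      by (simp add: rp_diff_right rp_add_right rp_tensor_idm[OF fin(2)] rp_add_left)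
    also have "rp ?X V2 (ptB R) - rp ?X V1 (ptB R) = rp ?X Gm R - l * rp ?X J R"
      unfolding Gm_def rp_add_left rp_diff_left rp_scale_left rp_ptB by simp
    finally show ?thesis by (simp add: algebra_simps)
  qed
  have partial: "pos A (\<lambda>a a'. \<Sum>b\<in>B. Q (a, b) (a', b))" if "pos ?X Q" for Q
    using pos_reindex[OF finX _ that, of "\<lambda>a. (a, _)"] by (intro pos_sum) auto
  have H: "pos A H" unfolding H_def[abs_def] by (intro pos_add partial V1 V2)
  obtain p e where sp: "spec ?X Gm p e" by (rule spectralE[OF finX hG])
  \<comment> \<open>The top eigenvalue of \<open>Gm\<close>, or 0 if \<open>Gm\<close> has no
    positive eigenvalue.\<close>
  define g where "g = Max (insert 0 (p ` ?X))"
  have g: "0 \<le> g" "\<And>k. k \<in> ?X \<Longrightarrow> p k \<le> g" unfolding g_def using finX by auto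
  have Hlt: "Re (qf A H v) < l * \<mu> - card B * g" if v: "(\<Sum>a\<in>A. (cmod (v a))\<^sup>2) = 1" for v
  proof -
    have "g \<in> insert 0 (p ` ?X)" unfolding g_def using finX by (intro Max_in) auto
    then consider "g = 0" | k where "k \<in> ?X" "g = p k" by auto
    then obtain R where R: "pos ?X R" "Re (\<Sum>x\<in>?X. R x x) \<le> card B" "rp ?X Gm R = card B * g"
    proof cases
      case 1
      then show ?thesis using that[of "\<lambda>_ _. 0"] by (simp add: pos_zero rp_def)
    next
      case 2
      let ?R = "\<lambda>x y. of_real (card B) * (e k x * cnj (e k y))"
      have "pos ?X ?R" by (intro pos_scale pos_rank1) simp
      moreover have "(\<Sum>x\<in>?X. ?R x x) = of_real (card B)"
      proof -
        have "(\<Sum>x\<in>?X. ?R x x) = of_real (card B) * of_real (\<Sum>x\<in>?X. (cmod (e k x))\<^sup>2)"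
          by (simp only: sum_distrib_left of_real_sum complex_norm_square)
        then show ?thesis using onb_norm[OF spec_onb[OF sp] 2(1)] by simp
      qed
      moreover have "rp ?X Gm ?R = card B * g"
        using qf_eigen[OF finX sp 2(1)] 2(2) by (simp only: rp_scale_right rp_rank1) simp
      ultimately show ?thesis using that[of ?R] by simp
    qed
    from main[OF R(1,2) rank1[OF v]] R(3) show ?thesis by (simp add: rp_rank1)
  qed
  \<comment> \<open>With \<open>l = 0\<close> the inequality \<open>Hlt\<close> would make the form
    of the positive matrix \<open>H\<close> negative at a unit vector.\<close>
  have "0 < l"
  proof (rule ccontr)
    assume "\<not> 0 < l"
    with l0 have "l = 0" by simp
    moreover have "0 \<le> Re (qf A H (idm a0))" by (rule pos_qf[OF H])
    moreover have "0 \<le> card B * g" using g(1) by simp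
    ultimately show False using Hlt[OF norm_idm] by simp
  qed
  \<comment> \<open>The identity is its own partial transpose, so the shift by \<open>g\<close> acts
    directly on the dual constraint. Dividing by \<open>l\<close> gives \<open>J\<close> the
    coefficient 1.\<close>
  define V where "V x y = of_real (1 / l) * (V1 x y + of_real g * idm x y)" for x y
  define Y where "Y x y = of_real (1 / l) * V2 x y" for x y
  have ll: "complex_of_real (1 / l) * of_real l = 1" using \<open>0 < l\<close> by (simp flip: of_real_mult)
  have "pos ?X V" unfolding V_def[abs_def] using \<open>0 < l\<close> g V1 finX by (intro pos_scale pos_add pos_idm) auto
  moreover have "pos ?X Y" unfolding Y_def[abs_def] using \<open>0 < l\<close> V2 by (intro pos_scale) auto
  moreover have "pos ?X (\<lambda>x y. ptB V x y - ptB Y x y - J x y)"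
  proof -
    have "pos ?X (\<lambda>x y. of_real g * idm x y - Gm x y)"
      using g(2) by (intro spec_pos[OF spec_reflect[OF sp]]) simp
    then have "pos ?X (\<lambda>x y. of_real (1 / l) * (of_real g * idm x y - Gm x y))"
      using \<open>0 < l\<close> by (intro pos_scale) auto
    then show ?thesis
    proof (rule iffD1[OF pos_cong, rotated])
      fix x y :: "'a \<times> 'b"
      have "ptB idm x y = idm x y" by (auto simp: ptB_def idm_def prod_eq_iff)
      moreover have "J x y = (of_real (1 / l) * of_real l) * J x y" using ll by simp
      ultimately show "of_real (1 / l) * (of_real g * idm x y - Gm x y) = ptB V x y - ptB Y x y - J x y"
        unfolding Gm_def using \<open>0 < l\<close> by (simp add: ptB_def V_def Y_def algebra_simps)
    qed
  qed
  moreover have "pos A (\<lambda>a a'. of_real \<mu> * idm a a' - (\<Sum>b\<in>B. V (a, b) (a', b) + Y (a, b) (a', b)))"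
  proof -
    have "pos A (\<lambda>a a'. of_real (1 / l) * (of_real (l * \<mu> - card B * g) * idm a a' - H a a'))"
      using \<open>0 < l\<close> by (intro pos_scale qf_lt_imp_pos[OF fin(1) pos_herm[OF H] Hlt]) auto
    then show ?thesis
    proof (rule iffD1[OF pos_cong, rotated])
      fix a a' :: 'a
      have "(\<Sum>b\<in>B. V (a, b) (a', b) + Y (a, b) (a', b)) = of_real (1 / l) * (H a a' + of_real (card B * g) * idm a a')"
        unfolding V_def Y_def H_def by (simp add: sum.distrib algebra_simps sum_distrib_left idm_Pair idm_def)
      moreover have "of_real \<mu> * idm a a' = (of_real (1 / l) * of_real l) * of_real \<mu> * idm a a'" using ll by simp
      ultimately show "of_real (1 / l) * (of_real (l * \<mu> - card B * g) * idm a a' - H a a') =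
         of_real \<mu> * idm a a' - (\<Sum>b\<in>B. V (a, b) (a', b) + Y (a, b) (a', b))"
        using \<open>0 < l\<close> by (simp add: algebra_simps)
    qed
  qed
  ultimately show ?thesis unfolding dual_feasible_def by blast
qed

end

section \<open>Channels and their tensor powers\<close>

definition Jc :: "nat \<Rightarrow> (complex mat \<Rightarrow> complex mat) \<Rightarrow> nat \<times> nat \<Rightarrow> nat \<times> nat \<Rightarrow> complex" where
  "Jc d \<Phi> x y = \<Phi> (unit_mat d (fst x) (fst y)) $$ (snd x, snd y)"

text \<open>Linearity in coordinates: the map is determined on \<open>d\<close> by \<open>d\<close>
  matrices by its Choi matrix. The definition of \<open>map_tensor\<close> is a sum of this form, so
  the property passes directly to tensor powers.\<close>

definition lin_rep :: "nat \<Rightarrow> nat \<Rightarrow> (complex mat \<Rightarrow> complex mat) \<Rightarrow> bool" where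
  "lin_rep d e \<Phi> \<longleftrightarrow> (\<forall>X\<in>carrier_mat d d. \<Phi> X \<in> carrier_mat e e \<and>
     (\<forall>b<e. \<forall>b'<e. \<Phi> X $$ (b, b') = (\<Sum>a<d. \<Sum>a'<d. X $$ (a, a') * Jc d \<Phi> (a, b) (a', b'))))"

lemma lin_repD:
  assumes "lin_rep d e \<Phi>" "X \<in> carrier_mat d d"
  shows "\<Phi> X \<in> carrier_mat e e"
    "b < e \<Longrightarrow> b' < e \<Longrightarrow> \<Phi> X $$ (b, b') = (\<Sum>a<d. \<Sum>a'<d. X $$ (a, a') * Jc d \<Phi> (a, b) (a', b'))"
  using assms by (auto simp: lin_rep_def)

lemma linear_map_lin_rep:
  assumes lin: "is_linear_map d \<Phi>" and carr: "\<And>X. X \<in> carrier_mat d d \<Longrightarrow> \<Phi> X \<in> carrier_mat e e"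
  shows "lin_rep d e \<Phi>"
  unfolding lin_rep_def
proof (intro ballI conjI allI impI carr)
  fix X :: "complex mat" and b b' assume X: "X \<in> carrier_mat d d" and b: "b < e" "b' < e"
  have add: "\<Phi> (Y + Z) = \<Phi> Y + \<Phi> Z" if "Y \<in> carrier_mat d d" "Z \<in> carrier_mat d d" for Y Z
    using lin that by (simp add: is_linear_map_def)
  have scale: "\<Phi> (c \<cdot>\<^sub>m Y) = c \<cdot>\<^sub>m \<Phi> Y" if "Y \<in> carrier_mat d d" for Y c
    using lin that by (simp add: is_linear_map_def)
  \<comment> \<open>Linearity is stated for two summands only, so \<open>X\<close> is assembled
    entry by entry; \<open>part S\<close> keeps the entries with index in \<open>S\<close>.\<close>
  define part where "part S = mat d d (\<lambda>(i, j). if (i, j) \<in> S then X $$ (i, j) else 0)" for S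
  have *: "\<Phi> (part S) $$ (b, b') = (\<Sum>x\<in>S. X $$ x * Jc d \<Phi> (fst x, b) (snd x, b'))"
    if "finite S" "S \<subseteq> {..<d} \<times> {..<d}" for S
    using that
  proof (induction S rule: finite_induct)
    case empty
    have c: "part {} \<in> carrier_mat d d" by (simp add: part_def)
    have "part {} = 0 \<cdot>\<^sub>m part {}" by (rule eq_matI) (auto simp: part_def)
    then have "\<Phi> (part {}) = \<Phi> (0 \<cdot>\<^sub>m part {})" by (rule arg_cong)
    also have "\<dots> = 0 \<cdot>\<^sub>m \<Phi> (part {})" by (rule scale[OF c])
    finally have "\<Phi> (part {}) $$ (b, b') = (0 \<cdot>\<^sub>m \<Phi> (part {})) $$ (b, b')" by (rule arg_cong)
    also have "\<dots> = 0" using carr[OF c] b by simp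
    finally show ?case by simp
  next
    case (insert x S)
    obtain a a' where x: "x = (a, a')" by fastforce
    have "part (insert x S) = part S + X $$ x \<cdot>\<^sub>m unit_mat d a a'"
      using insert x by (intro eq_matI) (auto simp: part_def unit_mat_def)
    moreover have "part S \<in> carrier_mat d d" "unit_mat d a a' \<in> carrier_mat d d"
      by (auto simp: part_def unit_mat_def)
    ultimately have "\<Phi> (part (insert x S)) = \<Phi> (part S) + X $$ x \<cdot>\<^sub>m \<Phi> (unit_mat d a a')"
      by (simp add: add scale)
    moreover have "\<Phi> (part S) \<in> carrier_mat e e" "\<Phi> (unit_mat d a a') \<in> carrier_mat e e"
      by (rule carr; simp add: part_def unit_mat_def)+
    ultimately show ?case using insert b x by (simp add: Jc_def)
  qed
  have "part ({..<d} \<times> {..<d}) = X" using X by (intro eq_matI) (auto simp: part_def)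
  then show "\<Phi> X $$ (b, b') = (\<Sum>a<d. \<Sum>a'<d. X $$ (a, a') * Jc d \<Phi> (a, b) (a', b'))"
    using *[of "{..<d} \<times> {..<d}"] by (simp add: sum_pair)
qed

lemma channel_lin_rep: "is_channel dA dB \<N> \<Longrightarrow> lin_rep dA dB \<N>"
  by (intro linear_map_lin_rep) (auto simp: is_channel_def)

lemma channel_tp:
  assumes "is_channel dA dB \<N>" "a < dA" "a' < dA"
  shows "(\<Sum>b<dB. Jc dA \<N> (a, b) (a', b)) = idm a a'"
proof -
  have E: "unit_mat dA a a' \<in> carrier_mat dA dA" by (simp add: unit_mat_def)
  have "(\<Sum>b<dB. Jc dA \<N> (a, b) (a', b)) = mtrace (\<N> (unit_mat dA a a'))"
  proof -
    have "\<N> (unit_mat dA a a') \<in> carrier_mat dB dB" using assms(1) E by (simp add: is_channel_def)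
    then show ?thesis by (auto simp: mtrace_def Jc_def)
  qed
  also have "\<dots> = mtrace (unit_mat dA a a')"
    using assms(1) E by (simp add: is_channel_def)
  also have "\<dots> = (\<Sum>i<dA. if i = a then idm i a' else 0)"
    unfolding mtrace_def by (intro sum.cong) (auto simp: unit_mat_def idm_def)
  also have "\<dots> = idm a a'" using assms by simp
  finally show ?thesis .
qed

text \<open>Complete positivity is applied to the unnormalised maximally entangled vector
  \<open>u\<close>, whose output is the Choi matrix.\<close>

lemma channel_pos:
  assumes "is_channel dA dB \<N>"
  shows "pos ({..<dA} \<times> {..<dB}) (Jc dA \<N>)"
proof -
  define u :: "nat \<Rightarrow> complex" where "u p = (if p div dA = p mod dA then 1 else 0)" for p
  define X where "X = mat (dA * dA) (dA * dA) (\<lambda>(p, q). u p * cnj (u q))"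
  have "pos {..<dA * dA} (ent X)"
    by (rule iffD1[OF pos_cong pos_rank1[of _ u]]) (simp add: X_def)
  then have "psd (dA * dA) X" by (simp add: psd_iff_pos X_def)
  then have "psd (dA * dB) (id_tensor dA dA dB \<N> X)" using assms by (auto simp: is_channel_def)
  then have p: "pos {..<dA * dB} (ent (id_tensor dA dA dB \<N> X))" by (simp add: psd_iff_pos)
  have "pos ({..<dA} \<times> {..<dB}) (\<lambda>x y. ent (id_tensor dA dA dB \<N> X) (fst x * dB + snd x) (fst y * dB + snd y))"
    by (rule pos_reindex[OF finite_lessThan _ p]) (auto simp: encode_less)
  then show ?thesis
  proof (rule iffD1[OF pos_cong, rotated])
    fix x y assume "x \<in> {..<dA} \<times> {..<dB}" "y \<in> {..<dA} \<times> {..<dB}"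
    then obtain a b a' b' where xy: "x = (a, b)" "y = (a', b')" and l: "a < dA" "b < dB" "a' < dA" "b' < dB" by auto
    have "mat dA dA (\<lambda>(i,j). X $$ (a * dA + i, a' * dA + j)) = unit_mat dA a a'"
      using l by (intro eq_matI) (auto simp: X_def unit_mat_def u_def encode_less)
    then show "ent (id_tensor dA dA dB \<N> X) (fst x * dB + snd x) (fst y * dB + snd y) = Jc dA \<N> x y"
      using l by (simp add: xy id_tensor_def Jc_def encode_less)
  qed
qed

text \<open>The Kronecker product of operators on \<open>A\<^sub>1 \<otimes> B\<^sub>1\<close> and \<open>A\<^sub>2 \<otimes> B\<^sub>2\<close>, regrouped as an operator on
  \<open>(A\<^sub>1 \<otimes> A\<^sub>2) \<otimes> (B\<^sub>1 \<otimes> B\<^sub>2)\<close>.\<close>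

definition tns :: "nat \<Rightarrow> nat \<Rightarrow> (nat \<times> nat \<Rightarrow> nat \<times> nat \<Rightarrow> complex) \<Rightarrow> (nat \<times> nat \<Rightarrow> nat \<times> nat \<Rightarrow> complex) \<Rightarrow>
    nat \<times> nat \<Rightarrow> nat \<times> nat \<Rightarrow> complex" where
  "tns d e M N x y = M (fst x div d, snd x div e) (fst y div d, snd y div e) * N (fst x mod d, snd x mod e) (fst y mod d, snd y mod e)"

section \<open>Tensor products of Choi matrices and of dual solutions\<close>

lemma bij_betw_decode2:
  fixes k d l e :: nat
  shows
  "bij_betw (\<lambda>x. ((fst x div d, snd x div e), (fst x mod d, snd x mod e)))
    ({..<k * d} \<times> {..<l * e}) (({..<k} \<times> {..<l}) \<times> ({..<d} \<times> {..<e}))"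
  by (rule bij_betw_byWitness[where f' = "\<lambda>(x, y). (fst x * d + fst y, snd x * e + snd y)"])
     (auto simp: decode_less encode_less)

lemma pos_tns:
  assumes "pos ({..<k} \<times> {..<l}) M" "pos ({..<d} \<times> {..<e}) N"
  shows "pos ({..<k * d} \<times> {..<l * e}) (tns d e M N)"
proof -
  have p: "pos (({..<k} \<times> {..<l}) \<times> ({..<d} \<times> {..<e})) (\<lambda>x y. M (fst x) (fst y) * N (snd x) (snd y))"
    by (rule pos_tensor) (use assms in auto)
  have "pos ({..<k * d} \<times> {..<l * e}) (\<lambda>x y. (\<lambda>x y. M (fst x) (fst y) * N (snd x) (snd y))
    ((fst x div d, snd x div e), (fst x mod d, snd x mod e)) ((fst y div d, snd y div e), (fst y mod d, snd y mod e)))"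
    by (rule pos_reindex[OF _ _ p]) (use bij_betw_decode2 in \<open>auto simp: decode_less\<close>)
  then show ?thesis by (simp add: tns_def[abs_def])
qed

lemma idm_decode: "idm (a div d) (a' div d) * idm (a mod d) (a' mod d) = idm a (a'::nat)"
  by (auto simp: idm_def) (metis div_mult_mod_eq)

lemma pos_tensor_decode:
  fixes k d :: nat
  assumes "pos {..<k} M" "pos {..<d} N"
  shows "pos {..<k * d} (\<lambda>a a'. M (a div d) (a' div d) * N (a mod d) (a' mod d))"
proof -
  have p: "pos ({..<k} \<times> {..<d}) (\<lambda>x y. M (fst x) (fst y) * N (snd x) (snd y))"
    by (rule pos_tensor) (use assms in auto)
  have "pos {..<k * d} (\<lambda>x y. (\<lambda>x y. M (fst x) (fst y) * N (snd x) (snd y)) (x div d, x mod d) (y div d, y mod d))"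
    by (rule pos_reindex[OF _ _ p]) (auto simp: decode_less)
  then show ?thesis by simp
qed

lemma pos_ptraceB:
  assumes "finite A" "finite B" "pos (A \<times> B) Q"
  shows "pos A (\<lambda>a a'. \<Sum>b\<in>B. Q (a, b) (a', b))"
proof (rule pos_sum)
  fix b assume b: "b \<in> B"
  show "pos A (\<lambda>a a'. Q (a, b) (a', b))"
    by (rule pos_reindex[OF _ _ assms(3)]) (use assms b in auto)
qed

text \<open>With \<open>V = V1 \<otimes> V2 + Y1 \<otimes> Y2\<close> and
  \<open>Y = V1 \<otimes> Y2 + Y1 \<otimes> V2\<close>, both the difference \<open>V - Y\<close> and
  the sum \<open>V + Y\<close> factorise. The difference controls the Choi matrix and the sum
  controls the threshold, so each constraint becomes an inequality between tensor products.\<close>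

lemma dual_feasible_tns:
  assumes J1: "pos ({..<k} \<times> {..<l}) J1" and J2: "pos ({..<d} \<times> {..<e}) J2"
    and df1: "dual_feasible {..<k} {..<l} \<mu>1 J1" and df2: "dual_feasible {..<d} {..<e} \<mu>2 J2" and \<mu>2: "0 \<le> \<mu>2"
  shows "dual_feasible {..<k * d} {..<l * e} (\<mu>1 * \<mu>2) (tns d e J1 J2)"
proof -
  let ?X1 = "{..<k} \<times> {..<l}" and ?X2 = "{..<d} \<times> {..<e}" and ?X = "{..<k * d} \<times> {..<l * e}"
  obtain V1 Y1 where V1: "pos ?X1 V1" and Y1: "pos ?X1 Y1" and W1: "pos ?X1 (\<lambda>x y. ptB V1 x y - ptB Y1 x y - J1 x y)"
    and T1: "pos {..<k} (\<lambda>a a'. of_real \<mu>1 * idm a a' - (\<Sum>b<l. V1 (a, b) (a', b) + Y1 (a, b) (a', b)))"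
    using df1 unfolding dual_feasible_def by blast
  obtain V2 Y2 where V2: "pos ?X2 V2" and Y2: "pos ?X2 Y2" and W2: "pos ?X2 (\<lambda>x y. ptB V2 x y - ptB Y2 x y - J2 x y)"
    and T2: "pos {..<d} (\<lambda>a a'. of_real \<mu>2 * idm a a' - (\<Sum>b<e. V2 (a, b) (a', b) + Y2 (a, b) (a', b)))"
    using df2 unfolding dual_feasible_def by blast
  define V where "V x y = tns d e V1 V2 x y + tns d e Y1 Y2 x y" for x y
  define Y where "Y x y = tns d e V1 Y2 x y + tns d e Y1 V2 x y" for x y
  have V: "pos ?X V" unfolding V_def[abs_def] by (intro pos_add pos_tns V1 V2 Y1 Y2)
  have Y: "pos ?X Y" unfolding Y_def[abs_def] by (intro pos_add pos_tns V1 V2 Y1 Y2)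
  have W2': "pos ?X2 (\<lambda>x y. ptB V2 x y - ptB Y2 x y)"
    using pos_add[OF W2 J2] by simp
  \<comment> \<open>Telescoping: \<open>K1 \<otimes> K2 - J1 \<otimes> J2 = (K1 - J1) \<otimes> K2 +
    J1 \<otimes> (K2 - J2)\<close>, where \<open>K2\<close> is positive because it dominates
    \<open>J2\<close>.\<close>
  have "pos ?X (\<lambda>x y. tns d e (\<lambda>x y. ptB V1 x y - ptB Y1 x y - J1 x y) (\<lambda>x y. ptB V2 x y - ptB Y2 x y) x y +
      tns d e J1 (\<lambda>x y. ptB V2 x y - ptB Y2 x y - J2 x y) x y)"
    by (intro pos_add pos_tns W1 W2' J1 W2)
  then have W: "pos ?X (\<lambda>x y. ptB V x y - ptB Y x y - tns d e J1 J2 x y)"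
    by (rule iffD1[OF pos_cong, rotated]) (simp add: V_def Y_def tns_def ptB_def algebra_simps)
  define S1 where "S1 a a' = (\<Sum>b<l. V1 (a, b) (a', b) + Y1 (a, b) (a', b))" for a a'
  define S2 where "S2 a a' = (\<Sum>b<e. V2 (a, b) (a', b) + Y2 (a, b) (a', b))" for a a'
  have S1: "pos {..<k} S1" unfolding S1_def[abs_def] by (intro pos_ptraceB pos_add V1 Y1) auto
  \<comment> \<open>The same telescoping for the partial traces, with \<open>S1\<close> and
    \<open>S2\<close> below multiples of the identity; here \<open>\<mu>2\<close> must be
    nonnegative.\<close>
  have "pos {..<k * d} (\<lambda>a a'. (of_real \<mu>1 * idm (a div d) (a' div d) - S1 (a div d) (a' div d)) * (of_real \<mu>2 * idm (a mod d) (a' mod d))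
     + S1 (a div d) (a' div d) * (of_real \<mu>2 * idm (a mod d) (a' mod d) - S2 (a mod d) (a' mod d)))"
    using T1 T2 \<mu>2 by (intro pos_add pos_tensor_decode[where M = "\<lambda>a a'. of_real \<mu>1 * idm a a' - S1 a a'" and N = "\<lambda>a a'. of_real \<mu>2 * idm a a'"]
        pos_tensor_decode[where M = S1 and N = "\<lambda>a a'. of_real \<mu>2 * idm a a' - S2 a a'"] S1 pos_scale pos_idm) (simp_all add: S1_def S2_def)
  then have T: "pos {..<k * d} (\<lambda>a a'. of_real (\<mu>1 * \<mu>2) * idm a a' - (\<Sum>b<l * e. V (a, b) (a', b) + Y (a, b) (a', b)))"
  proof (rule iffD1[OF pos_cong, rotated])
    fix a a'
    have "(\<Sum>b<l * e. V (a, b) (a', b) + Y (a, b) (a', b)) = (\<Sum>b<l * e.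
       (V1 (a div d, b div e) (a' div d, b div e) + Y1 (a div d, b div e) (a' div d, b div e)) *
       (V2 (a mod d, b mod e) (a' mod d, b mod e) + Y2 (a mod d, b mod e) (a' mod d, b mod e)))"
      unfolding V_def Y_def tns_def by (intro sum.cong refl) (simp add: algebra_simps)
    also have "\<dots> = S1 (a div d) (a' div d) * S2 (a mod d) (a' mod d)"
      unfolding sum_decode[where f = "\<lambda>r b. (V1 (a div d, r) (a' div d, r) + Y1 (a div d, r) (a' div d, r)) *
       (V2 (a mod d, b) (a' mod d, b) + Y2 (a mod d, b) (a' mod d, b))"] S1_def S2_def sum_product ..
    finally have S: "(\<Sum>b<l * e. V (a, b) (a', b) + Y (a, b) (a', b)) = S1 (a div d) (a' div d) * S2 (a mod d) (a' mod d)" .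
    show "(of_real \<mu>1 * idm (a div d) (a' div d) - S1 (a div d) (a' div d)) * (of_real \<mu>2 * idm (a mod d) (a' mod d))
     + S1 (a div d) (a' div d) * (of_real \<mu>2 * idm (a mod d) (a' mod d) - S2 (a mod d) (a' mod d)) =
      of_real (\<mu>1 * \<mu>2) * idm a a' - (\<Sum>b<l * e. V (a, b) (a', b) + Y (a, b) (a', b))"
      unfolding S idm_decode[of a d a', symmetric] by (simp add: algebra_simps)
  qed
  show ?thesis unfolding dual_feasible_def using V Y W T by blast
qed

lemma map_tensor_index:
  assumes "p < e1 * e2" "q < e1 * e2"
  shows "map_tensor d1 e1 d2 e2 \<Phi>1 \<Phi>2 X $$ (p, q) =
    (\<Sum>x<d1 * d2. \<Sum>y<d1 * d2. X $$ (x, y) * tns d2 e2 (Jc d1 \<Phi>1) (Jc d2 \<Phi>2) (x, p) (y, q))"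
proof -
  define F where "F i k j l = X $$ (i * d2 + k, j * d2 + l) * Jc d1 \<Phi>1 (i, p div e2) (j, q div e2) * Jc d2 \<Phi>2 (k, p mod e2) (l, q mod e2)" for i k j l
  have "map_tensor d1 e1 d2 e2 \<Phi>1 \<Phi>2 X $$ (p, q) = (\<Sum>i<d1. \<Sum>j<d1. \<Sum>k<d2. \<Sum>l<d2. F i k j l)"
    using assms by (simp add: map_tensor_def F_def Jc_def)
  also have "\<dots> = (\<Sum>i<d1. \<Sum>k<d2. \<Sum>j<d1. \<Sum>l<d2. F i k j l)"
    by (rule sum.cong[OF refl], rule sum.swap)
  also have "\<dots> = (\<Sum>i<d1. \<Sum>k<d2. \<Sum>y<d1 * d2. F i k (y div d2) (y mod d2))"
    by (intro sum.cong refl sum_decode[symmetric])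
  also have "\<dots> = (\<Sum>x<d1 * d2. \<Sum>y<d1 * d2. F (x div d2) (x mod d2) (y div d2) (y mod d2))"
    by (rule sum_decode[symmetric])
  finally show ?thesis by (simp add: F_def tns_def mult.assoc)
qed

lemma unit_mat_carrier [simp]: "unit_mat d i j \<in> carrier_mat d d"
  by (simp add: unit_mat_def)

lemma unit_mat_idm: "x < d \<Longrightarrow> y < d \<Longrightarrow> unit_mat d a a' $$ (x, y) = idm a x * idm a' y"
  by (simp add: unit_mat_def idm_def)

lemma Jc_map_tensor:
  assumes "a < d1 * d2" "a' < d1 * d2" "p < e1 * e2" "q < e1 * e2"
  shows "Jc (d1 * d2) (map_tensor d1 e1 d2 e2 \<Phi>1 \<Phi>2) (a, p) (a', q) = tns d2 e2 (Jc d1 \<Phi>1) (Jc d2 \<Phi>2) (a, p) (a', q)"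
proof -
  let ?T = "tns d2 e2 (Jc d1 \<Phi>1) (Jc d2 \<Phi>2)"
  have "Jc (d1 * d2) (map_tensor d1 e1 d2 e2 \<Phi>1 \<Phi>2) (a, p) (a', q) =
    (\<Sum>x<d1 * d2. \<Sum>y<d1 * d2. unit_mat (d1 * d2) a a' $$ (x, y) * ?T (x, p) (y, q))"
    unfolding Jc_def[of "d1 * d2"] fst_conv snd_conv by (rule map_tensor_index[OF assms(3,4)])
  also have "\<dots> = (\<Sum>x<d1 * d2. idm a x * (\<Sum>y<d1 * d2. idm a' y * ?T (x, p) (y, q)))"
    by (simp add: unit_mat_idm sum_distrib_left mult.assoc)
  also have "\<dots> = ?T (a, p) (a', q)" using assms by simp
  finally show ?thesis .
qed

lemma map_tensor_lin_rep: "lin_rep (d1 * d2) (e1 * e2) (map_tensor d1 e1 d2 e2 \<Phi>1 \<Phi>2)"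
  unfolding lin_rep_def
proof (intro ballI conjI allI impI)
  fix X :: "complex mat" and b b' assume "b < e1 * e2" "b' < e1 * e2"
  then show "map_tensor d1 e1 d2 e2 \<Phi>1 \<Phi>2 X $$ (b, b') =
    (\<Sum>a<d1 * d2. \<Sum>a'<d1 * d2. X $$ (a, a') * Jc (d1 * d2) (map_tensor d1 e1 d2 e2 \<Phi>1 \<Phi>2) (a, b) (a', b'))"
    by (simp add: map_tensor_index Jc_map_tensor)
qed (simp add: map_tensor_def)

lemma chan_pow_lin_rep: "lin_rep (d ^ n) (e ^ n) (chan_pow d e \<N> n)"
proof (cases n)
  case 0
  then show ?thesis by (auto simp: lin_rep_def Jc_def unit_mat_def)
next
  case (Suc m)
  have "chan_pow d e \<N> (Suc m) = map_tensor d e (d ^ m) (e ^ m) \<N> (chan_pow d e \<N> m)" by (rule ext) simp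
  then show ?thesis using Suc map_tensor_lin_rep by simp
qed

abbreviation Jpow :: "nat \<Rightarrow> nat \<Rightarrow> (complex mat \<Rightarrow> complex mat) \<Rightarrow> nat \<Rightarrow> nat \<times> nat \<Rightarrow> nat \<times> nat \<Rightarrow> complex" where
  "Jpow d e \<N> n \<equiv> Jc (d ^ n) (chan_pow d e \<N> n)"

lemma Jpow_0: "x \<in> {..<1} \<times> {..<1} \<Longrightarrow> y \<in> {..<1} \<times> {..<1} \<Longrightarrow> Jpow d e \<N> 0 x y = 1"
  by (auto simp: Jc_def unit_mat_def)

lemma Jpow_Suc:
  assumes "x \<in> {..<d ^ Suc n} \<times> {..<e ^ Suc n}" "y \<in> {..<d ^ Suc n} \<times> {..<e ^ Suc n}"
  shows "Jpow d e \<N> (Suc n) x y = tns (d ^ n) (e ^ n) (Jc d \<N>) (Jpow d e \<N> n) x y"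
proof -
  have "chan_pow d e \<N> (Suc n) = map_tensor d e (d ^ n) (e ^ n) \<N> (chan_pow d e \<N> n)" by (rule ext) simp
  then show ?thesis using assms Jc_map_tensor[of "fst x" d "d ^ n" "fst y" "snd x" e "e ^ n" "snd y"] by auto
qed

text \<open>\<open>chan_pow\<close> peels off one factor at a time, whereas superadditivity splits a
  power into blocks of \<open>m\<close> and \<open>n\<close>. The regrouping is arithmetic of digits
  in base \<open>d\<close> and base \<open>e\<close>.\<close>

lemma Jpow_add:
  assumes "x \<in> {..<d ^ (m + n)} \<times> {..<e ^ (m + n)}" "y \<in> {..<d ^ (m + n)} \<times> {..<e ^ (m + n)}"
  shows "Jpow d e \<N> (m + n) x y = tns (d ^ n) (e ^ n) (Jpow d e \<N> m) (Jpow d e \<N> n) x y"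
  using assms
proof (induction m arbitrary: x y)
  case 0
  then show ?case using Jpow_0[of "(0,0)" "(0,0)" d e \<N>] by (auto simp: tns_def)
next
  case (Suc m)
  have dm: "(i mod (c ^ (m + n))) div c ^ n = (i div c ^ n) mod c ^ m"
     "i div c ^ (m + n) = i div c ^ n div c ^ m"
     "(i mod (c ^ (m + n))) mod c ^ n = i mod c ^ n" for i c :: nat
  proof -
    have c: "c ^ (m + n) = c ^ n * c ^ m" by (simp add: power_add mult.commute)
    show "(i mod (c ^ (m + n))) div c ^ n = (i div c ^ n) mod c ^ m"
    proof (cases "c ^ n = 0")
      case True
      then show ?thesis by (simp only: div_by_0 mod_0)
    next
      case False
      then show ?thesis unfolding c mod_mult2_eq by simp
    qed
    show "i div c ^ (m + n) = i div c ^ n div c ^ m" unfolding c by (rule div_mult2_eq)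
    show "(i mod (c ^ (m + n))) mod c ^ n = i mod c ^ n" unfolding c by (simp add: mod_mult2_eq)
  qed
  have x: "fst x < d * d ^ (m + n)" "snd x < e * e ^ (m + n)" "fst y < d * d ^ (m + n)" "snd y < e * e ^ (m + n)"
    using Suc.prems by auto
  have "Jpow d e \<N> (Suc m + n) x y = Jc d \<N> (fst x div d ^ (m + n), snd x div e ^ (m + n)) (fst y div d ^ (m + n), snd y div e ^ (m + n)) *
     Jpow d e \<N> (m + n) (fst x mod d ^ (m + n), snd x mod e ^ (m + n)) (fst y mod d ^ (m + n), snd y mod e ^ (m + n))"
    using Jpow_Suc[of x d "m + n" e y \<N>] Suc.prems by (simp add: tns_def)
  also have "Jpow d e \<N> (m + n) (fst x mod d ^ (m + n), snd x mod e ^ (m + n)) (fst y mod d ^ (m + n), snd y mod e ^ (m + n)) =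
     tns (d ^ n) (e ^ n) (Jpow d e \<N> m) (Jpow d e \<N> n) (fst x mod d ^ (m + n), snd x mod e ^ (m + n)) (fst y mod d ^ (m + n), snd y mod e ^ (m + n))"
    by (rule Suc.IH) (use decode_less[OF x(1)] decode_less[OF x(2)] decode_less[OF x(3)] decode_less[OF x(4)] in auto)
  finally have 1: "Jpow d e \<N> (Suc m + n) x y =
     Jc d \<N> (fst x div d ^ n div d ^ m, snd x div e ^ n div e ^ m) (fst y div d ^ n div d ^ m, snd y div e ^ n div e ^ m) *
     Jpow d e \<N> m (fst x div d ^ n mod d ^ m, snd x div e ^ n mod e ^ m) (fst y div d ^ n mod d ^ m, snd y div e ^ n mod e ^ m) *
     Jpow d e \<N> n (fst x mod d ^ n, snd x mod e ^ n) (fst y mod d ^ n, snd y mod e ^ n)"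
    unfolding tns_def fst_conv snd_conv dm by (simp only: mult.assoc)
  have c: "c * c ^ (m + n) = c ^ Suc m * c ^ n" for c :: nat by (simp add: power_add)
  have "Jpow d e \<N> (Suc m) (fst x div d ^ n, snd x div e ^ n) (fst y div d ^ n, snd y div e ^ n) =
     tns (d ^ m) (e ^ m) (Jc d \<N>) (Jpow d e \<N> m) (fst x div d ^ n, snd x div e ^ n) (fst y div d ^ n, snd y div e ^ n)"
    by (rule Jpow_Suc) (use x decode_less in \<open>auto simp only: c SigmaI lessThan_iff\<close>)
  then show ?case unfolding 1 tns_def[of "d ^ n"] by (simp add: tns_def)
qed

lemma Jpow_pos:
  assumes "pos ({..<d} \<times> {..<e}) (Jc d \<N>)"
  shows "pos ({..<d ^ n} \<times> {..<e ^ n}) (Jpow d e \<N> n)"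
proof (induction n)
  case 0
  show ?case by (rule iffD1[OF pos_cong pos_rank1[of _ "\<lambda>_. 1"]]) (use Jpow_0 in simp)
next
  case (Suc n)
  have "pos ({..<d ^ Suc n} \<times> {..<e ^ Suc n}) (tns (d ^ n) (e ^ n) (Jc d \<N>) (Jpow d e \<N> n))"
    using pos_tns[OF assms Suc] by simp
  then show ?case
    by (rule iffD1[OF pos_cong, rotated]) (use Jpow_Suc in simp)
qed

lemma Jpow_tp:
  assumes tp: "\<And>a a'. a < d \<Longrightarrow> a' < d \<Longrightarrow> (\<Sum>b<e. Jc d \<N> (a, b) (a', b)) = idm a a'"
    and "a < d ^ n" "a' < d ^ n"
  shows "(\<Sum>b<e ^ n. Jpow d e \<N> n (a, b) (a', b)) = idm a a'"
  using assms(2,3)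
proof (induction n arbitrary: a a')
  case 0
  then show ?case by (simp add: Jc_def unit_mat_def idm_def)
next
  case (Suc n)
  then have a: "a < d * d ^ n" "a' < d * d ^ n" by auto
  have "(\<Sum>b<e ^ Suc n. Jpow d e \<N> (Suc n) (a, b) (a', b)) =
    (\<Sum>b<e * e ^ n. Jc d \<N> (a div d ^ n, b div e ^ n) (a' div d ^ n, b div e ^ n) * Jpow d e \<N> n (a mod d ^ n, b mod e ^ n) (a' mod d ^ n, b mod e ^ n))"
    using Jpow_Suc[of "(a, _)" d n e "(a', _)" \<N>] Suc.prems by (intro sum.cong) (auto simp: tns_def)
  also have "\<dots> = (\<Sum>r<e. Jc d \<N> (a div d ^ n, r) (a' div d ^ n, r)) * (\<Sum>b<e ^ n. Jpow d e \<N> n (a mod d ^ n, b) (a' mod d ^ n, b))"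
    unfolding sum_decode[where f = "\<lambda>r b. Jc d \<N> (a div d ^ n, r) (a' div d ^ n, r) * Jpow d e \<N> n (a mod d ^ n, b) (a' mod d ^ n, b)"] sum_product ..
  also have "\<dots> = idm a a'"
    using decode_less[OF a(1)] decode_less[OF a(2)] by (simp add: tp Suc.IH idm_decode)
  finally show ?case .
qed

lemma dual_feasibleI:
  assumes "pos (A \<times> B) V" "pos (A \<times> B) Y" "pos (A \<times> B) (\<lambda>x y. ptB V x y - ptB Y x y - J x y)"
    "pos A (\<lambda>a a'. of_real \<mu> * idm a a' - (\<Sum>b\<in>B. V (a, b) (a', b) + Y (a, b) (a', b)))"
  shows "dual_feasible A B \<mu> J"
  unfolding dual_feasible_def using assms by blast

lemma Jpow_dual_feasible:
  assumes pos: "pos ({..<d} \<times> {..<e}) (Jc d \<N>)" and df: "dual_feasible {..<d} {..<e} \<mu> (Jc d \<N>)" and \<mu>: "0 \<le> \<mu>"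
  shows "dual_feasible {..<d ^ n} {..<e ^ n} (\<mu> ^ n) (Jpow d e \<N> n)"
proof (induction n)
  case 0
  have 1: "pos ({..<Suc 0} \<times> {..<Suc 0}) (\<lambda>_ _. 1)" using pos_rank1[of _ "\<lambda>_. 1"] by simp
  have "pos ({..<1} \<times> {..<1}) (\<lambda>x y. ptB (\<lambda>_ _. 1) x y - ptB (\<lambda>_ _. 0) x y - Jpow d e \<N> 0 x y)"
    by (rule iffD1[OF pos_cong pos_zero]) (use Jpow_0 in \<open>simp add: ptB_def\<close>)
  moreover have "pos {..<1::nat} (\<lambda>a a'. of_real 1 * idm a a' - (\<Sum>b<1::nat. 1 + 0))"
    by (rule iffD1[OF pos_cong pos_zero]) (simp add: idm_def)
  ultimately show ?case using 1 pos_zero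
    by (intro dual_feasibleI[where V = "\<lambda>_ _. 1" and Y = "\<lambda>_ _. 0"]) simp_all
next
  case (Suc n)
  have "dual_feasible {..<d * d ^ n} {..<e * e ^ n} (\<mu> * \<mu> ^ n) (tns (d ^ n) (e ^ n) (Jc d \<N>) (Jpow d e \<N> n))"
    using \<mu> by (intro dual_feasible_tns pos df Suc Jpow_pos) auto
  then obtain V Y where *: "pos ({..<d * d ^ n} \<times> {..<e * e ^ n}) V" "pos ({..<d * d ^ n} \<times> {..<e * e ^ n}) Y"
    "pos ({..<d * d ^ n} \<times> {..<e * e ^ n}) (\<lambda>x y. ptB V x y - ptB Y x y - tns (d ^ n) (e ^ n) (Jc d \<N>) (Jpow d e \<N> n) x y)"
    "pos {..<d * d ^ n} (\<lambda>a a'. of_real (\<mu> * \<mu> ^ n) * idm a a' - (\<Sum>b<e * e ^ n. V (a, b) (a', b) + Y (a, b) (a', b)))"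
    unfolding dual_feasible_def by blast
  have "pos ({..<d ^ Suc n} \<times> {..<e ^ Suc n}) (\<lambda>x y. ptB V x y - ptB Y x y - Jpow d e \<N> (Suc n) x y)"
    using *(3) unfolding power_Suc[of d] power_Suc[of e]
    by (rule iffD1[OF pos_cong, rotated]) (use Jpow_Suc[of _ d n e _ \<N>] in simp)
  then show ?case unfolding dual_feasible_def using *(1,2,4) by auto
qed

section \<open>Coherent information and quantum capacity\<close>

abbreviation amp :: "nat \<Rightarrow> complex vec \<Rightarrow> nat \<Rightarrow> nat \<Rightarrow> complex" where
  "amp d \<psi> \<equiv> \<lambda>r a. \<psi> $ (r * d + a)"

definition coh_set :: "nat \<Rightarrow> nat \<Rightarrow> (complex mat \<Rightarrow> complex mat) \<Rightarrow> real set" where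
  "coh_set d e \<Phi> = {entropy (\<Phi> (ptrace_first d d (proj \<psi>))) - entropy (id_tensor d d e \<Phi> (proj \<psi>)) | \<psi>.
     \<psi> \<in> carrier_vec (d * d) \<and> \<psi> \<bullet>c \<psi> = 1}"

lemma coh_info_Sup: "coh_info d e \<Phi> = Sup (coh_set d e \<Phi>)"
  by (simp add: coh_info_def coh_set_def)

lemma unit_vector_iff:
  assumes "\<psi> \<in> carrier_vec (k * d)"
  shows "\<psi> \<bullet>c \<psi> = 1 \<longleftrightarrow> (\<Sum>r<k. \<Sum>a<d. (cmod (amp d \<psi> r a))\<^sup>2) = 1"
proof -
  have "\<psi> \<bullet>c \<psi> = (\<Sum>p<k * d. \<psi> $ p * cnj (\<psi> $ p))"
    using assms by (simp add: scalar_prod_def lessThan_atLeast0)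
  also have "\<dots> = of_real (\<Sum>p<k * d. (cmod (\<psi> $ p))\<^sup>2)"
    by (simp only: of_real_sum complex_norm_square)
  finally show ?thesis unfolding sum_encode by (simp only: of_real_eq_1_iff)
qed

lemma id_tensor_carrier: "id_tensor k d e \<Phi> X \<in> carrier_mat (k * e) (k * e)"
  by (simp add: id_tensor_def)

lemma id_tensor_index:
  assumes rep: "lin_rep d e \<Phi>" and "p < k * e" "q < k * e"
  shows "id_tensor k d e \<Phi> X $$ (p, q) = (\<Sum>a<d. \<Sum>a'<d. X $$ ((p div e) * d + a, (q div e) * d + a') * Jc d \<Phi> (a, p mod e) (a', q mod e))"
proof -
  let ?B = "mat d d (\<lambda>(i,j). X $$ ((p div e) * d + i, (q div e) * d + j))"
  have "id_tensor k d e \<Phi> X $$ (p, q) = \<Phi> ?B $$ (p mod e, q mod e)"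
    using assms by (simp add: id_tensor_def)
  also have "\<dots> = (\<Sum>a<d. \<Sum>a'<d. ?B $$ (a, a') * Jc d \<Phi> (a, p mod e) (a', q mod e))"
    using decode_less[OF assms(2)] decode_less[OF assms(3)] by (intro lin_repD(2)[OF rep]) auto
  finally show ?thesis by simp
qed

lemma proj_encode:
  assumes "\<psi> \<in> carrier_vec (k * d)" "r < k" "a < d" "r' < k" "a' < d"
  shows "proj \<psi> $$ (r * d + a, r' * d + a') = amp d \<psi> r a * cnj (amp d \<psi> r' a')"
  using assms by (simp add: proj_def encode_less)

lemma id_tensor_proj:
  assumes rep: "lin_rep d e \<Phi>" and \<psi>: "\<psi> \<in> carrier_vec (k * d)" and "p < k * e" "q < k * e"
  shows "id_tensor k d e \<Phi> (proj \<psi>) $$ (p, q) = out {..<d} (amp d \<psi>) (Jc d \<Phi>) (p div e, p mod e) (q div e, q mod e)"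
  unfolding id_tensor_index[OF rep assms(3,4)] out_def
  using decode_less[OF assms(3)] decode_less[OF assms(4)]
  by (intro sum.cong refl) (simp add: proj_encode[OF \<psi>])

lemma ptrace_out:
  assumes rep: "lin_rep d e \<Phi>" and \<psi>: "\<psi> \<in> carrier_vec (k * d)" and "b < e" "b' < e"
  shows "\<Phi> (ptrace_first k d (proj \<psi>)) $$ (b, b') = (\<Sum>r<k. out {..<d} (amp d \<psi>) (Jc d \<Phi>) (r, b) (r, b'))"
proof -
  have "\<Phi> (ptrace_first k d (proj \<psi>)) $$ (b, b') =
    (\<Sum>a<d. \<Sum>a'<d. ptrace_first k d (proj \<psi>) $$ (a, a') * Jc d \<Phi> (a, b) (a', b'))"
    by (rule lin_repD(2)[OF rep _ assms(3,4)]) (simp add: ptrace_first_def)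
  also have "\<dots> = (\<Sum>a<d. \<Sum>a'<d. \<Sum>r<k. amp d \<psi> r a * cnj (amp d \<psi> r a') * Jc d \<Phi> (a, b) (a', b'))"
    by (intro sum.cong refl)
      (simp add: ptrace_first_def proj_encode[OF \<psi>] sum_distrib_right)
  also have "\<dots> = (\<Sum>r<k. \<Sum>a<d. \<Sum>a'<d. amp d \<psi> r a * cnj (amp d \<psi> r a') * Jc d \<Phi> (a, b) (a', b'))"
    by (rule sum_rotate_out)
  finally show ?thesis by (simp add: out_def mult_ac)
qed

lemma entropy_id_tensor:
  assumes rep: "lin_rep d e \<Phi>" and \<psi>: "\<psi> \<in> carrier_vec (k * d)"
    and sp: "spec ({..<k} \<times> {..<e}) (out {..<d} (amp d \<psi>) (Jc d \<Phi>)) p h"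
  shows "entropy (id_tensor k d e \<Phi> (proj \<psi>)) = (\<Sum>x\<in>{..<k} \<times> {..<e}. eta (p x))"
proof -
  have "spec {..<k * e} (ent (id_tensor k d e \<Phi> (proj \<psi>))) (\<lambda>q. p (q div e, q mod e)) (\<lambda>q i. h (q div e, q mod e) (i div e, i mod e))"
    by (rule iffD1[OF spec_cong spec_reindex[OF bij_betw_decode sp]]) (simp add: id_tensor_proj[OF rep \<psi>])
  from entropy_spec[OF id_tensor_carrier this]
  show ?thesis unfolding sum_pair by (simp add: sum_decode[where f = "\<lambda>r b. eta (p (r, b))"])
qed

lemma entropy_ptrace:
  assumes rep: "lin_rep d e \<Phi>" and \<psi>: "\<psi> \<in> carrier_vec (k * d)"
    and sp: "spec {..<e} (\<lambda>b b'. \<Sum>r<k. out {..<d} (amp d \<psi>) (Jc d \<Phi>) (r, b) (r, b')) q f"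
  shows "entropy (\<Phi> (ptrace_first k d (proj \<psi>))) = (\<Sum>b<e. eta (q b))"
proof -
  have "\<Phi> (ptrace_first k d (proj \<psi>)) \<in> carrier_mat e e"
    by (rule lin_repD(1)[OF rep]) (simp add: ptrace_first_def)
  moreover have "spec {..<e} (ent (\<Phi> (ptrace_first k d (proj \<psi>)))) q f"
    by (rule iffD1[OF spec_cong sp]) (simp add: ptrace_out[OF rep \<psi>])
  ultimately show ?thesis by (rule entropy_spec)
qed

lemma out_specs:
  fixes d e k :: nat
  assumes "pos ({..<d} \<times> {..<e}) J"
  obtains p h q f where "spec ({..<k} \<times> {..<e}) (out {..<d} \<psi> J) p h"
    "spec {..<e} (\<lambda>b b'. \<Sum>r<k. out {..<d} \<psi> J (r, b) (r, b')) q f"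
    "\<And>x. x \<in> {..<k} \<times> {..<e} \<Longrightarrow> 0 \<le> p x" "\<And>b. b < e \<Longrightarrow> 0 \<le> q b"
proof -
  let ?o = "out {..<d} \<psi> J"
  have o: "pos ({..<k} \<times> {..<e}) ?o" by (rule pos_out[OF _ assms]) simp
  have "pos {..<e} (\<lambda>b b'. ?o (r, b) (r, b'))" if "r \<in> {..<k}" for r
    by (rule pos_reindex[OF _ _ o]) (use that in auto)
  then have o2: "pos {..<e} (\<lambda>b b'. \<Sum>r<k. ?o (r, b) (r, b'))" by (rule pos_sum)
  obtain p h where sp: "spec ({..<k} \<times> {..<e}) ?o p h"
    by (rule spectralE[OF _ pos_herm[OF o]]) auto
  obtain q f where sq: "spec {..<e} (\<lambda>b b'. \<Sum>r<k. ?o (r, b) (r, b')) q f"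
    by (rule spectralE[OF _ pos_herm[OF o2]]) auto
  show ?thesis
    using that[OF sp sq] spec_nonneg[OF _ o sp] spec_nonneg[OF _ o2 sq] by auto
qed

lemma coh_set_le:
  assumes rep: "lin_rep d e \<Phi>" and pos: "pos ({..<d} \<times> {..<e}) (Jc d \<Phi>)"
    and tp: "\<And>a a'. a < d \<Longrightarrow> a' < d \<Longrightarrow> (\<Sum>b<e. Jc d \<Phi> (a, b) (a', b)) = idm a a'"
    and df: "dual_feasible {..<d} {..<e} \<mu> (Jc d \<Phi>)" and \<nu>: "\<mu> < \<nu>" and x: "x \<in> coh_set d e \<Phi>"
  shows "x \<le> log 2 \<nu>"
proof -
  obtain \<psi> where \<psi>: "\<psi> \<in> carrier_vec (d * d)" "\<psi> \<bullet>c \<psi> = 1"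
    and x: "x = entropy (\<Phi> (ptrace_first d d (proj \<psi>))) - entropy (id_tensor d d e \<Phi> (proj \<psi>))"
    using x by (auto simp: coh_set_def)
  obtain p h q f where sp: "spec ({..<d} \<times> {..<e}) (out {..<d} (amp d \<psi>) (Jc d \<Phi>)) p h"
    and sq: "spec {..<e} (\<lambda>b b'. \<Sum>r<d. out {..<d} (amp d \<psi>) (Jc d \<Phi>) (r, b) (r, b')) q f"
    by (rule out_specs[OF pos, where k = d and \<psi> = "amp d \<psi>"], rule that) auto
  show ?thesis
    unfolding x entropy_ptrace[OF rep \<psi>(1) sq] entropy_id_tensor[OF rep \<psi>(1) sp]
    using \<psi> unit_vector_iff[OF \<psi>(1)]
    by (intro coherent_information_le[OF _ _ _ df pos _ _ \<nu> sp sq]) (auto simp: tp)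
qed

lemma coh_set_nonempty:
  assumes "0 < d"
  shows "coh_set d e \<Phi> \<noteq> {}"
proof -
  have "unit_vec (d * d) 0 \<bullet>c (unit_vec (d * d) 0 :: complex vec) = 1"
    using assms by (simp add: scalar_prod_def unit_vec_def if_distrib if_distribR cong: if_cong)
  then show ?thesis unfolding coh_set_def by (auto intro!: exI[of _ "unit_vec (d * d) 0"])
qed

lemma eta_mult:
  assumes "0 \<le> x" "0 \<le> y"
  shows "eta (x * y) = x * eta y + y * eta x"
proof (cases "x = 0 \<or> y = 0")
  case False
  with assms have "0 < x" "0 < y" by auto
  then show ?thesis by (simp add: eta_def log_mult mult_le_0_iff algebra_simps)
qed (auto simp: eta_def)

lemma sum_eta_tensor:
  assumes "\<And>i. i \<in> I \<Longrightarrow> 0 \<le> p i" "\<And>j. j \<in> J \<Longrightarrow> 0 \<le> q j" "sum p I = 1" "sum q J = 1"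
  shows "(\<Sum>i\<in>I. \<Sum>j\<in>J. eta (p i * q j)) = (\<Sum>i\<in>I. eta (p i)) + (\<Sum>j\<in>J. eta (q j))"
proof -
  have "(\<Sum>i\<in>I. \<Sum>j\<in>J. eta (p i * q j)) = (\<Sum>i\<in>I. \<Sum>j\<in>J. p i * eta (q j) + eta (p i) * q j)"
    using assms by (intro sum.cong refl) (simp add: eta_mult mult.commute)
  also have "\<dots> = sum p I * (\<Sum>j\<in>J. eta (q j)) + (\<Sum>i\<in>I. eta (p i)) * sum q J"
    by (simp only: sum.distrib sum_product)
  finally show ?thesis using assms by simp
qed

lemma encode_div_mod:
  assumes "a < (D::nat)"
  shows "(r * D + a) div D = r" "(r * D + a) mod D = a"
  using assms by simp_all

text \<open>Superadditivity of the coherent information: on a product input the output and its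
  marginal are tensor products, and entropy is additive on those.\<close>

lemma coh_set_tensor:
  assumes rep1: "lin_rep d1 e1 \<Phi>1" and rep2: "lin_rep d2 e2 \<Phi>2" and rep: "lin_rep (d1 * d2) (e1 * e2) \<Phi>"
    and J: "\<And>x y. x \<in> {..<d1 * d2} \<times> {..<e1 * e2} \<Longrightarrow> y \<in> {..<d1 * d2} \<times> {..<e1 * e2} \<Longrightarrow>
       Jc (d1 * d2) \<Phi> x y = tns d2 e2 (Jc d1 \<Phi>1) (Jc d2 \<Phi>2) x y"
    and pos1: "pos ({..<d1} \<times> {..<e1}) (Jc d1 \<Phi>1)" and pos2: "pos ({..<d2} \<times> {..<e2}) (Jc d2 \<Phi>2)"
    and tp1: "\<And>a a'. a < d1 \<Longrightarrow> a' < d1 \<Longrightarrow> (\<Sum>b<e1. Jc d1 \<Phi>1 (a, b) (a', b)) = idm a a'"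
    and tp2: "\<And>a a'. a < d2 \<Longrightarrow> a' < d2 \<Longrightarrow> (\<Sum>b<e2. Jc d2 \<Phi>2 (a, b) (a', b)) = idm a a'"
    and x1: "x1 \<in> coh_set d1 e1 \<Phi>1" and x2: "x2 \<in> coh_set d2 e2 \<Phi>2"
  shows "x1 + x2 \<in> coh_set (d1 * d2) (e1 * e2) \<Phi>"
proof -
  let ?d = "d1 * d2" and ?e = "e1 * e2"
  obtain \<psi>1 where \<psi>1: "\<psi>1 \<in> carrier_vec (d1 * d1)" "\<psi>1 \<bullet>c \<psi>1 = 1"
    and x1: "x1 = entropy (\<Phi>1 (ptrace_first d1 d1 (proj \<psi>1))) - entropy (id_tensor d1 d1 e1 \<Phi>1 (proj \<psi>1))"
    using x1 by (auto simp: coh_set_def)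
  obtain \<psi>2 where \<psi>2: "\<psi>2 \<in> carrier_vec (d2 * d2)" "\<psi>2 \<bullet>c \<psi>2 = 1"
    and x2: "x2 = entropy (\<Phi>2 (ptrace_first d2 d2 (proj \<psi>2))) - entropy (id_tensor d2 d2 e2 \<Phi>2 (proj \<psi>2))"
    using x2 by (auto simp: coh_set_def)
  let ?o1 = "out {..<d1} (amp d1 \<psi>1) (Jc d1 \<Phi>1)" and ?o2 = "out {..<d2} (amp d2 \<psi>2) (Jc d2 \<Phi>2)"
  obtain p1 h1 q1 f1 where sp1: "spec ({..<d1} \<times> {..<e1}) ?o1 p1 h1"
    and sq1: "spec {..<e1} (\<lambda>b b'. \<Sum>r<d1. ?o1 (r, b) (r, b')) q1 f1"
    and p1: "\<And>x. x \<in> {..<d1} \<times> {..<e1} \<Longrightarrow> 0 \<le> p1 x" and q1: "\<And>b. b < e1 \<Longrightarrow> 0 \<le> q1 b"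
    by (rule out_specs[OF pos1, where k = d1 and \<psi> = "amp d1 \<psi>1"], rule that) auto
  obtain p2 h2 q2 f2 where sp2: "spec ({..<d2} \<times> {..<e2}) ?o2 p2 h2"
    and sq2: "spec {..<e2} (\<lambda>b b'. \<Sum>r<d2. ?o2 (r, b) (r, b')) q2 f2"
    and p2: "\<And>x. x \<in> {..<d2} \<times> {..<e2} \<Longrightarrow> 0 \<le> p2 x" and q2: "\<And>b. b < e2 \<Longrightarrow> 0 \<le> q2 b"
    by (rule out_specs[OF pos2, where k = d2 and \<psi> = "amp d2 \<psi>2"], rule that) auto
  have tr1: "(\<Sum>r<d1. \<Sum>b<e1. ?o1 (r, b) (r, b)) = 1"
    using \<psi>1(2) unfolding unit_vector_iff[OF \<psi>1(1)] by (intro trace_out) (auto simp: tp1)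
  have tr2: "(\<Sum>r<d2. \<Sum>b<e2. ?o2 (r, b) (r, b)) = 1"
    using \<psi>2(2) unfolding unit_vector_iff[OF \<psi>2(1)] by (intro trace_out) (auto simp: tp2)
  have sum_p: "sum p ({..<d} \<times> {..<e}) = 1" and sum_q: "sum q {..<e} = 1"
    if tr: "(\<Sum>r<d. \<Sum>b<e. o' (r, b) (r, b)) = (1::complex)" and sp: "spec ({..<d} \<times> {..<e}) o' p h"
      and sq: "spec {..<e} (\<lambda>b b'. \<Sum>r<d. o' (r, b) (r, b')) q f" for o' p h q f and d e :: nat
  proof -
    show "sum p ({..<d} \<times> {..<e}) = 1"
      using trace_spec[OF sp] tr unfolding sum_pair[of "\<lambda>i. o' i i"] by (metis of_real_eq_1_iff)
    have "(\<Sum>b<e. \<Sum>r<d. o' (r, b) (r, b)) = 1" using tr by (subst sum.swap)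
    then show "sum q {..<e} = 1"
      using trace_spec[OF sq] by (metis of_real_eq_1_iff)
  qed
  \<comment> \<open>Both the reference index and the input index are split into two digits, so the
    subsystems are ordered \<open>R1 R2 A1 A2\<close>. The plain Kronecker product of the two
    vectors would have the order \<open>R1 A1 R2 A2\<close>.\<close>
  define \<psi> where "\<psi> = vec (?d * ?d) (\<lambda>p. amp d1 \<psi>1 (p div ?d div d2) (p mod ?d div d2) * amp d2 \<psi>2 (p div ?d mod d2) (p mod ?d mod d2))"
  have \<psi>: "\<psi> \<in> carrier_vec (?d * ?d)" by (simp add: \<psi>_def)
  have amp: "amp ?d \<psi> r a = amp d1 \<psi>1 (r div d2) (a div d2) * amp d2 \<psi>2 (r mod d2) (a mod d2)" if "r < ?d" "a < ?d" for r a
    using encode_less[OF that] by (simp only: \<psi>_def index_vec encode_div_mod[OF that(2)])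
  have "(\<Sum>r<?d. \<Sum>a<?d. (cmod (amp ?d \<psi> r a))\<^sup>2) =
    (\<Sum>r<?d. \<Sum>a<?d. (cmod (amp d1 \<psi>1 (r div d2) (a div d2)))\<^sup>2 * (cmod (amp d2 \<psi>2 (r mod d2) (a mod d2)))\<^sup>2)"
    by (intro sum.cong refl) (simp only: amp lessThan_iff norm_mult power_mult_distrib)
  also have "\<dots> = (\<Sum>r<?d. (\<Sum>a<d1. (cmod (amp d1 \<psi>1 (r div d2) a))\<^sup>2) * (\<Sum>a<d2. (cmod (amp d2 \<psi>2 (r mod d2) a))\<^sup>2))"
    unfolding sum_product
    by (rule sum.cong[OF refl], rule sum_decode[where f = "\<lambda>a a'. (cmod (amp d1 \<psi>1 (_ div d2) a))\<^sup>2 * (cmod (amp d2 \<psi>2 (_ mod d2) a'))\<^sup>2"])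
  also have "\<dots> = (\<Sum>r<d1. \<Sum>a<d1. (cmod (amp d1 \<psi>1 r a))\<^sup>2) * (\<Sum>r<d2. \<Sum>a<d2. (cmod (amp d2 \<psi>2 r a))\<^sup>2)"
    unfolding sum_product[where f = "\<lambda>r. \<Sum>a<d1. (cmod (amp d1 \<psi>1 r a))\<^sup>2"]
    by (rule sum_decode[where f = "\<lambda>r r'. (\<Sum>a<d1. (cmod (amp d1 \<psi>1 r a))\<^sup>2) * (\<Sum>a<d2. (cmod (amp d2 \<psi>2 r' a))\<^sup>2)"])
  also have "\<dots> = 1" using \<psi>1(2) \<psi>2(2) unfolding unit_vector_iff[OF \<psi>1(1)] unit_vector_iff[OF \<psi>2(1)] by simp
  finally have \<psi>u: "\<psi> \<bullet>c \<psi> = 1" unfolding unit_vector_iff[OF \<psi>] .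
  have out: "out {..<?d} (amp ?d \<psi>) (Jc ?d \<Phi>) x y = tns d2 e2 ?o1 ?o2 x y"
    if x: "x \<in> {..<?d} \<times> {..<?e}" and y: "y \<in> {..<?d} \<times> {..<?e}" for x y
  proof -
    define F where "F a a' = amp d1 \<psi>1 (fst x div d2) a * Jc d1 \<Phi>1 (a, snd x div e2) (a', snd y div e2) * cnj (amp d1 \<psi>1 (fst y div d2) a')" for a a'
    define G where "G a a' = amp d2 \<psi>2 (fst x mod d2) a * Jc d2 \<Phi>2 (a, snd x mod e2) (a', snd y mod e2) * cnj (amp d2 \<psi>2 (fst y mod d2) a')" for a a'
    have "out {..<?d} (amp ?d \<psi>) (Jc ?d \<Phi>) x y = (\<Sum>a<?d. \<Sum>a'<?d. F (a div d2) (a' div d2) * G (a mod d2) (a' mod d2))"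
      unfolding out_def
    proof (intro sum.cong refl)
      fix a a' assume "a \<in> {..<?d}" "a' \<in> {..<?d}"
      then have a: "a < ?d" "a' < ?d" by auto
      have xy: "fst x < ?d" "fst y < ?d" using x y by auto
      have "Jc ?d \<Phi> (a, snd x) (a', snd y) = tns d2 e2 (Jc d1 \<Phi>1) (Jc d2 \<Phi>2) (a, snd x) (a', snd y)"
        using a x y by (intro J) auto
      then show "amp ?d \<psi> (fst x) a * Jc ?d \<Phi> (a, snd x) (a', snd y) * cnj (amp ?d \<psi> (fst y) a') =
        F (a div d2) (a' div d2) * G (a mod d2) (a' mod d2)"
        unfolding amp[OF xy(1) a(1)] amp[OF xy(2) a(2)] by (simp add: tns_def F_def G_def mult_ac)
    qed
    also have "\<dots> = (\<Sum>a<?d. \<Sum>i<d1. \<Sum>j<d2. F (a div d2) i * G (a mod d2) j)"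
      by (rule sum.cong[OF refl], rule sum_decode[where f = "\<lambda>i j. F (_ div d2) i * G (_ mod d2) j"])
    also have "\<dots> = (\<Sum>a<?d. (\<Sum>i<d1. F (a div d2) i) * (\<Sum>j<d2. G (a mod d2) j))"
      by (simp only: sum_product)
    also have "\<dots> = (\<Sum>a<d1. \<Sum>a'<d2. (\<Sum>i<d1. F a i) * (\<Sum>j<d2. G a' j))"
      by (rule sum_decode)
    also have "\<dots> = (\<Sum>a<d1. \<Sum>i<d1. F a i) * (\<Sum>a'<d2. \<Sum>j<d2. G a' j)"
      by (rule sum_product[symmetric])
    finally show ?thesis by (simp add: tns_def out_def F_def G_def)
  qed
  have "spec ({..<?d} \<times> {..<?e}) (out {..<?d} (amp ?d \<psi>) (Jc ?d \<Phi>))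
     (\<lambda>k. p1 (fst k div d2, snd k div e2) * p2 (fst k mod d2, snd k mod e2))
     (\<lambda>k i. h1 (fst k div d2, snd k div e2) (fst i div d2, snd i div e2) * h2 (fst k mod d2, snd k mod e2) (fst i mod d2, snd i mod e2))"
    (is "spec _ _ ?p ?h")
    using spec_reindex[OF bij_betw_decode2[of d2 e2 d1 e1] spec_tensor[OF _ _ sp1 sp2]]
    by (subst spec_cong[OF out]) (simp_all add: tns_def[abs_def])
  from entropy_id_tensor[OF rep \<psi> this]
  have E: "entropy (id_tensor ?d ?d ?e \<Phi> (proj \<psi>)) = (\<Sum>x\<in>{..<?d} \<times> {..<?e}. eta (?p x))" .
  also have "\<dots> = (\<Sum>z\<in>({..<d1} \<times> {..<e1}) \<times> ({..<d2} \<times> {..<e2}). eta (p1 (fst z) * p2 (snd z)))"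
    using sum.reindex_bij_betw[OF bij_betw_decode2[of d2 e2 d1 e1], of "\<lambda>z. eta (p1 (fst z) * p2 (snd z))"] by simp
  also have "\<dots> = (\<Sum>x\<in>{..<d1} \<times> {..<e1}. \<Sum>y\<in>{..<d2} \<times> {..<e2}. eta (p1 x * p2 y))"
    by (subst sum_pair) simp
  also have "\<dots> = (\<Sum>x\<in>{..<d1} \<times> {..<e1}. eta (p1 x)) + (\<Sum>x\<in>{..<d2} \<times> {..<e2}. eta (p2 x))"
    using p1 p2 sum_p[OF tr1 sp1 sq1] sum_p[OF tr2 sp2 sq2] by (rule sum_eta_tensor)
  finally have E1: "entropy (id_tensor ?d ?d ?e \<Phi> (proj \<psi>)) = entropy (id_tensor d1 d1 e1 \<Phi>1 (proj \<psi>1)) + entropy (id_tensor d2 d2 e2 \<Phi>2 (proj \<psi>2))"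
    by (simp add: entropy_id_tensor[OF rep1 \<psi>1(1) sp1] entropy_id_tensor[OF rep2 \<psi>2(1) sp2])
  have "spec {..<?e} (\<lambda>b b'. \<Sum>r<?d. out {..<?d} (amp ?d \<psi>) (Jc ?d \<Phi>) (r, b) (r, b'))
     (\<lambda>k. q1 (k div e2) * q2 (k mod e2)) (\<lambda>k i. f1 (k div e2) (i div e2) * f2 (k mod e2) (i mod e2))"
  proof (rule iffD1[OF spec_cong])
    show "spec {..<?e} (\<lambda>b b'. (\<Sum>r<d1. ?o1 (r, b div e2) (r, b' div e2)) * (\<Sum>r<d2. ?o2 (r, b mod e2) (r, b' mod e2)))
      (\<lambda>k. q1 (k div e2) * q2 (k mod e2)) (\<lambda>k i. f1 (k div e2) (i div e2) * f2 (k mod e2) (i mod e2))"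
      using spec_reindex[OF bij_betw_decode[of e2 e1] spec_tensor[OF _ _ sq1 sq2]] by simp
  next
    fix b b' assume b: "b \<in> {..<?e}" "b' \<in> {..<?e}"
    have "(\<Sum>r<?d. out {..<?d} (amp ?d \<psi>) (Jc ?d \<Phi>) (r, b) (r, b')) =
      (\<Sum>r<?d. ?o1 (r div d2, b div e2) (r div d2, b' div e2) * ?o2 (r mod d2, b mod e2) (r mod d2, b' mod e2))"
      using b by (intro sum.cong refl) (subst out, auto simp: tns_def)
    also have "\<dots> = (\<Sum>r<d1. \<Sum>r'<d2. ?o1 (r, b div e2) (r, b' div e2) * ?o2 (r', b mod e2) (r', b' mod e2))"
      by (rule sum_decode[where f = "\<lambda>r r'. ?o1 (r, b div e2) (r, b' div e2) * ?o2 (r', b mod e2) (r', b' mod e2)"])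
    finally show "(\<Sum>r<d1. ?o1 (r, b div e2) (r, b' div e2)) * (\<Sum>r<d2. ?o2 (r, b mod e2) (r, b' mod e2)) =
      (\<Sum>r<?d. out {..<?d} (amp ?d \<psi>) (Jc ?d \<Phi>) (r, b) (r, b'))"
      by (simp add: sum_product)
  qed
  from entropy_ptrace[OF rep \<psi> this]
  have "entropy (\<Phi> (ptrace_first ?d ?d (proj \<psi>))) = (\<Sum>b<?e. eta (q1 (b div e2) * q2 (b mod e2)))" .
  also have "\<dots> = (\<Sum>b<e1. \<Sum>b'<e2. eta (q1 b * q2 b'))"
    by (rule sum_decode[where f = "\<lambda>b b'. eta (q1 b * q2 b')"])
  also have "\<dots> = (\<Sum>b<e1. eta (q1 b)) + (\<Sum>b<e2. eta (q2 b))"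
    using q1 q2 sum_q[OF tr1 sp1 sq1] sum_q[OF tr2 sp2 sq2] by (intro sum_eta_tensor) auto
  finally have E2: "entropy (\<Phi> (ptrace_first ?d ?d (proj \<psi>))) = entropy (\<Phi>1 (ptrace_first d1 d1 (proj \<psi>1))) + entropy (\<Phi>2 (ptrace_first d2 d2 (proj \<psi>2)))"
    by (simp add: entropy_ptrace[OF rep1 \<psi>1(1) sq1] entropy_ptrace[OF rep2 \<psi>2(1) sq2])
  show ?thesis
    unfolding coh_set_def x1 x2 using \<psi> \<psi>u E1 E2 by (auto intro!: exI[of _ \<psi>])
qed

subsection \<open>Fekete's lemma\<close>

lemma superadditive_convergent:
  fixes a :: "nat \<Rightarrow> real" and C :: real
  assumes super: "\<And>m n. a m + a n \<le> a (m + n)" and ub: "\<And>n. a n \<le> C * n"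
  shows "convergent (\<lambda>n. a n / n)"
proof -
  \<comment> \<open>Index 0 is left out: division by zero would contribute the value 0, which may
    exceed the limit.\<close>
  define L where "L = (SUP n\<in>{1..}. a n / real n)"
  have le: "a n / n \<le> C" if "n \<ge> 1" for n
    using ub[of n] that by (simp add: divide_le_eq)
  then have bdd: "bdd_above ((\<lambda>n. a n / real n) ` {1..})" by (auto simp: bdd_above_def)
  have upper: "a n / n \<le> L" if "n \<ge> 1" for n
    unfolding L_def using that bdd by (intro cSUP_upper) auto
  have "(\<lambda>n. a n / n) \<longlonglongrightarrow> L"
  proof (rule LIMSEQ_I)
    fix \<epsilon> :: real assume \<epsilon>: "0 < \<epsilon>"
    have "\<exists>k\<ge>1. L - \<epsilon> / 2 < a k / k"
      using less_cSUP_iff[OF _ bdd, of "L - \<epsilon> / 2"] \<epsilon> by (auto simp: L_def)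
    then obtain k where k: "k \<ge> 1" "L - \<epsilon> / 2 < a k / k" by blast
    \<comment> \<open>The worst value over all remainders modulo \<open>k\<close>; together with the
      other constants in \<open>M\<close> it vanishes after division by \<open>n\<close>.\<close>
    define m where "m = Min (a ` {..<k})"
    have m: "m \<le> a r" if "r < k" for r unfolding m_def using that by (intro Min_le) auto
    define M where "M = \<bar>m\<bar> + \<bar>a k\<bar> + \<bar>a 0\<bar>"
    obtain N where N: "N > 0" "M / \<epsilon> * 2 < real N"
      by (metis gr0I less_numeral_extra(3) of_nat_0 order.strict_trans reals_Archimedean2 zero_less_Suc of_nat_less_iff)
    have "\<bar>a n / n - L\<bar> < \<epsilon>" if n: "n \<ge> N" for n
    proof -
      have n0: "n > 0" using n N by simp
      define q where "q = n div k"
      define r where "r = n mod k"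
      have n_eq: "n = q * k + r" by (simp add: q_def r_def)
      have r: "r < k" using k by (simp add: r_def)
      \<comment> \<open>The term \<open>\<bar>a 0\<bar>\<close> covers \<open>q = 0\<close>, where
        the multiple of \<open>k\<close> contributes \<open>a 0\<close> itself.\<close>
      have q: "q * a k - \<bar>a 0\<bar> \<le> a (q * k)"
      proof (induction q)
        case (Suc q)
        then show ?case using super[of k "q * k"] by (simp add: algebra_simps)
      qed simp
      have "q * a k - \<bar>a 0\<bar> + m \<le> a n"
        using q m[OF r] super[of "q * k" r] by (simp add: n_eq)
      moreover have "real n * (a k / k) - \<bar>a k\<bar> \<le> q * a k"
      proof -
        have "real n * (a k / k) = q * a k + r * (a k / k)"
          using k by (simp add: n_eq field_simps)
        moreover have "r * (a k / k) \<le> \<bar>a k\<bar>"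
        proof -
          have "r * (a k / k) \<le> r * (\<bar>a k\<bar> / k)" using k by (intro mult_left_mono divide_right_mono) auto
          also have "\<dots> \<le> k * (\<bar>a k\<bar> / k)" using r by (intro mult_right_mono) auto
          also have "\<dots> = \<bar>a k\<bar>" using k by simp
          finally show ?thesis .
        qed
        ultimately show ?thesis by simp
      qed
      ultimately have "real n * (a k / k) - M \<le> a n" by (simp add: M_def)
      then have "(real n * (a k / k) - M) / n \<le> a n / n" by (rule divide_right_mono) simp
      moreover have "(real n * (a k / k) - M) / n = a k / k - M / n" using n0 by (simp add: diff_divide_distrib)
      ultimately have "a k / k - M / n \<le> a n / n" by simp
      moreover have "M / n < \<epsilon> / 2"
      proof -
        have "M / \<epsilon> * 2 < real n" using N n by simp
        then show ?thesis using \<epsilon> n0 by (simp add: field_simps)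
      qed
      ultimately have "L - \<epsilon> < a n / n" using k(2) by simp
      with upper[of n] n0 \<epsilon> show ?thesis by (simp add: abs_less_iff)
    qed
    then show "\<exists>no. \<forall>n\<ge>no. norm (a n / n - L) < \<epsilon>" by auto
  qed
  then show ?thesis by (auto simp: convergent_def)
qed

subsection \<open>The converse for the quantum capacity\<close>

text \<open>The one-shot bound asks for a value strictly above the threshold
  \<open>\<mu> ^ n\<close>. Taking \<open>\<mu> ^ n * 2 powr \<epsilon>\<close> costs exactly
  \<epsilon> in the logarithm.\<close>

lemma coh_info_pow_le:
  assumes ch: "is_channel dA dB \<N>" and df: "dual_feasible {..<dA} {..<dB} \<mu> (Jc dA \<N>)" and \<mu>: "0 < \<mu>"
    and x: "x \<in> coh_set (dA ^ n) (dB ^ n) (chan_pow dA dB \<N> n)"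
  shows "x \<le> n * log 2 \<mu>"
proof (rule field_le_epsilon)
  fix \<epsilon> :: real assume \<epsilon>: "0 < \<epsilon>"
  have "x \<le> log 2 (\<mu> ^ n * 2 powr \<epsilon>)"
  proof (rule coh_set_le[OF chan_pow_lin_rep _ _ _ _ x])
    show "pos ({..<dA ^ n} \<times> {..<dB ^ n}) (Jpow dA dB \<N> n)" by (rule Jpow_pos[OF channel_pos[OF ch]])
    show "(\<Sum>b<dB ^ n. Jpow dA dB \<N> n (a, b) (a', b)) = idm a a'" if "a < dA ^ n" "a' < dA ^ n" for a a'
      by (rule Jpow_tp[OF channel_tp[OF ch] that])
    show "dual_feasible {..<dA ^ n} {..<dB ^ n} (\<mu> ^ n) (Jpow dA dB \<N> n)"
      using \<mu> by (intro Jpow_dual_feasible[OF channel_pos[OF ch] df]) simp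
    show "\<mu> ^ n < \<mu> ^ n * 2 powr \<epsilon>" using \<mu> \<epsilon> by simp
  qed
  also have "\<dots> = n * log 2 \<mu> + \<epsilon>" using \<mu> by (simp add: log_mult log_nat_power)
  finally show "x \<le> n * log 2 \<mu> + \<epsilon>" .
qed

text \<open>The dual pair guarantees bounded suprema and the existence of the limit, while the bound
  \<open>C\<close> is supplied separately. This serves both the general converse and channels of
  capacity zero.\<close>

lemma quantum_capacity_le:
  fixes C :: real
  assumes ch: "is_channel dA dB \<N>" and df: "dual_feasible {..<dA} {..<dB} \<mu> (Jc dA \<N>)" and \<mu>: "0 < \<mu>"
    and C: "\<And>n. n > 0 \<Longrightarrow> coh_info (dA ^ n) (dB ^ n) (chan_pow dA dB \<N> n) \<le> n * C"
  shows "quantum_capacity dA dB \<N> \<le> C"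
proof -
  define a where "a n = coh_info (dA ^ n) (dB ^ n) (chan_pow dA dB \<N> n)" for n
  let ?S = "\<lambda>n. coh_set (dA ^ n) (dB ^ n) (chan_pow dA dB \<N> n)"
  have ne: "?S n \<noteq> {}" for n using ch by (intro coh_set_nonempty) (simp add: is_channel_def)
  have bdd: "bdd_above (?S n)" for n using coh_info_pow_le[OF ch df \<mu>] by (auto simp: bdd_above_def)
  have ub: "a n \<le> log 2 \<mu> * n" for n
    unfolding a_def coh_info_Sup using coh_info_pow_le[OF ch df \<mu>] ne by (intro cSup_least) (auto simp: mult.commute)
  have "a m + a n \<le> a (m + n)" for m n
  proof -
    have *: "x + y \<le> a (m + n)" if "x \<in> ?S m" "y \<in> ?S n" for x y
    proof -
      have "x + y \<in> coh_set (dA ^ m * dA ^ n) (dB ^ m * dB ^ n) (chan_pow dA dB \<N> (m + n))"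
      proof (rule coh_set_tensor[OF _ _ _ _ _ _ _ _ that])
        show "lin_rep (dA ^ m) (dB ^ m) (chan_pow dA dB \<N> m)" "lin_rep (dA ^ n) (dB ^ n) (chan_pow dA dB \<N> n)"
          by (rule chan_pow_lin_rep)+
        show "lin_rep (dA ^ m * dA ^ n) (dB ^ m * dB ^ n) (chan_pow dA dB \<N> (m + n))"
          using chan_pow_lin_rep[of dA "m + n" dB \<N>] by (simp add: power_add)
        show "Jc (dA ^ m * dA ^ n) (chan_pow dA dB \<N> (m + n)) x y = tns (dA ^ n) (dB ^ n) (Jpow dA dB \<N> m) (Jpow dA dB \<N> n) x y"
          if "x \<in> {..<dA ^ m * dA ^ n} \<times> {..<dB ^ m * dB ^ n}" "y \<in> {..<dA ^ m * dA ^ n} \<times> {..<dB ^ m * dB ^ n}" for x y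
          using Jpow_add[of x dA m n dB y \<N>] that by (simp add: power_add)
        show "pos ({..<dA ^ m} \<times> {..<dB ^ m}) (Jpow dA dB \<N> m)" "pos ({..<dA ^ n} \<times> {..<dB ^ n}) (Jpow dA dB \<N> n)"
          by (rule Jpow_pos[OF channel_pos[OF ch]])+
      qed (rule Jpow_tp[OF channel_tp[OF ch]]; assumption)+
      then show ?thesis unfolding a_def coh_info_Sup power_add by (rule cSup_upper) (use bdd[of "m + n"] in \<open>simp add: power_add\<close>)
    qed
    \<comment> \<open>The supremum of the sums is taken in one variable at a time.\<close>
    have "a m \<le> a (m + n) - y" if "y \<in> ?S n" for y
      unfolding a_def[of m] coh_info_Sup using *[OF _ that] ne by (intro cSup_least) (auto simp: le_diff_eq)
    then have "y \<le> a (m + n) - a m" if "y \<in> ?S n" for y using that by (simp add: algebra_simps)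
    then have "a n \<le> a (m + n) - a m"
      unfolding a_def[of n] coh_info_Sup using ne by (intro cSup_least) auto
    then show ?thesis by simp
  qed
  from superadditive_convergent[OF this ub] have "(\<lambda>n. a n / n) \<longlonglongrightarrow> quantum_capacity dA dB \<N>"
    unfolding quantum_capacity_def a_def by (simp add: convergent_LIMSEQ_iff)
  then show ?thesis
  proof (rule LIMSEQ_le_const2)
    show "\<exists>N. \<forall>n\<ge>N. a n / n \<le> C"
      using C by (intro exI[of _ 1]) (auto simp: a_def divide_le_eq mult.commute)
  qed
qed

section \<open>The semidefinite program for \<open>\<Gamma>\<close>\<close>

definition matX :: "nat \<Rightarrow> nat \<Rightarrow> (nat \<times> nat \<Rightarrow> nat \<times> nat \<Rightarrow> complex) \<Rightarrow> complex mat" where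
  "matX k e F = mat (k * e) (k * e) (\<lambda>(p, q). F (p div e, p mod e) (q div e, q mod e))"

lemma matX_carrier [simp]: "matX k e F \<in> carrier_mat (k * e) (k * e)"
  by (simp add: matX_def)

lemma psd_matX: "psd (k * e) (matX k e F) \<longleftrightarrow> pos ({..<k} \<times> {..<e}) F"
proof -
  have "pos {..<k * e} (ent (matX k e F)) \<longleftrightarrow> pos {..<k * e} (\<lambda>p q. F (p div e, p mod e) (q div e, q mod e))"
    by (rule pos_cong) (simp add: matX_def)
  also have "\<dots> \<longleftrightarrow> pos ({..<k} \<times> {..<e}) F"
  proof
    assume p: "pos {..<k * e} (\<lambda>p q. F (p div e, p mod e) (q div e, q mod e))"
    have "pos ({..<k} \<times> {..<e}) (\<lambda>x y. (\<lambda>p q. F (p div e, p mod e) (q div e, q mod e)) (fst x * e + snd x) (fst y * e + snd y))"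
      by (rule pos_reindex[OF _ _ p]) (auto simp: encode_less)
    then show "pos ({..<k} \<times> {..<e}) F"
      by (rule iffD1[OF pos_cong, rotated]) auto
  next
    assume p: "pos ({..<k} \<times> {..<e}) F"
    show "pos {..<k * e} (\<lambda>p q. F (p div e, p mod e) (q div e, q mod e))"
      by (rule pos_reindex[OF _ _ p]) (auto simp: decode_less)
  qed
  finally show ?thesis by (simp add: psd_iff_pos)
qed

lemma matX_exists:
  assumes "M \<in> carrier_mat (k * e) (k * e)"
  shows "\<exists>F. M = matX k e F"
proof
  show "M = matX k e (\<lambda>x y. M $$ (fst x * e + snd x, fst y * e + snd y))"
    using assms by (intro eq_matI) (auto simp: matX_def)
qed

lemma psd_mat: "psd d (mat d d (\<lambda>(i, j). f i j)) \<longleftrightarrow> pos {..<d} f"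
  unfolding psd_iff_pos using pos_cong[of "{..<d}" "ent (mat d d (\<lambda>(i, j). f i j))" f] by simp

lemma rp_matX: "Re (\<Sum>p<k * e. \<Sum>q<k * e. matX k e F $$ (p, q) * matX k e G $$ (q, p)) = rp ({..<k} \<times> {..<e}) F G"
proof -
  have "(\<Sum>p<k * e. \<Sum>q<k * e. matX k e F $$ (p, q) * matX k e G $$ (q, p)) =
    (\<Sum>p<k * e. \<Sum>q<k * e. F (p div e, p mod e) (q div e, q mod e) * G (q div e, q mod e) (p div e, p mod e))"
    by (intro sum.cong refl) (simp add: matX_def)
  also have "\<dots> = (\<Sum>p<k * e. \<Sum>r<k. \<Sum>b<e. F (p div e, p mod e) (r, b) * G (r, b) (p div e, p mod e))"
    by (intro sum.cong[OF refl], rule sum_decode)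
  also have "\<dots> = (\<Sum>r'<k. \<Sum>b'<e. \<Sum>r<k. \<Sum>b<e. F (r', b') (r, b) * G (r, b) (r', b'))"
    by (rule sum_decode)
  finally show ?thesis unfolding rp_def sum_pair by simp
qed

lemma choi_matX: "choi dA dB \<N> = matX dA dB (Jc dA \<N>)"
  by (intro eq_matI) (auto simp: choi_def matX_def Jc_def)

lemma kron_ptrans:
  assumes "0 < e"
  shows "kron (mat k k (\<lambda>(i, j). f i j)) (1\<^sub>m e) - ptrans_B k e (matX k e F) =
      matX k e (\<lambda>x y. f (fst x) (fst y) * idm (snd x) (snd y) - ptB F x y)"
    "ptrans_B k e (matX k e F) + kron (mat k k (\<lambda>(i, j). f i j)) (1\<^sub>m e) =
      matX k e (\<lambda>x y. f (fst x) (fst y) * idm (snd x) (snd y) + ptB F x y)"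
  using assms by (auto intro!: eq_matI simp: kron_def ptrans_B_def matX_def ptB_def idm_def decode_less encode_less encode_div_mod)

lemma Gamma_Sup:
  assumes "0 < dB"
  shows "Gamma dA dB \<N> = Sup {rp ({..<dA} \<times> {..<dB}) (Jc dA \<N>) R | R \<rho>. primal_feasible {..<dA} {..<dB} R \<rho>}"
proof -
  have val: "Re (mtrace (choi dA dB \<N> * matX dA dB F)) = rp ({..<dA} \<times> {..<dB}) (Jc dA \<N>) F" for F
  proof -
    have "mtrace (choi dA dB \<N> * matX dA dB F) = (\<Sum>p<dA * dB. \<Sum>q<dA * dB. matX dA dB (Jc dA \<N>) $$ (p, q) * matX dA dB F $$ (q, p))"
      unfolding mtrace_def choi_matX
      by (intro sum.cong) (auto simp: mult_mat_index[of _ "dA * dB" "dA * dB" _ "dA * dB"] matX_def[of _ _ "Jc dA \<N>"])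
    then show ?thesis by (simp only: rp_matX)
  qed
  have feas: "psd (dA * dB) (matX dA dB F) \<and> psd dA (mat dA dA (\<lambda>(i, j). f i j)) \<and> mtrace (mat dA dA (\<lambda>(i, j). f i j)) = 1 \<and>
      psd (dA * dB) (kron (mat dA dA (\<lambda>(i, j). f i j)) (1\<^sub>m dB) - ptrans_B dA dB (matX dA dB F)) \<and>
      psd (dA * dB) (ptrans_B dA dB (matX dA dB F) + kron (mat dA dA (\<lambda>(i, j). f i j)) (1\<^sub>m dB)) \<longleftrightarrow>
      primal_feasible {..<dA} {..<dB} F f" for F f
    unfolding kron_ptrans[OF assms] psd_matX psd_mat primal_feasible_def by (simp add: mtrace_def)
  have "{Re (mtrace (choi dA dB \<N> * R)) | R \<rho>.
      psd (dA * dB) R \<and> psd dA \<rho> \<and> mtrace \<rho> = 1 \<and>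
      psd (dA * dB) (kron \<rho> (1\<^sub>m dB) - ptrans_B dA dB R) \<and>
      psd (dA * dB) (ptrans_B dA dB R + kron \<rho> (1\<^sub>m dB))} =
    {rp ({..<dA} \<times> {..<dB}) (Jc dA \<N>) R | R \<rho>. primal_feasible {..<dA} {..<dB} R \<rho>}" (is "?L = ?R")
  proof (intro equalityI subsetI)
    fix x assume "x \<in> ?L"
    then obtain R \<rho> where x: "x = Re (mtrace (choi dA dB \<N> * R))"
      and c: "psd (dA * dB) R \<and> psd dA \<rho> \<and> mtrace \<rho> = 1 \<and>
        psd (dA * dB) (kron \<rho> (1\<^sub>m dB) - ptrans_B dA dB R) \<and> psd (dA * dB) (ptrans_B dA dB R + kron \<rho> (1\<^sub>m dB))" by blast
    have "R \<in> carrier_mat (dA * dB) (dA * dB)" using c by (simp add: psd_def)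
    then obtain F where F: "R = matX dA dB F" using matX_exists by blast
    have "\<rho> \<in> carrier_mat dA dA" using c by (simp add: psd_def)
    then have f: "\<rho> = mat dA dA (\<lambda>(i, j). ent \<rho> i j)" by (intro eq_matI) auto
    have "primal_feasible {..<dA} {..<dB} F (ent \<rho>)"
      using c unfolding F feas[symmetric] f[symmetric] .
    then show "x \<in> ?R" unfolding x F val by blast
  next
    fix x assume "x \<in> ?R"
    then obtain F f where x: "x = rp ({..<dA} \<times> {..<dB}) (Jc dA \<N>) F" and pf: "primal_feasible {..<dA} {..<dB} F f" by blast
    show "x \<in> ?L" unfolding x val[symmetric] using pf[unfolded feas[symmetric]] by blast
  qed
  then show ?thesis by (simp add: Gamma_def)
qed

section \<open>The completely bounded norm\<close>

text \<open>Bessel's inequality for orthogonal vectors of length at most 1, zero vectors included,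
  since normalised images of a basis vanish at singular value 0. The squared distance of
  \<open>z\<close> from \<open>\<Sum>j\<in>J. \<alpha> j * u j\<close> is nonnegative.\<close>

lemma bessel:
  assumes fin: "finite J" and orth: "\<And>j l. j \<in> J \<Longrightarrow> l \<in> J \<Longrightarrow> ip I (u j) (u l) = of_real (c j) * idm j l"
    and c: "\<And>j. j \<in> J \<Longrightarrow> c j \<le> 1"
  shows "(\<Sum>j\<in>J. (cmod (ip I (u j) z))\<^sup>2) \<le> (\<Sum>i\<in>I. (cmod (z i))\<^sup>2)"
proof -
  define \<alpha> where "\<alpha> j = ip I (u j) z" for j
  define y where "y i = (\<Sum>j\<in>J. \<alpha> j * u j i)" for i
  have ip_y: "ip I v y = (\<Sum>j\<in>J. \<alpha> j * ip I v (u j))" for v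
    unfolding y_def ip_def sum_distrib_left by (subst sum.swap) (simp add: mult_ac)
  have zy: "ip I z y = of_real (\<Sum>j\<in>J. (cmod (\<alpha> j))\<^sup>2)"
  proof -
    have "ip I z y = (\<Sum>j\<in>J. \<alpha> j * cnj (\<alpha> j))" unfolding ip_y \<alpha>_def cnj_ip ..
    then show ?thesis by (simp only: of_real_sum complex_norm_square)
  qed
  have uy: "ip I (u j) y = of_real (c j) * \<alpha> j" if "j \<in> J" for j
  proof -
    have "ip I (u j) y = (\<Sum>l\<in>J. (of_real (c j) * \<alpha> l) * idm j l)"
      unfolding ip_y using that by (intro sum.cong refl) (simp add: orth mult_ac)
    then show ?thesis by (simp only: idm_sum[OF fin that])
  qed
  have yy: "ip I y y = of_real (\<Sum>j\<in>J. c j * (cmod (\<alpha> j))\<^sup>2)"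
  proof -
    have "ip I y y = (\<Sum>j\<in>J. \<alpha> j * cnj (ip I (u j) y))" unfolding ip_y[of y] cnj_ip ..
    also have "\<dots> = (\<Sum>j\<in>J. of_real (c j) * (\<alpha> j * cnj (\<alpha> j)))"
      by (intro sum.cong refl) (simp add: uy)
    finally show ?thesis by (simp only: of_real_sum of_real_mult complex_norm_square)
  qed
  have "ip I (\<lambda>i. z i - y i) (\<lambda>i. z i - y i) = ip I z z - ip I z y - cnj (ip I z y) + ip I y y"
    unfolding cnj_ip ip_def by (simp add: algebra_simps sum.distrib sum_subtractf)
  then have "complex_of_real (\<Sum>i\<in>I. (cmod (z i - y i))\<^sup>2) = of_real ((\<Sum>i\<in>I. (cmod (z i))\<^sup>2) - 2 * (\<Sum>j\<in>J. (cmod (\<alpha> j))\<^sup>2) + (\<Sum>j\<in>J. c j * (cmod (\<alpha> j))\<^sup>2))"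
    unfolding zy yy unfolding ip_self by simp
  then have "(\<Sum>i\<in>I. (cmod (z i - y i))\<^sup>2) = (\<Sum>i\<in>I. (cmod (z i))\<^sup>2) - 2 * (\<Sum>j\<in>J. (cmod (\<alpha> j))\<^sup>2) + (\<Sum>j\<in>J. c j * (cmod (\<alpha> j))\<^sup>2)"
    by (simp only: of_real_eq_iff)
  moreover have "0 \<le> (\<Sum>i\<in>I. (cmod (z i - y i))\<^sup>2)" by (simp add: sum_nonneg)
  moreover have "(\<Sum>j\<in>J. c j * (cmod (\<alpha> j))\<^sup>2) \<le> (\<Sum>j\<in>J. 1 * (cmod (\<alpha> j))\<^sup>2)"
    using c by (intro sum_mono mult_right_mono) auto
  ultimately show ?thesis by (simp add: \<alpha>_def)
qed

text \<open>Cauchy-Schwarz with upper bounds in place of the norms, from the weighted mean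
  inequality with weights \<open>W / Z\<close> and \<open>Z / W\<close>; vanishing bounds are
  treated apart.\<close>

lemma sum_mult_le:
  fixes A B :: "'j \<Rightarrow> real"
  assumes fin: "finite J" and A: "(\<Sum>j\<in>J. (A j)\<^sup>2) \<le> Z\<^sup>2" and B: "(\<Sum>j\<in>J. (B j)\<^sup>2) \<le> W\<^sup>2" and ZW: "0 \<le> Z" "0 \<le> W"
  shows "(\<Sum>j\<in>J. A j * B j) \<le> Z * W"
proof (cases "Z = 0 \<or> W = 0")
  case True
  then have "(\<Sum>j\<in>J. (A j)\<^sup>2) \<le> 0 \<or> (\<Sum>j\<in>J. (B j)\<^sup>2) \<le> 0" using A B by auto
  then have "(\<forall>j\<in>J. A j = 0) \<or> (\<forall>j\<in>J. B j = 0)"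
    using fin sum_nonneg_eq_0_iff[of J "\<lambda>j. (A j)\<^sup>2"] sum_nonneg_eq_0_iff[of J "\<lambda>j. (B j)\<^sup>2"]
    by (auto simp: antisym sum_nonneg)
  then have "(\<Sum>j\<in>J. A j * B j) = 0" by (auto intro!: sum.neutral)
  then show ?thesis using ZW by simp
next
  case False
  with ZW have Z: "Z > 0" and W: "W > 0" by auto
  have "A j * B j \<le> ((A j)\<^sup>2 * (W / Z) + (B j)\<^sup>2 * (Z / W)) / 2" for j
  proof -
    have "0 \<le> (A j * W - B j * Z)\<^sup>2" by simp
    then have "2 * (A j * B j) * (Z * W) \<le> (A j)\<^sup>2 * W\<^sup>2 + (B j)\<^sup>2 * Z\<^sup>2"
      by (simp add: power2_eq_square algebra_simps)
    then have "2 * (A j * B j) \<le> ((A j)\<^sup>2 * W\<^sup>2 + (B j)\<^sup>2 * Z\<^sup>2) / (Z * W)"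
      using Z W by (simp add: pos_le_divide_eq)
    also have "\<dots> = (A j)\<^sup>2 * (W / Z) + (B j)\<^sup>2 * (Z / W)"
      using Z W by (simp add: power2_eq_square add_divide_distrib)
    finally show ?thesis by simp
  qed
  then have "(\<Sum>j\<in>J. A j * B j) \<le> (\<Sum>j\<in>J. ((A j)\<^sup>2 * (W / Z) + (B j)\<^sup>2 * (Z / W)) / 2)"
    by (rule sum_mono)
  also have "\<dots> = ((\<Sum>j\<in>J. (A j)\<^sup>2) * (W / Z) + (\<Sum>j\<in>J. (B j)\<^sup>2) * (Z / W)) / 2"
    by (simp add: sum.distrib sum_distrib_right flip: sum_divide_distrib)
  also have "\<dots> \<le> (Z\<^sup>2 * (W / Z) + W\<^sup>2 * (Z / W)) / 2"
    using A B Z W by (intro divide_right_mono add_mono mult_right_mono) auto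
  also have "\<dots> = Z * W" using Z W by (simp add: power2_eq_square)
  finally show ?thesis .
qed

text \<open>The triangle inequality for rank-one terms. Each singular value is
  \<open>ip (u j) (Y (v j))\<close> for a pair of singular vectors; for a fixed term, Cauchy-Schwarz
  over \<open>j\<close> combines Bessel for \<open>u\<close> with Parseval for
  \<open>v\<close>.\<close>

lemma trace_norm_sum_le:
  assumes Y: "Y \<in> carrier_mat n n" and T: "finite T"
    and dec: "\<And>p q. p < n \<Longrightarrow> q < n \<Longrightarrow> Y $$ (p, q) = (\<Sum>\<tau>\<in>T. c \<tau> * z \<tau> p * cnj (w \<tau> q))"
    and z: "\<And>\<tau>. \<tau> \<in> T \<Longrightarrow> (\<Sum>p<n. (cmod (z \<tau> p))\<^sup>2) \<le> (Z \<tau>)\<^sup>2 \<and> 0 \<le> Z \<tau>"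
    and w: "\<And>\<tau>. \<tau> \<in> T \<Longrightarrow> (\<Sum>p<n. (cmod (w \<tau> p))\<^sup>2) \<le> (W \<tau>)\<^sup>2 \<and> 0 \<le> W \<tau>"
  shows "trace_norm Y \<le> (\<Sum>\<tau>\<in>T. cmod (c \<tau>) * (Z \<tau> * W \<tau>))"
proof -
  obtain v s where v: "onb {..<n} v" and tn: "trace_norm Y = (\<Sum>k<n. s k)" and s0: "\<And>k. 0 \<le> s k"
    and orth: "\<And>k l. k < n \<Longrightarrow> l < n \<Longrightarrow>
       ip {..<n} (app {..<n} (ent Y) (v k)) (app {..<n} (ent Y) (v l)) = of_real ((s k)\<^sup>2) * idm k l"
    by (rule trace_norm_singular[OF Y], rule that) auto
  \<comment> \<open>The left singular vector, with the zero vector at singular value 0.\<close>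
  define u where "u j i = app {..<n} (ent Y) (v j) i * of_real (if s j = 0 then 0 else 1 / s j)" for j i
  have uu: "ip {..<n} (u j) (u l) = of_real (if s j = 0 then 0 else 1) * idm j l" if "j < n" "l < n" for j l
  proof -
    have "ip {..<n} (u j) (u l) = of_real ((if s j = 0 then 0 else 1 / s j) * (if s l = 0 then 0 else 1 / s l)) *
       ip {..<n} (app {..<n} (ent Y) (v j)) (app {..<n} (ent Y) (v l))"
      unfolding u_def ip_def sum_distrib_left by (intro sum.cong refl) (simp add: mult_ac)
    then show ?thesis unfolding orth[OF that] by (auto simp: idm_def power2_eq_square)
  qed
  have sj: "s j \<le> (\<Sum>\<tau>\<in>T. cmod (c \<tau>) * (cmod (ip {..<n} (u j) (z \<tau>)) * cmod (ip {..<n} (v j) (w \<tau>))))" if j: "j < n" for j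
  proof (cases "s j = 0")
    case True
    then show ?thesis by (simp add: sum_nonneg)
  next
    case False
    have "ip {..<n} (u j) (app {..<n} (ent Y) (v j)) = of_real (1 / s j) * ip {..<n} (app {..<n} (ent Y) (v j)) (app {..<n} (ent Y) (v j))"
      unfolding ip_def sum_distrib_left using False by (intro sum.cong refl) (simp add: u_def)
    also have "\<dots> = of_real (s j)" unfolding orth[OF j j] using False by (simp add: idm_def power2_eq_square)
    finally have "of_real (s j) = ip {..<n} (u j) (app {..<n} (ent Y) (v j))" ..
    also have "\<dots> = (\<Sum>p<n. \<Sum>q<n. \<Sum>\<tau>\<in>T. c \<tau> * (cnj (u j p) * z \<tau> p) * (cnj (w \<tau> q) * v j q))"
      unfolding ip_def app_def sum_distrib_left
      by (intro sum.cong refl) (simp add: dec sum_distrib_left sum_distrib_right mult_ac)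
    also have "\<dots> = (\<Sum>\<tau>\<in>T. \<Sum>p<n. \<Sum>q<n. c \<tau> * (cnj (u j p) * z \<tau> p) * (cnj (w \<tau> q) * v j q))"
      by (rule sum_rotate_out)
    also have "\<dots> = (\<Sum>\<tau>\<in>T. c \<tau> * ip {..<n} (u j) (z \<tau>) * ip {..<n} (w \<tau>) (v j))"
      unfolding ip_def sum_sandwich ..
    finally have "s j = cmod (\<Sum>\<tau>\<in>T. c \<tau> * ip {..<n} (u j) (z \<tau>) * ip {..<n} (w \<tau>) (v j))"
      using s0[of j] by (metis norm_of_real abs_of_nonneg)
    also have "\<dots> \<le> (\<Sum>\<tau>\<in>T. cmod (c \<tau>) * (cmod (ip {..<n} (u j) (z \<tau>)) * cmod (ip {..<n} (v j) (w \<tau>))))"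
    proof (rule sum_norm_le)
      fix \<tau>
      have "cmod (ip {..<n} (w \<tau>) (v j)) = cmod (ip {..<n} (v j) (w \<tau>))" by (metis cnj_ip complex_mod_cnj)
      then show "cmod (c \<tau> * ip {..<n} (u j) (z \<tau>) * ip {..<n} (w \<tau>) (v j)) \<le> cmod (c \<tau>) * (cmod (ip {..<n} (u j) (z \<tau>)) * cmod (ip {..<n} (v j) (w \<tau>)))"
        by (simp add: norm_mult)
    qed
    finally show ?thesis .
  qed
  have "trace_norm Y \<le> (\<Sum>j<n. \<Sum>\<tau>\<in>T. cmod (c \<tau>) * (cmod (ip {..<n} (u j) (z \<tau>)) * cmod (ip {..<n} (v j) (w \<tau>))))"
    unfolding tn using sj by (intro sum_mono) auto
  also have "\<dots> = (\<Sum>\<tau>\<in>T. cmod (c \<tau>) * (\<Sum>j<n. cmod (ip {..<n} (u j) (z \<tau>)) * cmod (ip {..<n} (v j) (w \<tau>))))"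
    unfolding sum_distrib_left by (rule sum.swap)
  also have "\<dots> \<le> (\<Sum>\<tau>\<in>T. cmod (c \<tau>) * (Z \<tau> * W \<tau>))"
  proof (intro sum_mono mult_left_mono sum_mult_le)
    fix \<tau> assume \<tau>: "\<tau> \<in> T"
    have "(\<Sum>j<n. (cmod (ip {..<n} (u j) (z \<tau>)))\<^sup>2) \<le> (\<Sum>p<n. (cmod (z \<tau> p))\<^sup>2)"
      by (rule bessel[where c = "\<lambda>j. if s j = 0 then 0 else 1"]) (use uu in auto)
    also have "\<dots> \<le> (Z \<tau>)\<^sup>2" using z[OF \<tau>] by simp
    finally show "(\<Sum>j<n. (cmod (ip {..<n} (u j) (z \<tau>)))\<^sup>2) \<le> (Z \<tau>)\<^sup>2" .
    show "(\<Sum>j<n. (cmod (ip {..<n} (v j) (w \<tau>)))\<^sup>2) \<le> (W \<tau>)\<^sup>2"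
      using w[OF \<tau>] parseval[OF _ v, of "w \<tau>"] by simp
  qed (use z w in auto)
  finally show ?thesis .
qed

text \<open>A crude bound whose merit is its independence of \<open>k\<close>: it makes the supremum
  in \<open>cb_norm\<close> finite. The singular value decomposition of \<open>X\<close> and the
  expansion of the map into matrix units leave rank-one terms only.\<close>

lemma trace_norm_id_tensor_le:
  assumes rep: "lin_rep d e \<Phi>" and X: "X \<in> carrier_mat (k * d) (k * d)" and X1: "trace_norm X \<le> 1"
  shows "trace_norm (id_tensor k d e \<Phi> X) \<le> (\<Sum>x\<in>{..<d} \<times> {..<e}. \<Sum>y\<in>{..<d} \<times> {..<e}. cmod (Jc d \<Phi> x y))"
proof -
  obtain y t where y: "onb {..<k * d} y" and tn: "trace_norm X = (\<Sum>m<k * d. t m)" and t0: "\<And>m. 0 \<le> t m"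
    and orth: "\<And>m l. m < k * d \<Longrightarrow> l < k * d \<Longrightarrow>
       ip {..<k * d} (app {..<k * d} (ent X) (y m)) (app {..<k * d} (ent X) (y l)) = of_real ((t m)\<^sup>2) * idm m l"
    by (rule trace_norm_singular[OF X], rule that) auto
  define Xy where "Xy m = app {..<k * d} (ent X) (y m)" for m
  have Xdec: "X $$ (i, j) = (\<Sum>m<k * d. Xy m i * cnj (y m j))" if "i < k * d" "j < k * d" for i j
  proof -
    have "(\<Sum>m<k * d. Xy m i * cnj (y m j)) = (\<Sum>m<k * d. \<Sum>l<k * d. X $$ (i, l) * (y m l * cnj (y m j)))"
      unfolding Xy_def app_def sum_distrib_right by (simp add: mult.assoc)
    also have "\<dots> = (\<Sum>l<k * d. X $$ (i, l) * (\<Sum>m<k * d. y m l * cnj (y m j)))"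
      unfolding sum_distrib_left by (rule sum.swap)
    also have "\<dots> = (\<Sum>l<k * d. X $$ (i, l) * idm l j)"
      using y that by (intro sum.cong refl) (simp add: onb_def)
    also have "\<dots> = X $$ (i, j)" using that by simp
    finally show ?thesis ..
  qed
  have Xyn: "(\<Sum>i<k * d. (cmod (Xy m i))\<^sup>2) = (t m)\<^sup>2" if "m < k * d" for m
    using orth[OF that that] unfolding Xy_def[symmetric] ip_self by (simp add: idm_def flip: of_real_power of_real_sum)
  let ?D = "{..<d} \<times> {..<e}"
  \<comment> \<open>For \<open>x = (a, b)\<close> this is the vector
    \<open>(1 \<otimes> |b\<rangle>\<langle>a|) g\<close>, a contraction of
    \<open>g\<close>.\<close>
  define emb where "emb g x p = (if p mod e = snd x then g ((p div e) * d + fst x) else 0 :: complex)" for g :: "nat \<Rightarrow> complex" and x p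
  have embn: "(\<Sum>p<k * e. (cmod (emb g x p))\<^sup>2) \<le> (\<Sum>i<k * d. (cmod (g i))\<^sup>2)" if x: "x \<in> ?D" for g x
  proof -
    have "(\<Sum>p<k * e. (cmod (emb g x p))\<^sup>2) = (\<Sum>r<k. \<Sum>b<e. if b = snd x then (cmod (g (r * d + fst x)))\<^sup>2 else 0)"
      unfolding sum_decode[where f = "\<lambda>r b. if b = snd x then (cmod (g (r * d + fst x)))\<^sup>2 else 0", symmetric]
      by (intro sum.cong refl) (simp add: emb_def)
    also have "\<dots> = (\<Sum>r<k. (cmod (g (r * d + fst x)))\<^sup>2)"
      using x by (intro sum.cong refl) auto
    also have "\<dots> \<le> (\<Sum>r<k. \<Sum>a<d. (cmod (g (r * d + a)))\<^sup>2)"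
      using x by (intro sum_mono member_le_sum[where f = "\<lambda>a. (cmod (g (_ * d + a)))\<^sup>2"]) auto
    also have "\<dots> = (\<Sum>i<k * d. (cmod (g i))\<^sup>2)" by (rule sum_encode[symmetric])
    finally show ?thesis .
  qed
  define T where "T = {..<k * d} \<times> (?D \<times> ?D)"
  have "trace_norm (id_tensor k d e \<Phi> X) \<le> (\<Sum>\<tau>\<in>T. cmod (Jc d \<Phi> (fst (snd \<tau>)) (snd (snd \<tau>))) * (t (fst \<tau>) * 1))"
  proof (rule trace_norm_sum_le[where z = "\<lambda>\<tau>. emb (Xy (fst \<tau>)) (fst (snd \<tau>))" and w = "\<lambda>\<tau>. emb (y (fst \<tau>)) (snd (snd \<tau>))"])
    show "id_tensor k d e \<Phi> X \<in> carrier_mat (k * e) (k * e)" by (rule id_tensor_carrier)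
    show "finite T" by (simp add: T_def)
    show "(\<Sum>p<k * e. (cmod (emb (Xy (fst \<tau>)) (fst (snd \<tau>)) p))\<^sup>2) \<le> (t (fst \<tau>))\<^sup>2 \<and> 0 \<le> t (fst \<tau>)" if "\<tau> \<in> T" for \<tau>
      using that embn[of "fst (snd \<tau>)" "Xy (fst \<tau>)"] Xyn[of "fst \<tau>"] t0 by (auto simp: T_def)
    show "(\<Sum>p<k * e. (cmod (emb (y (fst \<tau>)) (snd (snd \<tau>)) p))\<^sup>2) \<le> 1\<^sup>2 \<and> 0 \<le> (1::real)" if "\<tau> \<in> T" for \<tau>
      using that embn[of "snd (snd \<tau>)" "y (fst \<tau>)"] onb_norm[OF y, of "fst \<tau>"] by (auto simp: T_def)
    fix p q assume pq: "p < k * e" "q < k * e"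
    let ?F = "\<lambda>m a a'. Jc d \<Phi> (a, p mod e) (a', q mod e) * Xy m ((p div e) * d + a) * cnj (y m ((q div e) * d + a'))"
    have "id_tensor k d e \<Phi> X $$ (p, q) = (\<Sum>a<d. \<Sum>a'<d. \<Sum>m<k * d. ?F m a a')"
      unfolding id_tensor_index[OF rep pq]
    proof (intro sum.cong refl)
      fix a a' assume "a \<in> {..<d}" "a' \<in> {..<d}"
      then have "(p div e) * d + a < k * d" "(q div e) * d + a' < k * d"
        using decode_less[OF pq(1)] decode_less[OF pq(2)] by (auto intro: encode_less)
      from Xdec[OF this] show "X $$ ((p div e) * d + a, (q div e) * d + a') * Jc d \<Phi> (a, p mod e) (a', q mod e) = (\<Sum>m<k * d. ?F m a a')"
        by (simp add: sum_distrib_left sum_distrib_right mult.commute mult.left_commute)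
    qed
    also have "\<dots> = (\<Sum>m<k * d. \<Sum>a<d. \<Sum>a'<d. ?F m a a')"
      by (rule sum_rotate_out)
    also have "\<dots> = (\<Sum>m<k * d. \<Sum>a<d. \<Sum>b<e. \<Sum>a'<d. \<Sum>b'<e. Jc d \<Phi> (a, b) (a', b') * emb (Xy m) (a, b) p * cnj (emb (y m) (a', b') q))"
    proof (rule sum.cong[OF refl], rule sum.cong[OF refl])
      fix m a
      have "(\<Sum>b<e. \<Sum>a'<d. \<Sum>b'<e. Jc d \<Phi> (a, b) (a', b') * emb (Xy m) (a, b) p * cnj (emb (y m) (a', b') q)) =
         (\<Sum>b<e. \<Sum>a'<d. \<Sum>b'<e. if q mod e = b' then (if p mod e = b then ?F m a a' else 0) else 0)"
        by (intro sum.cong refl) (auto simp: emb_def)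
      also have "\<dots> = (\<Sum>b<e. \<Sum>a'<d. if p mod e = b then ?F m a a' else 0)"
        using decode_less[OF pq(2)] by simp
      also have "\<dots> = (\<Sum>a'<d. \<Sum>b<e. if p mod e = b then ?F m a a' else 0)"
        by (rule sum.swap)
      also have "\<dots> = (\<Sum>a'<d. ?F m a a')"
        using decode_less[OF pq(1)] by simp
      finally show "(\<Sum>a'<d. ?F m a a') = (\<Sum>b<e. \<Sum>a'<d. \<Sum>b'<e. Jc d \<Phi> (a, b) (a', b') * emb (Xy m) (a, b) p * cnj (emb (y m) (a', b') q))" ..
    qed
    also have "\<dots> = (\<Sum>\<tau>\<in>T. Jc d \<Phi> (fst (snd \<tau>)) (snd (snd \<tau>)) * emb (Xy (fst \<tau>)) (fst (snd \<tau>)) p * cnj (emb (y (fst \<tau>)) (snd (snd \<tau>)) q))"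
      unfolding T_def sum_pair by simp
    finally show "id_tensor k d e \<Phi> X $$ (p, q) = (\<Sum>\<tau>\<in>T. Jc d \<Phi> (fst (snd \<tau>)) (snd (snd \<tau>)) * emb (Xy (fst \<tau>)) (fst (snd \<tau>)) p * cnj (emb (y (fst \<tau>)) (snd (snd \<tau>)) q))" .
  qed
  also have "\<dots> = (\<Sum>m<k * d. \<Sum>z\<in>?D \<times> ?D. t m * cmod (Jc d \<Phi> (fst z) (snd z)))"
    unfolding T_def sum.cartesian_product'[of _ "{..<k * d}"] by (intro sum.cong refl) simp
  also have "\<dots> = (\<Sum>m<k * d. t m) * (\<Sum>z\<in>?D \<times> ?D. cmod (Jc d \<Phi> (fst z) (snd z)))"
    by (rule sum_product[symmetric])
  also have "(\<Sum>z\<in>?D \<times> ?D. cmod (Jc d \<Phi> (fst z) (snd z))) = (\<Sum>x\<in>?D. \<Sum>y\<in>?D. cmod (Jc d \<Phi> x y))"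
    unfolding sum.cartesian_product'[of _ ?D ?D] by simp
  also have "(\<Sum>m<k * d. t m) * (\<Sum>x\<in>?D. \<Sum>y\<in>?D. cmod (Jc d \<Phi> x y)) \<le> 1 * (\<Sum>x\<in>?D. \<Sum>y\<in>?D. cmod (Jc d \<Phi> x y))"
    using X1 tn by (intro mult_right_mono sum_nonneg) auto
  finally show ?thesis by simp
qed

subsection \<open>Lower bounds on the completely bounded norm\<close>

lemma cb_norm_upper:
  assumes "lin_rep d e \<Phi>" "X \<in> carrier_mat (k * d) (k * d)" "trace_norm X \<le> 1"
  shows "trace_norm (id_tensor k d e \<Phi> X) \<le> cb_norm d e \<Phi>"
  unfolding cb_norm_def
proof (rule cSup_upper)
  show "trace_norm (id_tensor k d e \<Phi> X) \<in> {trace_norm (id_tensor k d e \<Phi> X) |k X. X \<in> carrier_mat (k * d) (k * d) \<and> trace_norm X \<le> 1}"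
    using assms by blast
  show "bdd_above {trace_norm (id_tensor k d e \<Phi> X) |k X. X \<in> carrier_mat (k * d) (k * d) \<and> trace_norm X \<le> 1}"
    using trace_norm_id_tensor_le[OF assms(1)] unfolding bdd_above_def by blast
qed

lemma Jc_transpose:
  assumes "lin_rep d e \<N>" "snd x < e" "snd y < e"
  shows "Jc d (\<lambda>X. transpose_mat (\<N> X)) x y = ptB (Jc d \<N>) x y"
  using lin_repD(1)[OF assms(1) unit_mat_carrier, of "fst x" "fst y"] assms(2,3) by (simp add: Jc_def ptB_def)

lemma lin_rep_transpose:
  assumes "lin_rep d e \<N>"
  shows "lin_rep d e (\<lambda>X. transpose_mat (\<N> X))"
  unfolding lin_rep_def
proof (intro ballI conjI allI impI)
  fix X :: "complex mat" assume X: "X \<in> carrier_mat d d"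
  show c: "transpose_mat (\<N> X) \<in> carrier_mat e e" using lin_repD(1)[OF assms X] by simp
  fix b b' assume b: "b < e" "b' < e"
  show "transpose_mat (\<N> X) $$ (b, b') = (\<Sum>a<d. \<Sum>a'<d. X $$ (a, a') * Jc d (\<lambda>X. transpose_mat (\<N> X)) (a, b) (a', b'))"
    using b lin_repD(1)[OF assms X] lin_repD(2)[OF assms X b(2,1)]
    by (simp add: Jc_transpose[OF assms] ptB_def)
qed

lemma herm_out:
  assumes "finite B" "herm (A \<times> B) J"
  shows "herm (R \<times> B) (out A \<psi> J)"
  by (rule iffD1[OF herm_cong herm_pullback[OF assms(2)]]) (rule out_pullback[OF assms(1), symmetric])

lemma rp_pullback:
  "rp X (\<lambda>x y. \<Sum>i\<in>I. \<Sum>j\<in>I. L x i * M i j * cnj (L y j)) N = rp I M (\<lambda>i j. \<Sum>x\<in>X. \<Sum>y\<in>X. cnj (L x i) * N x y * L y j)"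
proof -
  let ?G = "\<lambda>x y i j. M i j * (cnj (L y j) * N y x * L x i)"
  have "(\<Sum>x\<in>X. \<Sum>y\<in>X. (\<Sum>i\<in>I. \<Sum>j\<in>I. L x i * M i j * cnj (L y j)) * N y x) = (\<Sum>x\<in>X. \<Sum>y\<in>X. \<Sum>i\<in>I. \<Sum>j\<in>I. ?G x y i j)"
    by (simp add: sum_distrib_right sum_distrib_left mult_ac)
  also have "\<dots> = (\<Sum>i\<in>I. \<Sum>j\<in>I. \<Sum>x\<in>X. \<Sum>y\<in>X. ?G x y i j)"
    by (rule sum_swap_pairs)
  also have "\<dots> = (\<Sum>i\<in>I. \<Sum>j\<in>I. \<Sum>y\<in>X. \<Sum>x\<in>X. ?G x y i j)"
    by (rule sum.cong[OF refl], rule sum.cong[OF refl], rule sum.swap)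
  finally show ?thesis unfolding rp_def by (simp only: sum_distrib_left)
qed

text \<open>The adjoint of a congruence is the congruence by the adjoint matrix, so the test
  operator can be moved from the output back to the Choi matrix.\<close>

lemma rp_out:
  fixes \<psi> :: "'r \<Rightarrow> 'a \<Rightarrow> complex"
  assumes "finite B"
  shows "rp (R \<times> B) (out A \<psi> J) N = rp (A \<times> B) J (out R (\<lambda>a r. cnj (\<psi> r a)) N)"
proof -
  define L where "L x i = \<psi> (fst x) (fst i) * idm (snd x) (snd i)" for x :: "'r \<times> 'b" and i :: "'a \<times> 'b"
  have "rp (R \<times> B) (out A \<psi> J) N = rp (R \<times> B) (\<lambda>x y. \<Sum>i\<in>A \<times> B. \<Sum>j\<in>A \<times> B. L x i * J i j * cnj (L y j)) N"
    unfolding L_def by (rule rp_cong[OF out_pullback[OF assms]]) auto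
  also have "\<dots> = rp (A \<times> B) J (\<lambda>i j. \<Sum>x\<in>R \<times> B. \<Sum>y\<in>R \<times> B. cnj (L x i) * N x y * L y j)"
    by (rule rp_pullback)
  also have "\<dots> = rp (A \<times> B) J (out R (\<lambda>a r. cnj (\<psi> r a)) N)"
  proof (rule rp_cong[OF refl])
    fix i j assume "i \<in> A \<times> B" "j \<in> A \<times> B"
    from out_pullback[OF assms this, of R "\<lambda>a r. cnj (\<psi> r a)" N]
    show "(\<Sum>x\<in>R \<times> B. \<Sum>y\<in>R \<times> B. cnj (L x i) * N x y * L y j) = out R (\<lambda>a r. cnj (\<psi> r a)) N i j"
      by (simp add: L_def idm_commute)
  qed
  finally show ?thesis .
qed

text \<open>The two amplitude matrices are inverse to each other up to conjugation, so one
  congruence undoes the other.\<close>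

lemma out_out:
  assumes fin: "finite A" and inv: "\<And>a a'. a \<in> A \<Longrightarrow> a' \<in> A \<Longrightarrow> (\<Sum>s\<in>S. cnj (\<psi> s a) * \<phi> s a') = idm a a'"
    and x: "fst x \<in> A" and y: "fst y \<in> A"
  shows "out S (\<lambda>a s. cnj (\<psi> s a)) (out A \<phi> K) x y = K x y"
proof -
  let ?K = "\<lambda>c c'. K (c, snd x) (c', snd y)"
  let ?G = "\<lambda>s s' c c'. ?K c c' * (cnj (\<psi> s (fst x)) * \<phi> s c) * (cnj (\<phi> s' c') * \<psi> s' (fst y))"
  have "out S (\<lambda>a s. cnj (\<psi> s a)) (out A \<phi> K) x y = (\<Sum>s\<in>S. \<Sum>s'\<in>S. \<Sum>c\<in>A. \<Sum>c'\<in>A. ?G s s' c c')"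
    unfolding out_def by (simp add: sum_distrib_left sum_distrib_right mult_ac)
  also have "\<dots> = (\<Sum>c\<in>A. \<Sum>c'\<in>A. \<Sum>s\<in>S. \<Sum>s'\<in>S. ?G s s' c c')"
    by (rule sum_swap_pairs)
  also have "\<dots> = (\<Sum>c\<in>A. \<Sum>c'\<in>A. ?K c c' * (\<Sum>s\<in>S. cnj (\<psi> s (fst x)) * \<phi> s c) * (\<Sum>s'\<in>S. cnj (\<phi> s' c') * \<psi> s' (fst y)))"
    unfolding sum_sandwich ..
  also have "\<dots> = (\<Sum>c\<in>A. \<Sum>c'\<in>A. ?K c c' * idm (fst x) c * idm (fst y) c')"
  proof (intro sum.cong refl)
    fix c c' assume c: "c \<in> A" "c' \<in> A"
    have "(\<Sum>s'\<in>S. cnj (\<phi> s' c') * \<psi> s' (fst y)) = cnj (\<Sum>s\<in>S. cnj (\<psi> s (fst y)) * \<phi> s c')"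
      unfolding cnj_sum by (intro sum.cong refl) (simp add: mult.commute)
    then show "?K c c' * (\<Sum>s\<in>S. cnj (\<psi> s (fst x)) * \<phi> s c) * (\<Sum>s'\<in>S. cnj (\<phi> s' c') * \<psi> s' (fst y)) = ?K c c' * idm (fst x) c * idm (fst y) c'"
      using inv[OF x c(1)] inv[OF y c(2)] by simp
  qed
  also have "\<dots> = K x y"
    by (simp only: idm_sum[OF fin y] idm_sum[OF fin x] prod.collapse)
  finally show ?thesis .
qed

lemma out_diff: "out A \<psi> (\<lambda>x y. M x y - N x y) x y = out A \<psi> M x y - out A \<psi> N x y"
  unfolding out_def by (simp add: algebra_simps sum_subtractf)

lemma out_add: "out A \<psi> (\<lambda>x y. M x y + N x y) x y = out A \<psi> M x y + out A \<psi> N x y"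
  unfolding out_def by (simp add: algebra_simps sum.distrib)

text \<open>Moving \<open>\<rho>^(1/2)\<close> from the test operator \<open>K\<close> to
  \<open>J\<close> turns \<open>J\<close> into the output on a purification of \<rho> and
  \<open>K\<close> into an operator \<open>Kh\<close> between -1 and 1. Pairing with such an
  operator is bounded by the trace norm.\<close>

lemma rp_le_cb_norm_posdef:
  assumes rep: "lin_rep d e \<Phi>" and hJ: "herm ({..<d} \<times> {..<e}) (Jc d \<Phi>)"
    and sr: "spec {..<d} \<rho> r h" and r: "\<And>s. s < d \<Longrightarrow> 0 < r s" and tr: "(\<Sum>a<d. \<rho> a a) = 1"
    and K: "herm ({..<d} \<times> {..<e}) K"
    and K1: "pos ({..<d} \<times> {..<e}) (\<lambda>x y. \<rho> (fst x) (fst y) * idm (snd x) (snd y) - K x y)"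
    and K2: "pos ({..<d} \<times> {..<e}) (\<lambda>x y. \<rho> (fst x) (fst y) * idm (snd x) (snd y) + K x y)"
  shows "rp ({..<d} \<times> {..<e}) (Jc d \<Phi>) K \<le> cb_norm d e \<Phi>"
proof -
  let ?X = "{..<d} \<times> {..<e}"
  have h: "onb {..<d} h" using sr by (rule spec_onb)
  \<comment> \<open>The reference system is taken in the eigenbasis of \<rho>, so that square roots
    of numbers suffice: the amplitude matrix \<open>\<psi>\<close> satisfies
    \<open>\<psi>^* \<psi> = \<rho>\<close>.\<close>
  define \<psi> where "\<psi> = vec (d * d) (\<lambda>p. of_real (sqrt (r (p div d))) * cnj (h (p div d) (p mod d)))"
  have \<psi>: "\<psi> \<in> carrier_vec (d * d)" by (simp add: \<psi>_def)
  have amp: "amp d \<psi> s a = of_real (sqrt (r s)) * cnj (h s a)" if "s < d" "a < d" for s a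
    using encode_less[OF that] that by (simp add: \<psi>_def encode_div_mod)
  \<comment> \<open>The inverse square root of \<rho>, with the reference in the same eigenbasis;
    this is where the eigenvalues must be positive.\<close>
  define \<phi> where "\<phi> s a = cnj (h s a) * of_real (1 / sqrt (r s))" for s a
  have sq: "complex_of_real (sqrt (r s)) * of_real (1 / sqrt (r s)) = 1" if "s < d" for s
    using r[OF that] by (simp flip: of_real_mult)
  have inv: "(\<Sum>s<d. cnj (amp d \<psi> s a) * \<phi> s a') = idm a a'" if a: "a \<in> {..<d}" "a' \<in> {..<d}" for a a'
  proof -
    have "(\<Sum>s<d. cnj (amp d \<psi> s a) * \<phi> s a') = (\<Sum>s<d. h s a * cnj (h s a'))"
    proof (intro sum.cong refl)
      fix s assume s: "s \<in> {..<d}"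
      have "cnj (amp d \<psi> s a) * \<phi> s a' = (complex_of_real (sqrt (r s)) * of_real (1 / sqrt (r s))) * (h s a * cnj (h s a'))"
        using s a by (simp add: amp \<phi>_def)
      then show "cnj (amp d \<psi> s a) * \<phi> s a' = h s a * cnj (h s a')" using sq s by simp
    qed
    then show ?thesis using h a by (simp add: onb_def)
  qed
  define Kh where "Kh = out {..<d} \<phi> K"
  \<comment> \<open>Congruence by \<phi> takes \<rho> to the identity and thereby the bounds on
    \<open>K\<close> to bounds on \<open>Kh\<close>.\<close>
  have norm: "out {..<d} \<phi> (\<lambda>x y. \<rho> (fst x) (fst y) * idm (snd x) (snd y)) x y = idm x y" if "x \<in> ?X" "y \<in> ?X" for x y
  proof -
    have s: "fst x < d" "fst y < d" using that by auto
    have "out {..<d} \<phi> (\<lambda>x y. \<rho> (fst x) (fst y) * idm (snd x) (snd y)) x y =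
      of_real (1 / sqrt (r (fst x))) * of_real (1 / sqrt (r (fst y))) * idm (snd x) (snd y) * ip {..<d} (h (fst x)) (app {..<d} \<rho> (h (fst y)))"
      unfolding out_def \<phi>_def ip_def app_def by (simp add: sum_distrib_left mult_ac)
    also have "ip {..<d} (h (fst x)) (app {..<d} \<rho> (h (fst y))) = of_real (r (fst y)) * ip {..<d} (h (fst x)) (h (fst y))"
      unfolding ip_def sum_distrib_left using s
      by (intro sum.cong refl) (simp add: app_eigen[OF _ sr])
    also have "\<dots> = of_real (r (fst y)) * idm (fst x) (fst y)"
      using h s by (simp add: onb_def)
    also have "of_real (1 / sqrt (r (fst x))) * of_real (1 / sqrt (r (fst y))) * idm (snd x) (snd y) * (of_real (r (fst y)) * idm (fst x) (fst y)) = idm x y"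
    proof (cases "fst x = fst y")
      case True
      have "1 / sqrt (r (fst y)) * (1 / sqrt (r (fst y))) * r (fst y) = 1"
        using r[OF s(2)] by (simp add: power2_eq_square[symmetric] power_divide)
      then have "complex_of_real (1 / sqrt (r (fst y))) * of_real (1 / sqrt (r (fst y))) * of_real (r (fst y)) = 1"
        by (metis of_real_1 of_real_mult)
      then show ?thesis unfolding True
        by (metis (no_types, lifting) True idm_def idm_Pair mult.assoc mult.commute mult_1 prod.collapse)
    next
      case False
      then show ?thesis by (auto simp: idm_def)
    qed
    finally show ?thesis .
  qed
  have Kh1: "pos ?X (\<lambda>x y. idm x y - Kh x y)"
    by (rule iffD1[OF pos_cong pos_out[OF _ K1, of "{..<d}" \<phi>]]) (simp_all add: out_diff norm Kh_def)
  have Kh2: "pos ?X (\<lambda>x y. idm x y + Kh x y)"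
    by (rule iffD1[OF pos_cong pos_out[OF _ K2, of "{..<d}" \<phi>]]) (simp_all add: out_add norm Kh_def)
  have hKh: "herm ?X Kh" unfolding Kh_def by (rule herm_out[OF _ K]) simp
  let ?P = "proj \<psi>"
  have Pc: "?P \<in> carrier_mat (d * d) (d * d)" using \<psi> by (simp add: proj_def)
  have "trace_norm ?P \<le> 1"
  proof -
    have "pos {..<d * d} (ent ?P)"
      by (rule iffD1[OF pos_cong pos_rank1[of _ "\<lambda>i. \<psi> $ i"]]) (use \<psi> in \<open>simp add: proj_def\<close>)
    then have "trace_norm ?P = Re (\<Sum>p<d * d. ?P $$ (p, p))" by (rule trace_norm_pos[OF Pc])
    also have "(\<Sum>p<d * d. ?P $$ (p, p)) = of_real (\<Sum>p<d * d. (cmod (\<psi> $ p))\<^sup>2)"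
      unfolding of_real_sum complex_norm_square using \<psi> by (intro sum.cong refl) (simp add: proj_def)
    also have "(\<Sum>p<d * d. (cmod (\<psi> $ p))\<^sup>2) = (\<Sum>s<d. \<Sum>a<d. (cmod (amp d \<psi> s a))\<^sup>2)"
      by (rule sum_encode)
    also have "\<dots> = (\<Sum>s<d. r s * (\<Sum>a<d. (cmod (h s a))\<^sup>2))"
      unfolding sum_distrib_left using r
      by (intro sum.cong refl) (simp add: amp norm_mult power_mult_distrib less_imp_le)
    also have "\<dots> = (\<Sum>s<d. r s)" using onb_norm[OF h] by simp
    also have "Re (complex_of_real \<dots>) = 1" using trace_spec[OF sr] tr by (metis one_complex.sel(1))
    finally show ?thesis by simp
  qed
  from cb_norm_upper[OF rep Pc this]
  have cb: "trace_norm (id_tensor d d e \<Phi> ?P) \<le> cb_norm d e \<Phi>" .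
  have idt: "id_tensor d d e \<Phi> ?P = matX d e (out {..<d} (amp d \<psi>) (Jc d \<Phi>))"
  proof (rule eq_matI)
    fix i j assume "i < dim_row (matX d e (out {..<d} (amp d \<psi>) (Jc d \<Phi>)))" "j < dim_col (matX d e (out {..<d} (amp d \<psi>) (Jc d \<Phi>)))"
    then have "i < d * e" "j < d * e" by (auto simp: matX_def)
    then show "id_tensor d d e \<Phi> ?P $$ (i, j) = matX d e (out {..<d} (amp d \<psi>) (Jc d \<Phi>)) $$ (i, j)"
      by (simp add: id_tensor_proj[OF rep \<psi>] matX_def)
  qed (simp_all add: id_tensor_def matX_def)
  have reidx: "pos {..<d * e} (\<lambda>p q. F (p div e, p mod e) (q div e, q mod e))" if "pos ?X F" for F
    by (rule pos_reindex[OF _ _ that]) (auto simp: decode_less)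
  have hM: "herm {..<d * e} (ent (matX d e (out {..<d} (amp d \<psi>) (Jc d \<Phi>))))"
    using herm_out[OF finite_lessThan hJ, of "{..<d}" "amp d \<psi>"] by (auto simp: herm_def matX_def decode_less)
  have hK': "herm {..<d * e} (\<lambda>p q. Kh (p div e, p mod e) (q div e, q mod e))"
    using hKh by (auto simp: herm_def decode_less)
  have idm_dec: "idm (p div e, p mod e) (q div e, q mod e) = idm p q" for p q :: nat
    unfolding idm_Pair by (rule idm_decode)
  have "rp ?X (out {..<d} (amp d \<psi>) (Jc d \<Phi>)) Kh =
    Re (\<Sum>p<d * e. \<Sum>q<d * e. matX d e (out {..<d} (amp d \<psi>) (Jc d \<Phi>)) $$ (p, q) * Kh (q div e, q mod e) (p div e, p mod e))"
    unfolding rp_matX[symmetric] by (simp add: matX_def[of _ _ Kh])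
  also have "\<dots> \<le> trace_norm (matX d e (out {..<d} (amp d \<psi>) (Jc d \<Phi>)))"
    using reidx[OF Kh1] reidx[OF Kh2] unfolding idm_dec
    by (intro trace_prod_le_trace_norm[OF matX_carrier hM hK'])
  also have "\<dots> \<le> cb_norm d e \<Phi>" using cb by (simp only: idt)
  also have "rp ?X (out {..<d} (amp d \<psi>) (Jc d \<Phi>)) Kh = rp ?X (Jc d \<Phi>) (out {..<d} (\<lambda>a s. cnj (amp d \<psi> s a)) Kh)"
    by (rule rp_out) simp
  also have "\<dots> = rp ?X (Jc d \<Phi>) K"
    unfolding Kh_def by (rule rp_cong[OF refl], rule out_out[OF _ inv]) auto
  finally show ?thesis .
qed

text \<open>A singular \<rho> is mixed with the maximally mixed state in proportion \<open>z\<close>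
  to \<open>1 - z\<close>. Then \<open>z * K\<close> obeys the bounds for the invertible mixture,
  and \<open>z\<close> tends to 1.\<close>

lemma rp_le_cb_norm:
  assumes rep: "lin_rep d e \<Phi>" and hJ: "herm ({..<d} \<times> {..<e}) (Jc d \<Phi>)" and d: "0 < d"
    and \<rho>: "pos {..<d} \<rho>" and tr: "(\<Sum>a<d. \<rho> a a) = 1" and K: "herm ({..<d} \<times> {..<e}) K"
    and K1: "pos ({..<d} \<times> {..<e}) (\<lambda>x y. \<rho> (fst x) (fst y) * idm (snd x) (snd y) - K x y)"
    and K2: "pos ({..<d} \<times> {..<e}) (\<lambda>x y. \<rho> (fst x) (fst y) * idm (snd x) (snd y) + K x y)"
  shows "rp ({..<d} \<times> {..<e}) (Jc d \<Phi>) K \<le> cb_norm d e \<Phi>"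
proof (rule field_le_mult_one_interval)
  let ?X = "{..<d} \<times> {..<e}"
  fix z :: real assume z: "0 < z" "z < 1"
  define c where "c = (1 - z) / d"
  have c: "c > 0" using z d by (simp add: c_def)
  obtain r h where sr: "spec {..<d} \<rho> r h" by (rule spectralE[OF finite_lessThan pos_herm[OF \<rho>]])
  define \<rho>' where "\<rho>' x y = of_real z * \<rho> x y + of_real c * idm x y" for x y
  have "spec {..<d} (\<lambda>x y. of_real z * \<rho> x y) (\<lambda>k. z * r k) h"
    using sr by (simp add: spec_def sum_distrib_left mult.assoc)
  then have sr': "spec {..<d} \<rho>' (\<lambda>k. z * r k + c) h"
    unfolding \<rho>'_def by (rule spec_shift)
  have pp: "pos ?X (\<lambda>x y. of_real c * (idm (fst x) (fst y) * idm (snd x) (snd y)))"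
    using c by (intro pos_scale pos_tensor_idm pos_idm) auto
  have "rp ?X (Jc d \<Phi>) (\<lambda>x y. of_real z * K x y) \<le> cb_norm d e \<Phi>"
  proof (rule rp_le_cb_norm_posdef[OF rep hJ sr'])
    show "0 < z * r s + c" if "s < d" for s
      using spec_nonneg[OF _ \<rho> sr, of s] that z c by (simp add: add_nonneg_pos)
    have "(\<Sum>a<d. \<rho>' a a) = of_real z * (\<Sum>a<d. \<rho> a a) + of_real (d * c)"
      unfolding \<rho>'_def by (simp add: sum.distrib sum_distrib_left idm_def)
    also have "real d * c = 1 - z" using d by (simp add: c_def)
    finally show "(\<Sum>a<d. \<rho>' a a) = 1" using tr by simp
    show "herm ?X (\<lambda>x y. of_real z * K x y)" by (rule herm_scale[OF K])
    show "pos ?X (\<lambda>x y. \<rho>' (fst x) (fst y) * idm (snd x) (snd y) - of_real z * K x y)"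
      by (rule iffD1[OF pos_cong pos_add[OF pos_scale[OF K1, of z] pp]]) (use z in \<open>simp_all add: \<rho>'_def algebra_simps\<close>)
    show "pos ?X (\<lambda>x y. \<rho>' (fst x) (fst y) * idm (snd x) (snd y) + of_real z * K x y)"
      by (rule iffD1[OF pos_cong pos_add[OF pos_scale[OF K2, of z] pp]]) (use z in \<open>simp_all add: \<rho>'_def algebra_simps\<close>)
  qed
  then show "z * rp ?X (Jc d \<Phi>) K \<le> cb_norm d e \<Phi>" by (simp add: rp_scale_right)
qed

lemma rp_le_cb_norm_transpose:
  assumes ch: "is_channel dA dB \<N>" and \<rho>: "pos {..<dA} \<rho>" "(\<Sum>a<dA. \<rho> a a) = 1" and K: "herm ({..<dA} \<times> {..<dB}) K"
    and K12: "pos ({..<dA} \<times> {..<dB}) (\<lambda>x y. \<rho> (fst x) (fst y) * idm (snd x) (snd y) - K x y)"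
     "pos ({..<dA} \<times> {..<dB}) (\<lambda>x y. \<rho> (fst x) (fst y) * idm (snd x) (snd y) + K x y)"
  shows "rp ({..<dA} \<times> {..<dB}) (ptB (Jc dA \<N>)) K \<le> cb_norm dA dB (\<lambda>X. transpose_mat (\<N> X))"
proof -
  let ?X = "{..<dA} \<times> {..<dB}"
  note rep = channel_lin_rep[OF ch]
  have eq: "Jc dA (\<lambda>X. transpose_mat (\<N> X)) x y = ptB (Jc dA \<N>) x y" if "x \<in> ?X" "y \<in> ?X" for x y
    using that by (intro Jc_transpose[OF rep]) auto
  have "herm ?X (ptB (Jc dA \<N>))" by (intro herm_ptB pos_herm channel_pos ch)
  then have "herm ?X (Jc dA (\<lambda>X. transpose_mat (\<N> X)))" using eq by (simp add: herm_def)
  moreover have "0 < dA" using ch by (simp add: is_channel_def)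
  ultimately have "rp ?X (Jc dA (\<lambda>X. transpose_mat (\<N> X))) K \<le> cb_norm dA dB (\<lambda>X. transpose_mat (\<N> X))"
    by (rule rp_le_cb_norm[OF lin_rep_transpose[OF rep] _ _ \<rho> K K12])
  moreover have "rp ?X (Jc dA (\<lambda>X. transpose_mat (\<N> X))) K = rp ?X (ptB (Jc dA \<N>)) K"
    by (rule rp_cong[OF eq refl])
  ultimately show ?thesis by simp
qed

section \<open>The chain of inequalities\<close>

text \<open>Partial transposition is an involution and self-adjoint, so \<open>Tr (J R)\<close> does
  not change when both factors are partially transposed.\<close>

lemma primal_le_cb:
  assumes ch: "is_channel dA dB \<N>" and pf: "primal_feasible {..<dA} {..<dB} R \<rho>"
  shows "rp ({..<dA} \<times> {..<dB}) (Jc dA \<N>) R \<le> cb_norm dA dB (\<lambda>X. transpose_mat (\<N> X))"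
proof -
  let ?X = "{..<dA} \<times> {..<dB}"
  have "ptB (ptB (Jc dA \<N>)) = Jc dA \<N>" by (simp add: ptB_def fun_eq_iff)
  then have "rp ?X (Jc dA \<N>) R = rp ?X (ptB (Jc dA \<N>)) (ptB R)" by (metis rp_ptB)
  also have "\<dots> \<le> cb_norm dA dB (\<lambda>X. transpose_mat (\<N> X))"
    using pf unfolding primal_feasible_def
    by (intro rp_le_cb_norm_transpose[OF ch, of \<rho>] herm_ptB pos_herm) auto
  finally show ?thesis .
qed

lemma Gamma_upper:
  assumes ch: "is_channel dA dB \<N>" and pf: "primal_feasible {..<dA} {..<dB} R \<rho>"
  shows "rp ({..<dA} \<times> {..<dB}) (Jc dA \<N>) R \<le> Gamma dA dB \<N>"
proof -
  have "0 < dB" using ch by (simp add: is_channel_def)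
  then show ?thesis unfolding Gamma_Sup[OF \<open>0 < dB\<close>]
    using pf primal_le_cb[OF ch] by (intro cSup_upper) (auto simp: bdd_above_def)
qed

text \<open>A feasible point of value 1 for every channel. It makes the supremum in
  \<open>Gamma\<close> one over a nonempty set and keeps \<Gamma> at least 1, where the logarithm
  behaves.\<close>

lemma primal_feasible_maximally_mixed:
  fixes d e :: nat
  assumes "0 < d"
  shows "primal_feasible {..<d} {..<e} (\<lambda>x y. of_real (1 / d) * idm x y) (\<lambda>x y. of_real (1 / d) * idm x y)"
proof -
  have id2: "ptB (\<lambda>x y. of_real (1 / d) * idm x y) x y = of_real (1 / d) * (idm (fst x) (fst y) * idm (snd x) (snd y))"
    for x y :: "nat \<times> nat"
    by (auto simp: ptB_def idm_def)
  have "pos ({..<d} \<times> {..<e}) (\<lambda>x y. of_real (1 / d) * idm (fst x) (fst y) * idm (snd x) (snd y) + ptB (\<lambda>x y. of_real (1 / d) * idm x y) x y)"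
    unfolding id2 mult.assoc[of "of_real (1 / d)"] by (intro pos_add pos_scale pos_tensor_idm pos_idm) auto
  moreover have "(\<Sum>a<d. of_real (1 / d) * idm a a) = (1 :: complex)"
    using assms by (simp add: idm_def)
  moreover have "pos ({..<d} \<times> {..<e}) (\<lambda>x y. of_real (1 / d) * idm (fst x) (fst y) * idm (snd x) (snd y) - ptB (\<lambda>x y. of_real (1 / d) * idm x y) x y)"
    unfolding id2 mult.assoc[of "of_real (1 / d)"] by (simp add: pos_zero)
  ultimately show ?thesis
    unfolding primal_feasible_def by (intro conjI pos_scale pos_idm) auto
qed

lemma Gamma_ge_1:
  assumes ch: "is_channel dA dB \<N>"
  shows "1 \<le> Gamma dA dB \<N>"
proof -
  let ?X = "{..<dA} \<times> {..<dB}"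
  have d: "0 < dA" using ch by (simp add: is_channel_def)
  have "(\<Sum>x\<in>?X. \<Sum>y\<in>?X. Jc dA \<N> x y * idm y x) = (\<Sum>x\<in>?X. Jc dA \<N> x x)"
    by (intro sum.cong refl) simp
  also have "\<dots> = (\<Sum>a<dA. \<Sum>b<dB. Jc dA \<N> (a, b) (a, b))" by (rule sum_pair)
  also have "\<dots> = of_nat dA" using channel_tp[OF ch] by (simp add: idm_def)
  finally have "rp ?X (Jc dA \<N>) (\<lambda>x y. of_real (1 / dA) * idm x y) = 1"
    using d unfolding rp_scale_right by (simp add: rp_def)
  then show ?thesis using Gamma_upper[OF ch primal_feasible_maximally_mixed[OF d]] by simp
qed

lemma Gamma_le:
  assumes ch: "is_channel dA dB \<N>" and ub: "\<And>R \<rho>. primal_feasible {..<dA} {..<dB} R \<rho> \<Longrightarrow> rp ({..<dA} \<times> {..<dB}) (Jc dA \<N>) R \<le> c"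
  shows "Gamma dA dB \<N> \<le> c"
proof -
  have d: "0 < dA" "0 < dB" using ch by (auto simp: is_channel_def)
  show ?thesis unfolding Gamma_Sup[OF d(2)]
    using ub primal_feasible_maximally_mixed[OF d(1)] by (intro cSup_least) blast+
qed

lemma Gamma_dual_feasible:
  assumes ch: "is_channel dA dB \<N>" and \<mu>: "Gamma dA dB \<N> < \<mu>"
  shows "dual_feasible {..<dA} {..<dB} \<mu> (Jc dA \<N>)"
proof (rule strong_duality[OF _ _ _ _ Gamma_upper[OF ch] _ \<mu>])
  show "{..<dA} \<noteq> {}" using ch by (auto simp: is_channel_def)
  show "herm ({..<dA} \<times> {..<dB}) (Jc dA \<N>)" by (rule pos_herm[OF channel_pos[OF ch]])
  show "0 \<le> Gamma dA dB \<N>" using Gamma_ge_1[OF ch] by simp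
qed auto

lemma quantum_capacity_le_Q_Gamma:
  assumes ch: "is_channel dA dB \<N>"
  shows "quantum_capacity dA dB \<N> \<le> Q_Gamma dA dB \<N>"
proof (rule field_le_epsilon)
  fix \<epsilon> :: real assume \<epsilon>: "0 < \<epsilon>"
  define \<mu> where "\<mu> = Gamma dA dB \<N> * 2 powr \<epsilon>"
  have G: "Gamma dA dB \<N> > 0" using Gamma_ge_1[OF ch] by simp
  have df: "dual_feasible {..<dA} {..<dB} \<mu> (Jc dA \<N>)"
    using G \<epsilon> by (intro Gamma_dual_feasible[OF ch]) (simp add: \<mu>_def)
  have \<mu>: "0 < \<mu>" using G by (simp add: \<mu>_def)
  have "quantum_capacity dA dB \<N> \<le> log 2 \<mu>"
  proof (rule quantum_capacity_le[OF ch df \<mu>])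
    fix n
    have "0 < dA" using ch by (simp add: is_channel_def)
    then show "coh_info (dA ^ n) (dB ^ n) (chan_pow dA dB \<N> n) \<le> n * log 2 \<mu>"
      unfolding coh_info_Sup
      using coh_info_pow_le[OF ch df \<mu>] by (intro cSup_least coh_set_nonempty) auto
  qed
  also have "log 2 \<mu> = Q_Gamma dA dB \<N> + \<epsilon>"
    using G by (simp add: \<mu>_def Q_Gamma_def log_mult)
  finally show "quantum_capacity dA dB \<N> \<le> Q_Gamma dA dB \<N> + \<epsilon>" .
qed

lemma Q_Gamma_le_Q_Theta:
  assumes ch: "is_channel dA dB \<N>"
  shows "Q_Gamma dA dB \<N> \<le> Q_Theta dA dB \<N>"
proof -
  have "Gamma dA dB \<N> \<le> cb_norm dA dB (\<lambda>X. transpose_mat (\<N> X))"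
    by (rule Gamma_le[OF ch primal_le_cb[OF ch]])
  then show ?thesis using Gamma_ge_1[OF ch] by (simp add: Q_Gamma_def Q_Theta_def)
qed

section \<open>Channels whose output equals the output of the complementary channel\<close>

lemma lin_rep_linear_map:
  assumes "lin_rep d e \<Phi>"
  shows "is_linear_map d \<Phi>"
  unfolding is_linear_map_def
proof (intro conjI ballI allI)
  fix X Y :: "complex mat" assume X: "X \<in> carrier_mat d d" and Y: "Y \<in> carrier_mat d d"
  show "\<Phi> (X + Y) = \<Phi> X + \<Phi> Y"
    by (rule eq_matI)
      (use X Y lin_repD[OF assms X] lin_repD[OF assms Y] lin_repD[OF assms add_carrier_mat[OF Y, of X]] in
        \<open>auto simp: distrib_right sum.distrib\<close>)
next
  fix X :: "complex mat" and c :: complex assume X: "X \<in> carrier_mat d d"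
  show "\<Phi> (c \<cdot>\<^sub>m X) = c \<cdot>\<^sub>m \<Phi> X"
    by (rule eq_matI)
      (use X lin_repD[OF assms X] lin_repD[OF assms smult_carrier_mat[OF X, of c]] in
        \<open>auto simp: sum_distrib_left mult.assoc\<close>)
qed

text \<open>\<open>W f b a\<close> is the entry \<open>(b, a)\<close> of the Kraus operator number
  \<open>f\<close>. There are as many Kraus operators as output dimensions, so the environment has
  the dimension of the output and the two can be exchanged.\<close>

definition kraus_map :: "nat \<Rightarrow> nat \<Rightarrow> (nat \<Rightarrow> nat \<Rightarrow> nat \<Rightarrow> complex) \<Rightarrow> complex mat \<Rightarrow> complex mat" where
  "kraus_map d e W X = mat e e (\<lambda>(b, b'). \<Sum>f<e. \<Sum>a<d. \<Sum>a'<d. W f b a * X $$ (a, a') * cnj (W f b' a'))"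

lemma kraus_map_Jc:
  assumes "fst x < d" "fst y < d" "snd x < e" "snd y < e"
  shows "Jc d (kraus_map d e W) x y = (\<Sum>f<e. W f (snd x) (fst x) * cnj (W f (snd y) (fst y)))"
proof -
  have "(\<Sum>a<d. \<Sum>a'<d. W f (snd x) a * unit_mat d (fst x) (fst y) $$ (a, a') * cnj (W f (snd y) a')) = W f (snd x) (fst x) * cnj (W f (snd y) (fst y))" for f
  proof -
    have "(\<Sum>a<d. \<Sum>a'<d. W f (snd x) a * unit_mat d (fst x) (fst y) $$ (a, a') * cnj (W f (snd y) a')) =
      (\<Sum>a<d. idm (fst x) a * (W f (snd x) a * (\<Sum>a'<d. idm (fst y) a' * cnj (W f (snd y) a'))))"
      by (simp add: unit_mat_idm sum_distrib_left mult_ac)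
    then show ?thesis using assms by simp
  qed
  then show ?thesis using assms by (simp add: Jc_def kraus_map_def)
qed

lemma kraus_map_lin_rep: "lin_rep d e (kraus_map d e W)"
  unfolding lin_rep_def
proof (intro ballI conjI allI impI)
  fix X :: "complex mat" and b b' assume b: "b < e" "b' < e"
  have "kraus_map d e W X $$ (b, b') = (\<Sum>f<e. \<Sum>a<d. \<Sum>a'<d. X $$ (a, a') * (W f b a * cnj (W f b' a')))"
    using b by (simp add: kraus_map_def mult_ac)
  also have "\<dots> = (\<Sum>a<d. \<Sum>a'<d. \<Sum>f<e. X $$ (a, a') * (W f b a * cnj (W f b' a')))"
    by (rule sum_rotate_in)
  also have "\<dots> = (\<Sum>a<d. \<Sum>a'<d. X $$ (a, a') * Jc d (kraus_map d e W) (a, b) (a', b'))"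
    using b by (intro sum.cong refl) (simp add: kraus_map_Jc sum_distrib_left)
  finally show "kraus_map d e W X $$ (b, b') = (\<Sum>a<d. \<Sum>a'<d. X $$ (a, a') * Jc d (kraus_map d e W) (a, b) (a', b'))" .
qed (simp add: kraus_map_def)

text \<open>The extended map is a sum over \<open>f\<close> of congruences by
  \<open>1 \<otimes> W f\<close>.\<close>

lemma kraus_map_cp:
  assumes "psd (k * d) X"
  shows "psd (k * e) (id_tensor k d e (kraus_map d e W) X)"
proof -
  define X' where "X' x y = X $$ (fst x * d + snd x, fst y * d + snd y)" for x y :: "nat \<times> nat"
  have X: "pos {..<k * d} (ent X)" using assms by (simp add: psd_iff_pos)
  have X': "pos ({..<k} \<times> {..<d}) X'"
    unfolding X'_def by (rule pos_reindex[OF finite_lessThan _ X]) (auto simp: encode_less)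
  define L where "L f p x = idm (p div e) (fst x) * W f (p mod e) (snd x)" for f p and x :: "nat \<times> nat"
  have "pos {..<k * e} (\<lambda>p q. \<Sum>f<e. \<Sum>x\<in>{..<k} \<times> {..<d}. \<Sum>y\<in>{..<k} \<times> {..<d}. L f p x * X' x y * cnj (L f q y))"
    by (intro pos_sum pos_pullback X')
  then have "pos {..<k * e} (ent (id_tensor k d e (kraus_map d e W) X))"
  proof (rule iffD1[OF pos_cong, rotated])
    fix p q assume "p \<in> {..<k * e}" "q \<in> {..<k * e}"
    then have pq: "p < k * e" "q < k * e" by auto
    note dp = decode_less[OF pq(1)] and dq = decode_less[OF pq(2)]
    have "(\<Sum>x\<in>{..<k} \<times> {..<d}. \<Sum>y\<in>{..<k} \<times> {..<d}. L f p x * X' x y * cnj (L f q y)) =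
      (\<Sum>a<d. \<Sum>a'<d. W f (p mod e) a * X' (p div e, a) (q div e, a') * cnj (W f (q mod e) a'))" for f
    proof -
      have "(\<Sum>x\<in>{..<k} \<times> {..<d}. \<Sum>y\<in>{..<k} \<times> {..<d}. L f p x * X' x y * cnj (L f q y)) =
        (\<Sum>r<k. idm (p div e) r * (\<Sum>a<d. \<Sum>r'<k. idm (q div e) r' * (\<Sum>a'<d. W f (p mod e) a * X' (r, a) (r', a') * cnj (W f (q mod e) a'))))"
        unfolding sum_pair L_def by (simp add: sum_distrib_left mult_ac)
      then show ?thesis using dp dq by simp
    qed
    then show "(\<Sum>f<e. \<Sum>x\<in>{..<k} \<times> {..<d}. \<Sum>y\<in>{..<k} \<times> {..<d}. L f p x * X' x y * cnj (L f q y)) =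
      ent (id_tensor k d e (kraus_map d e W) X) p q"
      using pq dp dq by (simp add: id_tensor_def kraus_map_def X'_def)
  qed
  then show ?thesis by (simp add: psd_iff_pos id_tensor_carrier)
qed

lemma kraus_map_channel:
  assumes d: "0 < d" "0 < e"
    and W: "\<And>a a'. a < d \<Longrightarrow> a' < d \<Longrightarrow> (\<Sum>b<e. \<Sum>f<e. W f b a * cnj (W f b a')) = idm a a'"
  shows "is_channel d e (kraus_map d e W)"
proof -
  note rep = kraus_map_lin_rep[of d e W]
  have tr: "mtrace (kraus_map d e W X) = mtrace X" if X: "X \<in> carrier_mat d d" for X
  proof -
    have "mtrace (kraus_map d e W X) = (\<Sum>b<e. \<Sum>a<d. \<Sum>a'<d. X $$ (a, a') * Jc d (kraus_map d e W) (a, b) (a', b))"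
      using lin_repD[OF rep X] by (simp add: mtrace_def)
    also have "\<dots> = (\<Sum>a<d. \<Sum>a'<d. \<Sum>b<e. X $$ (a, a') * Jc d (kraus_map d e W) (a, b) (a', b))"
      by (rule sum_rotate_in)
    also have "\<dots> = (\<Sum>a<d. \<Sum>a'<d. X $$ (a, a') * idm a a')"
      using W by (intro sum.cong refl) (simp add: kraus_map_Jc flip: sum_distrib_left)
    also have "\<dots> = mtrace X" using X by (simp add: mtrace_def)
    finally show ?thesis .
  qed
  show ?thesis
    unfolding is_channel_def using d lin_rep_linear_map[OF rep] lin_repD(1)[OF rep] tr kraus_map_cp by blast
qed

text \<open>The isometry into environment and output is symmetric under their exchange, so the
  channel coincides with its complementary channel. Phrasing this for Choi matrices lets it pass to
  tensor powers.\<close>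

definition sym_kraus :: "nat \<Rightarrow> nat \<Rightarrow> (nat \<times> nat \<Rightarrow> nat \<times> nat \<Rightarrow> complex) \<Rightarrow> bool" where
  "sym_kraus d e J \<longleftrightarrow> (\<exists>W. (\<forall>f b a. W f b a = W b f a) \<and>
     (\<forall>x\<in>{..<d} \<times> {..<e}. \<forall>y\<in>{..<d} \<times> {..<e}. J x y = (\<Sum>f<e. W f (snd x) (fst x) * cnj (W f (snd y) (fst y)))))"

lemma sym_kraus_tns:
  assumes "sym_kraus d1 e1 J1" "sym_kraus d2 e2 J2"
  shows "sym_kraus (d1 * d2) (e1 * e2) (tns d2 e2 J1 J2)"
proof -
  obtain W1 where W1: "\<And>f b a. W1 f b a = W1 b f a"
    "\<And>x y. x \<in> {..<d1} \<times> {..<e1} \<Longrightarrow> y \<in> {..<d1} \<times> {..<e1} \<Longrightarrow> J1 x y = (\<Sum>f<e1. W1 f (snd x) (fst x) * cnj (W1 f (snd y) (fst y)))"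
    using assms(1) unfolding sym_kraus_def by blast
  obtain W2 where W2: "\<And>f b a. W2 f b a = W2 b f a"
    "\<And>x y. x \<in> {..<d2} \<times> {..<e2} \<Longrightarrow> y \<in> {..<d2} \<times> {..<e2} \<Longrightarrow> J2 x y = (\<Sum>f<e2. W2 f (snd x) (fst x) * cnj (W2 f (snd y) (fst y)))"
    using assms(2) unfolding sym_kraus_def by blast
  define W where "W f b a = W1 (f div e2) (b div e2) (a div d2) * W2 (f mod e2) (b mod e2) (a mod d2)" for f b a
  have "W f b a = W b f a" for f b a
    unfolding W_def using W1(1)[of "f div e2"] W2(1)[of "f mod e2"] by simp
  moreover have "tns d2 e2 J1 J2 x y = (\<Sum>f<e1 * e2. W f (snd x) (fst x) * cnj (W f (snd y) (fst y)))"
    if "x \<in> {..<d1 * d2} \<times> {..<e1 * e2}" "y \<in> {..<d1 * d2} \<times> {..<e1 * e2}" for x y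
  proof -
    have "tns d2 e2 J1 J2 x y =
      (\<Sum>f<e1. W1 f (snd x div e2) (fst x div d2) * cnj (W1 f (snd y div e2) (fst y div d2))) *
      (\<Sum>f<e2. W2 f (snd x mod e2) (fst x mod d2) * cnj (W2 f (snd y mod e2) (fst y mod d2)))"
    proof -
      have "fst x < d1 * d2" "snd x < e1 * e2" "fst y < d1 * d2" "snd y < e1 * e2" using that by auto
      note dec = this[THEN decode_less]
      show ?thesis
        unfolding tns_def
        using W1(2)[of "(fst x div d2, snd x div e2)" "(fst y div d2, snd y div e2)"]
          W2(2)[of "(fst x mod d2, snd x mod e2)" "(fst y mod d2, snd y mod e2)"] dec by simp
    qed
    also have "\<dots> = (\<Sum>f<e1. \<Sum>g<e2. (W1 f (snd x div e2) (fst x div d2) * cnj (W1 f (snd y div e2) (fst y div d2))) *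
      (W2 g (snd x mod e2) (fst x mod d2) * cnj (W2 g (snd y mod e2) (fst y mod d2))))"
      by (rule sum_product)
    also have "\<dots> = (\<Sum>f<e1 * e2. (W1 (f div e2) (snd x div e2) (fst x div d2) * cnj (W1 (f div e2) (snd y div e2) (fst y div d2))) *
      (W2 (f mod e2) (snd x mod e2) (fst x mod d2) * cnj (W2 (f mod e2) (snd y mod e2) (fst y mod d2))))"
      by (rule sum_decode[symmetric])
    finally show ?thesis by (simp add: W_def mult_ac)
  qed
  ultimately show ?thesis unfolding sym_kraus_def by blast
qed

lemma sym_kraus_cong:
  assumes "sym_kraus d e J" "\<And>x y. x \<in> {..<d} \<times> {..<e} \<Longrightarrow> y \<in> {..<d} \<times> {..<e} \<Longrightarrow> J' x y = J x y"
  shows "sym_kraus d e J'"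
proof -
  obtain W where "\<forall>f b a. W f b a = W b f a"
    "\<forall>x\<in>{..<d} \<times> {..<e}. \<forall>y\<in>{..<d} \<times> {..<e}. J x y = (\<Sum>f<e. W f (snd x) (fst x) * cnj (W f (snd y) (fst y)))"
    using assms(1) unfolding sym_kraus_def by blast
  then show ?thesis unfolding sym_kraus_def using assms(2) by (intro exI[of _ W]) simp
qed

lemma sym_kraus_Jpow:
  assumes "sym_kraus d e (Jc d \<N>)"
  shows "sym_kraus (d ^ n) (e ^ n) (Jpow d e \<N> n)"
proof (induction n)
  case 0
  show ?case unfolding sym_kraus_def
    by (intro exI[of _ "\<lambda>_ _ _. 1"]) (use Jpow_0[of _ _ d e \<N>] in simp)
next
  case (Suc n)
  have "sym_kraus (d ^ Suc n) (e ^ Suc n) (tns (d ^ n) (e ^ n) (Jc d \<N>) (Jpow d e \<N> n))"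
    using sym_kraus_tns[OF assms Suc] by simp
  then show ?case by (rule sym_kraus_cong) (rule Jpow_Suc)
qed

section \<open>Entropies of complementary marginals of a pure state\<close>

lemma eta_nonneg: "0 \<le> x \<Longrightarrow> x \<le> 1 \<Longrightarrow> 0 \<le> eta x"
  by (auto simp: eta_def mult_nonneg_nonpos2 mult_le_0_iff)

text \<open>\<open>F F\<^sup>\<dagger>\<close> and \<open>F\<^sup>T F\<^sup>*\<close> have the same nonzero eigenvalues.\<close>

lemma entropy_gram_le:
  assumes fin: "finite I" "finite X"
    and sp: "spec X (\<lambda>x y. \<Sum>f\<in>I. F f x * cnj (F f y)) p e"
    and sq: "spec I (\<lambda>f g. \<Sum>x\<in>X. F f x * cnj (F g x)) q h"
    and tr: "(\<Sum>x\<in>X. \<Sum>f\<in>I. F f x * cnj (F f x)) = 1"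
  shows "(\<Sum>j\<in>I. eta (q j)) \<le> (\<Sum>i\<in>X. eta (p i))"
proof -
  define \<omega> where "\<omega> x y = (\<Sum>f\<in>I. F f x * cnj (F f y))" for x y
  define \<rho> where "\<rho> f g = (\<Sum>x\<in>X. F f x * cnj (F g x))" for f g
  have sp: "spec X \<omega> p e" using sp by (simp add: \<omega>_def[abs_def])
  have sq: "spec I \<rho> q h" using sq by (simp add: \<rho>_def[abs_def])
  have e: "onb X e" and h: "onb I h" using sp sq spec_onb by auto
  have \<omega>: "pos X \<omega>" unfolding \<omega>_def[abs_def] by (intro pos_sum pos_rank1)
  have p0: "0 \<le> p i" if "i \<in> X" for i using spec_nonneg[OF fin(2) \<omega> sp that] .
  have psum: "(\<Sum>i\<in>X. p i) = 1" using trace_spec[OF sp] tr unfolding \<omega>_def by (metis of_real_eq_1_iff)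
  have p1: "p i \<le> 1" if "i \<in> X" for i
    using member_le_sum[of i X p] p0 fin that psum by auto
  \<comment> \<open>The image of the conjugated eigenvector \<open>h j\<close>. It satisfies the
    eigenvector equation of \<omega> for the value \<open>q j\<close> and has squared length
    \<open>q j\<close>, so it vanishes exactly when \<open>q j = 0\<close>.\<close>
  define u where "u j x = (\<Sum>f\<in>I. F f x * cnj (h j f))" for j x
  have U1: "app X \<omega> (u j) x = of_real (q j) * u j x" if j: "j \<in> I" for j x
  proof -
    have "app X \<omega> (u j) x = (\<Sum>y\<in>X. \<Sum>f\<in>I. \<Sum>g\<in>I. F f x * (cnj (F f y) * F g y * cnj (h j g)))"
      unfolding app_def \<omega>_def u_def sum_product by (simp add: mult_ac)
    also have "\<dots> = (\<Sum>f\<in>I. \<Sum>g\<in>I. \<Sum>y\<in>X. F f x * (cnj (F f y) * F g y * cnj (h j g)))"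
      by (rule sum_rotate_in)
    also have "\<dots> = (\<Sum>f\<in>I. F f x * cnj (app I \<rho> (h j) f))"
      unfolding app_def \<rho>_def by (simp add: sum_distrib_left sum_distrib_right mult_ac)
    also have "\<dots> = (\<Sum>f\<in>I. of_real (q j) * (F f x * cnj (h j f)))"
      using app_eigen[OF fin(1) sq j] by (intro sum.cong refl) (simp add: mult_ac)
    finally show ?thesis unfolding u_def by (simp add: sum_distrib_left)
  qed
  have U2: "ip X (u j) (u l) = of_real (q j) * idm j l" if j: "j \<in> I" "l \<in> I" for j l
  proof -
    have "ip X (u j) (u l) = (\<Sum>x\<in>X. \<Sum>f\<in>I. \<Sum>g\<in>I. cnj (h l g) * (F g x * cnj (F f x) * h j f))"
      unfolding ip_def u_def cnj_sum sum_product by (simp add: mult_ac)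
    also have "\<dots> = (\<Sum>g\<in>I. \<Sum>x\<in>X. \<Sum>f\<in>I. cnj (h l g) * (F g x * cnj (F f x) * h j f))"
      by (rule sum_rotate_out)
    also have "\<dots> = (\<Sum>g\<in>I. \<Sum>f\<in>I. \<Sum>x\<in>X. cnj (h l g) * (F g x * cnj (F f x) * h j f))"
      by (rule sum.cong[OF refl], rule sum.swap)
    also have "\<dots> = (\<Sum>g\<in>I. cnj (h l g) * app I \<rho> (h j) g)"
      unfolding app_def \<rho>_def by (simp add: sum_distrib_left sum_distrib_right)
    also have "\<dots> = (\<Sum>g\<in>I. of_real (q j) * (cnj (h l g) * h j g))"
      using app_eigen[OF fin(1) sq j(1)] by (intro sum.cong refl) simp
    also have "\<dots> = of_real (q j) * ip I (h l) (h j)" unfolding ip_def by (simp add: sum_distrib_left)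
    finally show ?thesis using h j by (simp add: onb_def idm_commute)
  qed
  define w where "w i j = (cmod (ip X (e i) (u j)))\<^sup>2" for i j
  have w_sum: "(\<Sum>i\<in>X. w i j) = q j" if "j \<in> I" for j
  proof -
    have "complex_of_real (\<Sum>x\<in>X. (cmod (u j x))\<^sup>2) = of_real (q j)"
      using U2[OF that that] unfolding ip_self by (simp add: idm_def)
    then show ?thesis unfolding w_def parseval[OF fin(2) e] by (simp only: of_real_eq_iff)
  qed
  \<comment> \<open>Eigenvectors of a hermitian matrix for different eigenvalues are orthogonal, so
    nonzero overlaps occur between equal eigenvalues only.\<close>
  have w_eq: "p i = q j" if "i \<in> X" "j \<in> I" "w i j \<noteq> 0" for i j
  proof -
    have "of_real (p i) * ip X (e i) (u j) = ip X (app X \<omega> (e i)) (u j)"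
      unfolding ip_def sum_distrib_left using that
      by (intro sum.cong refl) (simp add: app_eigen[OF fin(2) sp])
    also have "\<dots> = ip X (e i) (app X \<omega> (u j))" by (rule ip_app_herm[OF pos_herm[OF \<omega>]])
    also have "\<dots> = of_real (q j) * ip X (e i) (u j)"
      unfolding ip_def sum_distrib_left using that U1 by (intro sum.cong refl) simp
    finally show ?thesis using that(3) by (simp add: w_def)
  qed
  define c where "c j = (if q j = 0 then 0 else 1 / q j)" for j
  have q0: "0 \<le> q j" if "j \<in> I" for j
    using w_sum[OF that] sum_nonneg[of X "\<lambda>i. w i j"] by (simp add: w_def)
  \<comment> \<open>After normalisation the nonzero \<open>u j\<close> are orthonormal, and Bessel
    bounds the weight at each \<open>i\<close>. As \<open>eta\<close> is nonnegative on the unit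
    interval, this suffices for the inequality.\<close>
  have wc: "(\<Sum>j\<in>I. w i j * c j) \<le> 1" if i: "i \<in> X" for i
  proof -
    define v where "v j x = of_real (sqrt (c j)) * u j x" for j x
    have vv: "ip X (v j) (v l) = of_real (if q j = 0 then 0 else 1) * idm j l" if "j \<in> I" "l \<in> I" for j l
    proof -
      have "ip X (v j) (v l) = of_real (sqrt (c j) * sqrt (c l)) * ip X (u j) (u l)"
        unfolding v_def ip_def by (simp add: sum_distrib_left mult_ac)
      also have "\<dots> = of_real (sqrt (c j) * sqrt (c l) * q j) * idm j l"
        unfolding U2[OF that] by simp
      also have "\<dots> = of_real (if q j = 0 then 0 else 1) * idm j l"
        using q0[OF that(1)] by (cases "j = l") (auto simp: idm_def c_def simp flip: power2_eq_square)
      finally show ?thesis .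
    qed
    have "(\<Sum>j\<in>I. (cmod (ip X (v j) (e i)))\<^sup>2) \<le> (\<Sum>x\<in>X. (cmod (e i x))\<^sup>2)"
      by (rule bessel[OF fin(1) vv]) auto
    also have "\<dots> = 1" by (rule onb_norm[OF e i])
    also have "(\<Sum>j\<in>I. (cmod (ip X (v j) (e i)))\<^sup>2) = (\<Sum>j\<in>I. w i j * c j)"
    proof (intro sum.cong refl)
      fix j assume j: "j \<in> I"
      have "ip X (v j) (e i) = of_real (sqrt (c j)) * ip X (u j) (e i)"
        unfolding v_def ip_def by (simp add: sum_distrib_left mult_ac)
      moreover have "cmod (ip X (u j) (e i)) = cmod (ip X (e i) (u j))" by (metis cnj_ip complex_mod_cnj)
      moreover have "0 \<le> c j" using q0[OF j] by (simp add: c_def)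
      ultimately show "(cmod (ip X (v j) (e i)))\<^sup>2 = w i j * c j"
        by (simp add: norm_mult power_mult_distrib w_def)
    qed
    finally show ?thesis .
  qed
  have "(\<Sum>j\<in>I. eta (q j)) = (\<Sum>j\<in>I. \<Sum>i\<in>X. w i j * c j * eta (p i))"
  proof (intro sum.cong refl)
    fix j assume j: "j \<in> I"
    have "(\<Sum>i\<in>X. w i j * c j * eta (p i)) = (\<Sum>i\<in>X. w i j * (c j * eta (q j)))"
      using w_eq[OF _ j] by (intro sum.cong refl) (metis mult.assoc mult_zero_left)
    also have "\<dots> = q j * (c j * eta (q j))" by (simp add: w_sum[OF j] flip: sum_distrib_right)
    also have "\<dots> = eta (q j)" by (simp add: c_def eta_def)
    finally show "eta (q j) = (\<Sum>i\<in>X. w i j * c j * eta (p i))" ..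
  qed
  also have "\<dots> = (\<Sum>i\<in>X. (\<Sum>j\<in>I. w i j * c j) * eta (p i))"
    unfolding sum_distrib_right by (rule sum.swap)
  also have "\<dots> \<le> (\<Sum>i\<in>X. 1 * eta (p i))"
    using wc p0 p1 by (intro sum_mono mult_right_mono eta_nonneg) auto
  finally show ?thesis by simp
qed

text \<open>The vector \<open>F\<close> is a pure state on reference, output and environment. The
  joint state of reference and output has the entropy of the environment, whose state equals that of
  the output by symmetry.\<close>

lemma coh_set_sym_kraus:
  assumes rep: "lin_rep d e \<Phi>" and pos: "pos ({..<d} \<times> {..<e}) (Jc d \<Phi>)"
    and tp: "\<And>a a'. a < d \<Longrightarrow> a' < d \<Longrightarrow> (\<Sum>b<e. Jc d \<Phi> (a, b) (a', b)) = idm a a'"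
    and sym: "sym_kraus d e (Jc d \<Phi>)" and x: "x \<in> coh_set d e \<Phi>"
  shows "x \<le> 0"
proof -
  obtain \<psi> where \<psi>: "\<psi> \<in> carrier_vec (d * d)" "\<psi> \<bullet>c \<psi> = 1"
    and x: "x = entropy (\<Phi> (ptrace_first d d (proj \<psi>))) - entropy (id_tensor d d e \<Phi> (proj \<psi>))"
    using x by (auto simp: coh_set_def)
  obtain W where W: "\<And>f b a. W f b a = W b f a"
    and J: "\<And>x y. x \<in> {..<d} \<times> {..<e} \<Longrightarrow> y \<in> {..<d} \<times> {..<e} \<Longrightarrow> Jc d \<Phi> x y = (\<Sum>f<e. W f (snd x) (fst x) * cnj (W f (snd y) (fst y)))"
    using sym unfolding sym_kraus_def by blast
  let ?X = "{..<d} \<times> {..<e}"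
  let ?o = "out {..<d} (amp d \<psi>) (Jc d \<Phi>)"
  obtain p h q f where sp: "spec ?X ?o p h" and sq: "spec {..<e} (\<lambda>b b'. \<Sum>r<d. ?o (r, b) (r, b')) q f"
    by (rule out_specs[OF pos, where k = d and \<psi> = "amp d \<psi>"], rule that) auto
  define F where "F f x = (\<Sum>a<d. amp d \<psi> (fst x) a * W f (snd x) a)" for f and x :: "nat \<times> nat"
  have o: "?o x y = (\<Sum>f<e. F f x * cnj (F f y))" if "x \<in> ?X" "y \<in> ?X" for x y
  proof -
    have "?o x y = (\<Sum>a<d. \<Sum>a'<d. \<Sum>f<e. (amp d \<psi> (fst x) a * W f (snd x) a) * cnj (amp d \<psi> (fst y) a' * W f (snd y) a'))"
      unfolding out_def using that
      by (intro sum.cong refl) (subst J, auto simp: sum_distrib_left sum_distrib_right mult.commute mult.left_commute)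
    also have "\<dots> = (\<Sum>f<e. \<Sum>a<d. \<Sum>a'<d. (amp d \<psi> (fst x) a * W f (snd x) a) * cnj (amp d \<psi> (fst y) a' * W f (snd y) a'))"
      by (rule sum_rotate_out)
    also have "\<dots> = (\<Sum>f<e. F f x * cnj (F f y))"
      unfolding F_def cnj_sum sum_product ..
    finally show ?thesis .
  qed
  have sp': "spec ?X (\<lambda>x y. \<Sum>f<e. F f x * cnj (F f y)) p h"
    by (rule iffD1[OF spec_cong sp]) (rule o)
  have Fsym: "F f (r, b) = F b (r, f)" for f r b unfolding F_def using W[of f b] by simp
  have sq': "spec {..<e} (\<lambda>b b'. \<Sum>x\<in>?X. F b x * cnj (F b' x)) q f"
  proof (rule iffD1[OF spec_cong sq])
    fix b b' assume b: "b \<in> {..<e}" "b' \<in> {..<e}"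
    have "(\<Sum>r<d. ?o (r, b) (r, b')) = (\<Sum>r<d. \<Sum>f<e. F f (r, b) * cnj (F f (r, b')))"
      using b by (intro sum.cong refl o) auto
    also have "\<dots> = (\<Sum>r<d. \<Sum>f<e. F b (r, f) * cnj (F b' (r, f)))"
      using Fsym[of _ _ b] Fsym[of _ _ b'] by simp
    finally show "(\<Sum>r<d. ?o (r, b) (r, b')) = (\<Sum>x\<in>?X. F b x * cnj (F b' x))" by (simp add: sum_pair)
  qed
  have "(\<Sum>x\<in>?X. \<Sum>f<e. F f x * cnj (F f x)) = (\<Sum>r<d. \<Sum>b<e. ?o (r, b) (r, b))"
    unfolding sum_pair by (intro sum.cong refl, subst o) auto
  also have "\<dots> = 1"
    using \<psi>(2) unfolding unit_vector_iff[OF \<psi>(1)] by (intro trace_out) (auto simp: tp)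
  finally have "(\<Sum>b<e. eta (q b)) \<le> (\<Sum>x\<in>?X. eta (p x))"
    by (intro entropy_gram_le[OF _ _ sp' sq']) auto
  then show ?thesis
    unfolding x entropy_ptrace[OF rep \<psi>(1) sq] entropy_id_tensor[OF rep \<psi>(1) sp] by simp
qed

lemma quantum_capacity_sym_kraus:
  assumes ch: "is_channel dA dB \<N>" and sym: "sym_kraus dA dB (Jc dA \<N>)"
  shows "quantum_capacity dA dB \<N> \<le> 0"
proof -
  \<comment> \<open>Any threshold above \<Gamma> will do, because the pair only secures bounded
    suprema and a convergent limit.\<close>
  have df: "dual_feasible {..<dA} {..<dB} (Gamma dA dB \<N> + 1) (Jc dA \<N>)"
    by (rule Gamma_dual_feasible[OF ch]) simp
  show ?thesis
  proof (rule quantum_capacity_le[OF ch df])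
    show "0 < Gamma dA dB \<N> + 1" using Gamma_ge_1[OF ch] by simp
    fix n
    have "0 < dA" using ch by (simp add: is_channel_def)
    moreover have "x \<le> 0" if "x \<in> coh_set (dA ^ n) (dB ^ n) (chan_pow dA dB \<N> n)" for x
      using that by (intro coh_set_sym_kraus[OF chan_pow_lin_rep Jpow_pos[OF channel_pos[OF ch]] Jpow_tp[OF channel_tp[OF ch]] sym_kraus_Jpow[OF sym]])
    ultimately show "coh_info (dA ^ n) (dB ^ n) (chan_pow dA dB \<N> n) \<le> real n * 0"
      unfolding coh_info_Sup by (simp, intro cSup_least coh_set_nonempty) auto
  qed
qed

section \<open>The amplitude damping channel with damping parameter one half\<close>

text \<open>The excitation goes to environment or output with equal amplitude:
  \<open>|1\<rangle>\<close> becomes \<open>(|01\<rangle> + |10\<rangle>) / sqrt 2\<close> and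
  \<open>|0\<rangle>\<close> becomes \<open>|00\<rangle>\<close>.\<close>

definition dampW :: "nat \<Rightarrow> nat \<Rightarrow> nat \<Rightarrow> complex" where
  "dampW f b a = (if a = 0 \<and> f = 0 \<and> b = 0 then 1 else if a = 1 \<and> f + b = 1 then of_real (1 / sqrt 2) else 0)"

abbreviation damp :: "complex mat \<Rightarrow> complex mat" where
  "damp \<equiv> kraus_map 2 2 dampW"

lemma sum_lt_2: "(\<Sum>i<2. f i) = f 0 + f (Suc 0)"
  by (simp add: numeral_2_eq_2)

lemma sqrt2_sq: "complex_of_real (sqrt 2) * of_real (sqrt 2) = 2"
  by (simp flip: of_real_mult)

lemma sqrt2_mult: "sqrt 2 * (sqrt 2 * x) = 2 * x"
  by (simp flip: mult.assoc)

lemma damp_channel: "is_channel 2 2 damp"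
proof (rule kraus_map_channel)
  fix a a' :: nat assume "a < 2" "a' < 2"
  then show "(\<Sum>b<2. \<Sum>f<2. dampW f b a * cnj (dampW f b a')) = idm a a'"
    by (auto simp: less_2_cases_iff sum_lt_2 dampW_def idm_def sqrt2_sq)
qed auto

lemma damp_sym_kraus: "sym_kraus 2 2 (Jc 2 damp)"
  unfolding sym_kraus_def
proof (intro exI[of _ dampW] conjI allI ballI)
  show "dampW f b a = dampW b f a" for f b a by (auto simp: dampW_def add.commute)
  show "Jc 2 damp x y = (\<Sum>f<2. dampW f (snd x) (fst x) * cnj (dampW f (snd y) (fst y)))"
    if "x \<in> {..<2} \<times> {..<2}" "y \<in> {..<2} \<times> {..<2}" for x y
    using that by (intro kraus_map_Jc) auto
qed

text \<open>The Choi matrix is the sum of the projections onto the Kraus vectors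
  \<open>|00\<rangle> + |11\<rangle> / sqrt 2\<close> and
  \<open>|10\<rangle> / sqrt 2\<close>.\<close>

lemma rp_damp:
  "rp ({..<2} \<times> {..<2}) (Jc 2 damp) R = Re (R (0,0) (0,0)) + Re (R (1,1) (1,1)) / 2 + Re (R (1,0) (1,0)) / 2
     + (Re (R (0,0) (1,1)) + Re (R (1,1) (0,0))) / sqrt 2"
  unfolding rp_def sum_pair sum_lt_2
  by (simp add: kraus_map_Jc sum_lt_2 dampW_def sqrt2_sq sqrt2_mult field_simps)

text \<open>The quadratic form at a real combination of two basis vectors. The case
  \<open>z = w\<close> is included and yields the diagonal entries.\<close>

lemma pos_two:
  assumes "finite X" "pos X M" "z \<in> X" "w \<in> X"
  shows "0 \<le> \<alpha>\<^sup>2 * Re (M z z) + \<beta>\<^sup>2 * Re (M w w) + \<alpha> * \<beta> * (Re (M z w) + Re (M w z))"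
proof -
  have "pos UNIV (\<lambda>a b. M (if a then z else w) (if b then z else w))"
    by (rule pos_reindex[OF assms(1) _ assms(2)]) (use assms in auto)
  from pos_qf[OF this, of "\<lambda>b. of_real (if b then \<alpha> else \<beta>)"] show ?thesis
    by (simp add: qf_def UNIV_bool power2_eq_square algebra_simps)
qed

lemma pos_diag:
  assumes "finite X" "pos X M" "z \<in> X"
  shows "0 \<le> Re (M z z)"
  using pos_two[OF assms(1,2,3,3), of 1 0] by simp

text \<open>The witness is the maximally entangled state with maximally mixed \<rho>: its partial
  transpose is half the swap operator, which lies between plus and minus one half of the identity.
  The value is \<open>3 / 4 + 1 / sqrt 2\<close>.\<close>

lemma Gamma_damp_gt: "1 < Gamma 2 2 damp"
proof -
  define R where "R x y = complex_of_real (1 / 2) * (idm (fst x) (snd x) * cnj (idm (fst y) (snd y)))" for x y :: "nat \<times> nat"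
  define \<rho> where "\<rho> x y = complex_of_real (1 / 2) * idm x y" for x y :: nat
  let ?X = "{..<2::nat} \<times> {..<2::nat}"
  have red: "pos ?X (\<lambda>x y. \<rho> (fst x) (fst y) * idm (snd x) (snd y) + of_real \<epsilon> * ptB R x y)" if "\<epsilon> = 1 \<or> \<epsilon> = -1" for \<epsilon> :: real
  proof -
    have "pos ?X (\<lambda>x y. of_real (1 / 2) * (idm (fst x) (fst y) * (\<Sum>s<2. idm s (snd y) * cnj (idm s (snd x)))
       + of_real \<epsilon> * (idm (fst x) (snd y) * cnj (idm (fst y) (snd x)))))"
      using pos_reduction_rank1[of "{..<2}" "{..<2}" \<epsilon> "\<lambda>x. idm (fst x) (snd x)"] that
      by (intro pos_scale) auto
    then show ?thesis
    proof (rule iffD1[OF pos_cong, rotated])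
      fix x y assume "x \<in> ?X" "y \<in> ?X"
      then have "snd x < 2" "snd y < 2" by auto
      then have "(\<Sum>s<2. idm s (snd y) * cnj (idm s (snd x))) = idm (snd x) (snd y)"
        by (simp add: idm_commute)
      then show "of_real (1 / 2) * (idm (fst x) (fst y) * (\<Sum>s<2. idm s (snd y) * cnj (idm s (snd x)))
       + of_real \<epsilon> * (idm (fst x) (snd y) * cnj (idm (fst y) (snd x)))) =
        \<rho> (fst x) (fst y) * idm (snd x) (snd y) + of_real \<epsilon> * ptB R x y"
        by (simp add: \<rho>_def R_def ptB_def algebra_simps)
    qed
  qed
  have "pos ?X R" unfolding R_def[abs_def] by (intro pos_scale pos_rank1) simp
  moreover have "pos {..<2} \<rho>" unfolding \<rho>_def[abs_def] by (intro pos_scale pos_idm) auto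
  moreover have "(\<Sum>a<2. \<rho> a a) = 1" by (simp add: \<rho>_def idm_def)
  ultimately have "primal_feasible {..<2} {..<2} R \<rho>"
    unfolding primal_feasible_def using red[of 1] red[of "-1"] by simp
  from Gamma_upper[OF damp_channel this] have "rp ?X (Jc 2 damp) R \<le> Gamma 2 2 damp" .
  moreover have "rp ?X (Jc 2 damp) R = 3 / 4 + 1 / sqrt 2"
    unfolding rp_damp by (simp add: R_def idm_def)
  moreover have "1 / 4 < 1 / sqrt 2"
    using real_sqrt_less_mono[of 2 16] by (simp add: field_simps)
  ultimately show ?thesis by linarith
qed

text \<open>A dual certificate in scalar form: the upper bound on the partial transpose is tested at
  three vectors, which leaves \<open>3 / 2\<close> times the trace of \<rho> and nonpositive
  multiples of diagonal entries of \<open>R\<close>.\<close>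

lemma Gamma_damp_le: "Gamma 2 2 damp \<le> 3 / 2"
proof (rule Gamma_le[OF damp_channel])
  fix R \<rho> assume pf: "primal_feasible {..<2::nat} {..<2::nat} R \<rho>"
  let ?X = "{..<2::nat} \<times> {..<2::nat}"
  let ?C = "\<lambda>x y. \<rho> (fst x) (fst y) * idm (snd x) (snd y) - ptB R x y"
  have R: "pos ?X R" and C: "pos ?X ?C" and tr: "(\<Sum>a<2. \<rho> a a) = 1"
    using pf by (auto simp: primal_feasible_def)
  have fin: "finite ?X" by simp
  have arith: "a + b / 2 + d / 2 + s \<le> 3 / 2"
    if "a \<le> r0" "b \<le> r1" "0 \<le> c" "0 \<le> d" "s \<le> (r0 - c) / 2 + (r1 - d)" "r0 + r1 = 1" for a b c d s r0 r1 :: real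
    using that unfolding diff_divide_distrib by linarith
  define S where "S = (Re (R (0,0) (1,1)) + Re (R (1,1) (0,0))) / sqrt 2"
  have "0 \<le> Re (?C (0,0) (0,0))" "0 \<le> Re (?C (1,1) (1,1))"
    by (rule pos_diag[OF fin C]; simp)+
  then have "Re (R (0,0) (0,0)) \<le> Re (\<rho> 0 0)" "Re (R (1,1) (1,1)) \<le> Re (\<rho> 1 1)"
    by (simp_all add: ptB_def idm_def del: One_nat_def)
  moreover have "0 \<le> Re (R (0,1) (0,1))" "0 \<le> Re (R (1,0) (1,0))"
    by (rule pos_diag[OF fin R]; simp)+
  \<comment> \<open>The vector \<open>|01\<rangle> / sqrt 2 + |10\<rangle>\<close> reproduces the
    coefficient \<open>1 / sqrt 2\<close> of the coherences and gives \<open>Re (\<rho> 0 0)\<close>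
    and \<open>Re (\<rho> 1 1)\<close> the weights \<open>1 / 2\<close> and 1, which complete the
    weights 1 and \<open>1 / 2\<close> of the diagonal terms to \<open>3 / 2\<close> each.\<close>
  moreover have "0 \<le> (1 / sqrt 2)\<^sup>2 * Re (?C (0,1) (0,1)) + 1\<^sup>2 * Re (?C (1,0) (1,0)) + 1 / sqrt 2 * 1 * (Re (?C (0,1) (1,0)) + Re (?C (1,0) (0,1)))"
    by (rule pos_two[OF fin C]) auto
  then have "S \<le>
      (Re (\<rho> 0 0) - Re (R (0,1) (0,1))) / 2 + (Re (\<rho> 1 1) - Re (R (1,0) (1,0)))"
    by (simp add: S_def ptB_def idm_def power_divide add_divide_distrib diff_divide_distrib del: One_nat_def)
  moreover have "Re (\<rho> 0 0) + Re (\<rho> 1 1) = 1"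
    using arg_cong[OF tr, of Re] by (simp add: sum_lt_2)
  ultimately show "rp ?X (Jc 2 damp) R \<le> 3 / 2"
    unfolding rp_damp S_def[symmetric] by (rule arith)
qed

text \<open>The test operator has the negative diagonal entry \<open>- 14 / 75\<close>. Partial
  transposition preserves it, so \<open>K\<close> is not the partial transpose of a positive
  \<open>R\<close>: exactly the freedom that \<Gamma> excludes.\<close>

lemma cb_norm_damp_gt: "3 / 2 < cb_norm 2 2 (\<lambda>X. transpose_mat (damp X))"
proof -
  let ?X = "{..<2::nat} \<times> {..<2::nat}"
  \<comment> \<open>On \<open>|00\<rangle>\<close>, \<open>|11\<rangle>\<close> the operator reaches
    its upper bound. On \<open>|01\<rangle>\<close>, \<open>|10\<rangle>\<close>, after removing the
    square roots of \<open>2 / 3\<close> and \<open>1 / 3\<close>, it is the reflection with rows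
    \<open>(- 7, 24) / 25\<close> and \<open>(24, 7) / 25\<close>. The Pythagorean triple
    approximates the optimal reflection for this \<rho>, whose entries involve the square root of
    17.\<close>
  define K :: "nat \<times> nat \<Rightarrow> nat \<times> nat \<Rightarrow> complex" where
    "K x y = (if x = (0,0) \<and> y = (0,0) then 2 / 3 else if x = (1,1) \<and> y = (1,1) then 1 / 3
      else if x = (0,1) \<and> y = (0,1) then - 14 / 75 else if x = (1,0) \<and> y = (1,0) then 7 / 75
      else if x = (0,1) \<and> y = (1,0) \<or> x = (1,0) \<and> y = (0,1) then 8 * of_real (sqrt 2) / 25 else 0)" for x y
  define \<rho> :: "nat \<Rightarrow> nat \<Rightarrow> complex" where "\<rho> a b = (if a = b then if a = 0 then 2 / 3 else 1 / 3 else 0)" for a b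
  have cases: "z = (0,0) \<or> z = (0,1) \<or> z = (1,0) \<or> z = (1,1)" if "z \<in> ?X" for z
    using that by (auto simp: less_2_cases_iff)
  \<comment> \<open>A reflection differs from plus and minus the identity by rank one, so on this
    block both bounds are certified by a single vector each, \<open>u1\<close> for the upper and
    \<open>u2\<close> for the lower.\<close>
  define u1 :: "nat \<times> nat \<Rightarrow> complex" where "u1 z = (if z = (0,1) then 8 else if z = (1,0) then - 3 * of_real (sqrt 2) else 0)" for z
  define u2 :: "nat \<times> nat \<Rightarrow> complex" where "u2 z = (if z = (0,1) then 6 else if z = (1,0) then 4 * of_real (sqrt 2) else 0)" for z
  have "pos ?X (\<lambda>x y. of_real (1 / 75) * (u1 x * cnj (u1 y)))"
    by (intro pos_scale pos_rank1) simp
  then have K1: "pos ?X (\<lambda>x y. \<rho> (fst x) (fst y) * idm (snd x) (snd y) - K x y)"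
  proof (rule iffD1[OF pos_cong, rotated])
    fix x y assume "x \<in> ?X" "y \<in> ?X"
    from cases[OF this(1)] cases[OF this(2)]
    show "of_real (1 / 75) * (u1 x * cnj (u1 y)) = \<rho> (fst x) (fst y) * idm (snd x) (snd y) - K x y"
      by (elim disjE) (simp_all add: K_def \<rho>_def u1_def idm_def sqrt2_sq)
  qed
  \<comment> \<open>On \<open>|00\<rangle>\<close> and \<open>|11\<rangle>\<close> the operator
    equals its upper bound, so the sum is twice \<open>2 / 3\<close> and twice
    \<open>1 / 3\<close>.\<close>
  have "pos ?X (\<lambda>x y. of_real (1 / 75) * (u2 x * cnj (u2 y)) + (of_real (4 / 3) * (idm (0,0) x * cnj (idm (0,0) y)) + of_real (2 / 3) * (idm (1,1) x * cnj (idm (1,1) y))))"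
    by (intro pos_add pos_scale pos_rank1) simp_all
  then have K2: "pos ?X (\<lambda>x y. \<rho> (fst x) (fst y) * idm (snd x) (snd y) + K x y)"
  proof (rule iffD1[OF pos_cong, rotated])
    fix x y assume "x \<in> ?X" "y \<in> ?X"
    from cases[OF this(1)] cases[OF this(2)]
    show "of_real (1 / 75) * (u2 x * cnj (u2 y)) + (of_real (4 / 3) * (idm (0,0) x * cnj (idm (0,0) y)) + of_real (2 / 3) * (idm (1,1) x * cnj (idm (1,1) y))) = \<rho> (fst x) (fst y) * idm (snd x) (snd y) + K x y"
      by (elim disjE) (simp_all add: K_def \<rho>_def u2_def idm_def sqrt2_sq)
  qed
  have "herm ?X K" by (auto simp: herm_def K_def)
  moreover have "pos {..<2} \<rho>"
  proof -
    have "pos {..<2} (\<lambda>a b. of_real (2 / 3) * (idm 0 a * cnj (idm 0 b)) + of_real (1 / 3) * (idm 1 a * cnj (idm 1 b)))"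
      by (intro pos_add pos_scale pos_rank1) simp_all
    then show ?thesis
      by (rule iffD1[OF pos_cong, rotated]) (auto simp: \<rho>_def idm_def less_2_cases_iff)
  qed
  moreover have "(\<Sum>a<2. \<rho> a a) = 1" by (simp add: sum_lt_2 \<rho>_def)
  ultimately have "rp ?X (ptB (Jc 2 damp)) K \<le> cb_norm 2 2 (\<lambda>X. transpose_mat (damp X))"
    using K1 K2 by (intro rp_le_cb_norm_transpose[OF damp_channel, of \<rho>]) auto
  moreover have "rp ?X (ptB (Jc 2 damp)) K = 38 / 25"
    unfolding rp_ptB rp_damp by (simp add: ptB_def K_def field_simps)
  ultimately show ?thesis by simp
qed

theorem theorem4:
  shows "(\<forall>dA dB \<N>. is_channel dA dB \<N> \<longrightarrow>
            quantum_capacity dA dB \<N> \<le> Q_Gamma dA dB \<N> \<and>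
            Q_Gamma dA dB \<N> \<le> Q_Theta dA dB \<N>) \<and>
         (\<exists>dA dB \<N>. is_channel dA dB \<N> \<and> quantum_capacity dA dB \<N> < Q_Gamma dA dB \<N>) \<and>
         (\<exists>dA dB \<N>. is_channel dA dB \<N> \<and> Q_Gamma dA dB \<N> < Q_Theta dA dB \<N>)"
proof (intro conjI allI impI)
  show "quantum_capacity dA dB \<N> \<le> Q_Gamma dA dB \<N>" if "is_channel dA dB \<N>" for dA dB \<N>
    using that by (rule quantum_capacity_le_Q_Gamma)
  show "Q_Gamma dA dB \<N> \<le> Q_Theta dA dB \<N>" if "is_channel dA dB \<N>" for dA dB \<N>
    using that by (rule Q_Gamma_le_Q_Theta)
  have "quantum_capacity 2 2 damp \<le> 0" by (rule quantum_capacity_sym_kraus[OF damp_channel damp_sym_kraus])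
  also have "0 < Q_Gamma 2 2 damp" using Gamma_damp_gt by (simp add: Q_Gamma_def)
  finally show "\<exists>dA dB \<N>. is_channel dA dB \<N> \<and> quantum_capacity dA dB \<N> < Q_Gamma dA dB \<N>"
    using damp_channel by blast
  have "Q_Gamma 2 2 damp < Q_Theta 2 2 damp"
    using Gamma_damp_gt Gamma_damp_le cb_norm_damp_gt by (simp add: Q_Gamma_def Q_Theta_def)
  then show "\<exists>dA dB \<N>. is_channel dA dB \<N> \<and> Q_Gamma dA dB \<N> < Q_Theta dA dB \<N>"
    using damp_channel by blast
qed

end
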